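(* Let $A$ be an NGAS algebra. Then $A$ is a weak finitistic Auslander algebra in each of the following cases: \begin{enumerate} \item The full subcategory $P^{<\infty}(A)$ of $A$-modules of finite projective dimension is contravariantly finite in $\mathrm{mod}\text{-}A$. \item $A$ is representation-finite. \item $A$ is Gorenstein. \end{enumerate}
   Context: $K$ is a field. An algebra means a finite dimensional connected non-semisimple basic $K$-algebra; modules are finite dimensional right modules, and $\mathrm{mod}\text{-}A$ is their category; $D=\mathrm{Hom}_K(-,K)$. Dominant dimension of a module $N$ with minimal injective coresolution $0\to N\to I_0\to I_1\to\cdots$: it is $0$ if $I_0$ is not projective, and otherwise $\sup\{n \mid I_i \text{ is projective for } i=0,\dots,n\}+1$. The dominant dimension of an algebra is that of its regular module. The finitistic dimension of $A$ is the supremum of the projective dimensions of all modules in $\mathrm{mod}\text{-}A$ of finite projective dimension. An NGAS algebra (also written NASG) is a non-selfinjective algebra of dominant dimension at least one that has at most one (equivalently, exactly one) indecomposable projective non-injective module up to isomorphism. A weak finitistic Auslander algebra is an algebra of positive dominant dimension that is equal to its finitistic dimension. A subcategory $C$ of $\mathrm{mod}\text{-}A$ is contravariantly finite if every $X\in\mathrm{mod}\text{-}A$ has a minimal right $C$-approximation, i.e. a right minimal map $f:N\to X$ with $N\in C$ such that $\mathrm{Hom}_A(L,f)$ is surjective for all $L\in C$. $A$ is Gorenstein if the injective dimension of $A$ and the projective dimension of $D(A)$ are equal and finite. *)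

theory Defs
  imports Complex_Main "HOL-Library.Function_Algebras" "HOL-Library.Extended_Nat"
begin

section \<open>Right modules over a ring\<close>

text \<open>
  The ring is the whole type \<open>'a\<close>. The underlying group of a right module is an additive
  subgroup of an ambient abelian group \<open>'m\<close>, so that submodules of a module and \<open>e A \<subseteq> A\<close> share
  the ambient type. Maps between modules are only relevant on the carrier of their source.
\<close>

record ('a, 'm) rmodule =
  carrier :: "'m set"
  act :: "'m \<Rightarrow> 'a \<Rightarrow> 'm"

definition right_module :: "('a::ring_1, 'm::ab_group_add) rmodule \<Rightarrow> bool" where
  "right_module M \<longleftrightarrow>
     0 \<in> carrier M \<and>
     (\<forall>x\<in>carrier M. \<forall>y\<in>carrier M. x - y \<in> carrier M) \<and>
     (\<forall>x\<in>carrier M. \<forall>a. act M x a \<in> carrier M) \<and>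
     (\<forall>x\<in>carrier M. \<forall>y\<in>carrier M. \<forall>a. act M (x + y) a = act M x a + act M y a) \<and>
     (\<forall>x\<in>carrier M. \<forall>a b. act M x (a + b) = act M x a + act M x b) \<and>
     (\<forall>x\<in>carrier M. \<forall>a b. act M x (a * b) = act M (act M x a) b) \<and>
     (\<forall>x\<in>carrier M. act M x 1 = x)"

definition submodule :: "'m::ab_group_add set \<Rightarrow> ('a::ring_1, 'm) rmodule \<Rightarrow> bool" where
  "submodule U M \<longleftrightarrow> U \<subseteq> carrier M \<and> right_module (M\<lparr>carrier := U\<rparr>)"

definition module_hom ::
  "('a::ring_1, 'm::ab_group_add) rmodule \<Rightarrow> ('a, 'n::ab_group_add) rmodule \<Rightarrow> ('m \<Rightarrow> 'n) \<Rightarrow> bool"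
  where
  "module_hom M N f \<longleftrightarrow>
     (\<forall>x\<in>carrier M. f x \<in> carrier N) \<and>
     (\<forall>x\<in>carrier M. \<forall>y\<in>carrier M. f (x + y) = f x + f y) \<and>
     (\<forall>x\<in>carrier M. \<forall>a. f (act M x a) = act N (f x) a)"

definition module_iso ::
  "('a::ring_1, 'm::ab_group_add) rmodule \<Rightarrow> ('a, 'n::ab_group_add) rmodule \<Rightarrow> ('m \<Rightarrow> 'n) \<Rightarrow> bool"
  where
  "module_iso M N f \<longleftrightarrow> module_hom M N f \<and> bij_betw f (carrier M) (carrier N)"

definition isomorphic ::
  "('a::ring_1, 'm::ab_group_add) rmodule \<Rightarrow> ('a, 'n::ab_group_add) rmodule \<Rightarrow> bool"
  where
  "isomorphic M N \<longleftrightarrow> (\<exists>f. module_iso M N f)"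

definition module_ker ::
  "('a::ring_1, 'm::ab_group_add) rmodule \<Rightarrow> ('m \<Rightarrow> 'n::ab_group_add) \<Rightarrow> 'm set" where
  "module_ker M f = {x \<in> carrier M. f x = 0}"

definition internal_direct_sum ::
  "('a::ring_1, 'm::ab_group_add) rmodule \<Rightarrow> 'm set \<Rightarrow> 'm set \<Rightarrow> bool" where
  "internal_direct_sum M U V \<longleftrightarrow>
     submodule U M \<and> submodule V M \<and> U \<inter> V = {0} \<and> carrier M = {u + v |u v. u \<in> U \<and> v \<in> V}"

definition indecomposable :: "('a::ring_1, 'm::ab_group_add) rmodule \<Rightarrow> bool" where
  "indecomposable M \<longleftrightarrow>
     carrier M \<noteq> {0} \<and> (\<forall>U V. internal_direct_sum M U V \<longrightarrow> U = {0} \<or> V = {0})"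

definition semisimple_module :: "('a::ring_1, 'm::ab_group_add) rmodule \<Rightarrow> bool" where
  "semisimple_module M \<longleftrightarrow> (\<forall>U. submodule U M \<longrightarrow> (\<exists>V. internal_direct_sum M U V))"

definition essential :: "'m::ab_group_add set \<Rightarrow> ('a::ring_1, 'm) rmodule \<Rightarrow> bool" where
  "essential U M \<longleftrightarrow>
     submodule U M \<and> (\<forall>V. submodule V M \<and> V \<noteq> {0} \<longrightarrow> U \<inter> V \<noteq> {0})"

definition regular_module :: "('a::ring_1, 'a) rmodule" where
  "regular_module = \<lparr>carrier = UNIV, act = (*)\<rparr>"

definition idempotent_module :: "'a::ring_1 \<Rightarrow> ('a, 'a) rmodule" where
  "idempotent_module e = \<lparr>carrier = range ((*) e), act = (*)\<rparr>"


section \<open>Idempotents\<close>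

definition idempotent :: "'a::ring_1 \<Rightarrow> bool" where
  "idempotent e \<longleftrightarrow> e * e = e"

definition orthogonal :: "'a::ring_1 \<Rightarrow> 'a \<Rightarrow> bool" where
  "orthogonal e f \<longleftrightarrow> e * f = 0 \<and> f * e = 0"

definition primitive :: "'a::ring_1 \<Rightarrow> bool" where
  "primitive e \<longleftrightarrow> idempotent e \<and> e \<noteq> 0 \<and>
     (\<forall>f g. idempotent f \<and> idempotent g \<and> orthogonal f g \<and> e = f + g \<longrightarrow> f = 0 \<or> g = 0)"

definition complete_primitive_orthogonal :: "'a::ring_1 set \<Rightarrow> bool" where
  "complete_primitive_orthogonal E \<longleftrightarrow>
     finite E \<and> (\<forall>e\<in>E. primitive e) \<and>
     (\<forall>e\<in>E. \<forall>f\<in>E. e \<noteq> f \<longrightarrow> orthogonal e f) \<and> \<Sum>E = 1"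


section \<open>Finite dimensional algebras and their modules\<close>

locale fd_algebra = vector_space scale
  for scale :: "'k::field \<Rightarrow> 'a::ring_1 \<Rightarrow> 'a" +
  assumes scale_mult_left: "scale c a * b = scale c (a * b)"
    and scale_mult_right: "a * scale c b = scale c (a * b)"
    and finite_dimensional: "\<exists>B. finite B \<and> span B = UNIV"
begin

definition basic :: bool where
  "basic \<longleftrightarrow> (\<exists>E :: 'a set. complete_primitive_orthogonal E \<and>
     (\<forall>e\<in>E. \<forall>f\<in>E. e \<noteq> f \<longrightarrow> \<not> isomorphic (idempotent_module e) (idempotent_module f)))"

definition connected :: bool where
  "connected \<longleftrightarrow> (\<forall>e::'a. idempotent e \<and> (\<forall>a. e * a = a * e) \<longrightarrow> e = 0 \<or> e = 1)"

definition semisimple :: bool where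
  "semisimple \<longleftrightarrow> semisimple_module (regular_module :: ('a, 'a) rmodule)"

text \<open>The \<open>K\<close>-vector space structure of a module is \<open>c x = x (c 1)\<close>.\<close>

definition fd_module :: "('a, 'm::ab_group_add) rmodule \<Rightarrow> bool" where
  "fd_module M \<longleftrightarrow> right_module M \<and>
     (\<exists>S. finite S \<and> S \<subseteq> carrier M \<and>
        (\<forall>x\<in>carrier M. \<exists>c. x = (\<Sum>s\<in>S. act M s (scale (c s) 1))))"

text \<open>
  Quantification over all of mod-\<open>A\<close> is quantification over the finite dimensional modules whose
  carrier lies in \<open>nat \<Rightarrow> 'k\<close>. As this type contains \<open>K\<^sup>n\<close> for every \<open>n\<close>, every finite
  dimensional right \<open>A\<close>-module is isomorphic to one of these. Notions that apply to a given module
  (such as \<open>A\<close> or \<open>D(A)\<close>) remain polymorphic in its ambient type.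
\<close>

definition mod_cat :: "('a, nat \<Rightarrow> 'k) rmodule set" where
  "mod_cat = {M. fd_module M}"

definition projective :: "('a, 'm::ab_group_add) rmodule \<Rightarrow> bool" where
  "projective P \<longleftrightarrow> fd_module P \<and>
     (\<forall>M\<in>mod_cat. \<forall>N\<in>mod_cat. \<forall>p g.
        module_hom M N p \<and> p ` carrier M = carrier N \<and> module_hom P N g \<longrightarrow>
        (\<exists>h. module_hom P M h \<and> (\<forall>x\<in>carrier P. p (h x) = g x)))"

definition injective :: "('a, 'm::ab_group_add) rmodule \<Rightarrow> bool" where
  "injective I \<longleftrightarrow> fd_module I \<and>
     (\<forall>M\<in>mod_cat. \<forall>N\<in>mod_cat. \<forall>j g.
        module_hom M N j \<and> inj_on j (carrier M) \<and> module_hom M I g \<longrightarrow>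
        (\<exists>h. module_hom N I h \<and> (\<forall>x\<in>carrier M. h (j x) = g x)))"


section \<open>Resolutions and homological dimensions\<close>

text \<open>\<open>0 \<rightarrow> N \<rightarrow> I 0 \<rightarrow> I 1 \<rightarrow> \<dots>\<close> with maps \<open>\<epsilon>, d 0, d 1, \<dots>\<close>\<close>

definition injective_coresolution ::
  "('a, 'm::ab_group_add) rmodule \<Rightarrow> (nat \<Rightarrow> ('a, nat \<Rightarrow> 'k) rmodule) \<Rightarrow>
   ('m \<Rightarrow> nat \<Rightarrow> 'k) \<Rightarrow> (nat \<Rightarrow> (nat \<Rightarrow> 'k) \<Rightarrow> nat \<Rightarrow> 'k) \<Rightarrow> bool" where
  "injective_coresolution N I \<epsilon> d \<longleftrightarrow>
     (\<forall>i. injective (I i)) \<and>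
     module_hom N (I 0) \<epsilon> \<and> (\<forall>i. module_hom (I i) (I (Suc i)) (d i)) \<and>
     inj_on \<epsilon> (carrier N) \<and>
     \<epsilon> ` carrier N = module_ker (I 0) (d 0) \<and>
     (\<forall>i. d i ` carrier (I i) = module_ker (I (Suc i)) (d (Suc i)))"

definition minimal_injective_coresolution ::
  "('a, 'm::ab_group_add) rmodule \<Rightarrow> (nat \<Rightarrow> ('a, nat \<Rightarrow> 'k) rmodule) \<Rightarrow>
   ('m \<Rightarrow> nat \<Rightarrow> 'k) \<Rightarrow> (nat \<Rightarrow> (nat \<Rightarrow> 'k) \<Rightarrow> nat \<Rightarrow> 'k) \<Rightarrow> bool" where
  "minimal_injective_coresolution N I \<epsilon> d \<longleftrightarrow>
     injective_coresolution N I \<epsilon> d \<and>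
     essential (\<epsilon> ` carrier N) (I 0) \<and>
     (\<forall>i. essential (d i ` carrier (I i)) (I (Suc i)))"

text \<open>\<open>\<dots> \<rightarrow> P 1 \<rightarrow> P 0 \<rightarrow> M \<rightarrow> 0\<close> with maps \<open>\<dots>, d 1, d 0, \<epsilon>\<close>\<close>

definition projective_resolution ::
  "('a, 'm::ab_group_add) rmodule \<Rightarrow> (nat \<Rightarrow> ('a, nat \<Rightarrow> 'k) rmodule) \<Rightarrow>
   ((nat \<Rightarrow> 'k) \<Rightarrow> 'm) \<Rightarrow> (nat \<Rightarrow> (nat \<Rightarrow> 'k) \<Rightarrow> nat \<Rightarrow> 'k) \<Rightarrow> bool" where
  "projective_resolution M P \<epsilon> d \<longleftrightarrow>
     (\<forall>i. projective (P i)) \<and>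
     module_hom (P 0) M \<epsilon> \<and> (\<forall>i. module_hom (P (Suc i)) (P i) (d i)) \<and>
     \<epsilon> ` carrier (P 0) = carrier M \<and>
     d 0 ` carrier (P 1) = module_ker (P 0) \<epsilon> \<and>
     (\<forall>i. d (Suc i) ` carrier (P (Suc (Suc i))) = module_ker (P (Suc i)) (d i))"

text \<open>
  The dimensions below are the least length of a resolution; they are \<open>\<infinity>\<close> if there is no finite
  one, since \<open>Inf {} = \<infinity>\<close> in \<^typ>\<open>enat\<close>.
\<close>

definition projdim :: "('a, 'm::ab_group_add) rmodule \<Rightarrow> enat" where
  "projdim M = Inf {enat n |n. \<exists>P \<epsilon> d. projective_resolution M P \<epsilon> d \<and>
     (\<forall>i>n. carrier (P i) = {0})}"

definition injdim :: "('a, 'm::ab_group_add) rmodule \<Rightarrow> enat" where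
  "injdim M = Inf {enat n |n. \<exists>I \<epsilon> d. injective_coresolution M I \<epsilon> d \<and>
     (\<forall>i>n. carrier (I i) = {0})}"

text \<open>The minimal injective coresolution is unique only up to isomorphism, hence the choice.\<close>

definition domdim :: "('a, 'm::ab_group_add) rmodule \<Rightarrow> enat" where
  "domdim N =
     (let I = (SOME I. \<exists>\<epsilon> d. minimal_injective_coresolution N I \<epsilon> d)
      in if \<not> projective (I 0) then 0
         else Sup {enat n |n. \<forall>i\<le>n. projective (I i)} + 1)"

definition dominant_dimension :: enat where
  "dominant_dimension = domdim (regular_module :: ('a, 'a) rmodule)"

definition P_fin :: "('a, nat \<Rightarrow> 'k) rmodule set" where
  "P_fin = {M \<in> mod_cat. projdim M < \<infinity>}"

definition finitistic_dimension :: enat where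
  "finitistic_dimension = Sup (projdim ` P_fin)"


section \<open>Classes of algebras\<close>

definition selfinjective :: bool where
  "selfinjective \<longleftrightarrow> injective (regular_module :: ('a, 'a) rmodule)"

text \<open>Finite dimensional algebras are moreover assumed connected, non-semisimple and basic.\<close>

definition standing_assumptions :: bool where
  "standing_assumptions \<longleftrightarrow> connected \<and> \<not> semisimple \<and> basic"

definition NGAS :: bool where
  "NGAS \<longleftrightarrow> standing_assumptions \<and> \<not> selfinjective \<and> dominant_dimension \<ge> 1 \<and>
     (\<forall>P\<in>mod_cat. \<forall>Q\<in>mod_cat.
        indecomposable P \<and> projective P \<and> \<not> injective P \<and>
        indecomposable Q \<and> projective Q \<and> \<not> injective Q \<longrightarrow> isomorphic P Q)"

definition weak_finitistic_Auslander :: bool where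
  "weak_finitistic_Auslander \<longleftrightarrow> standing_assumptions \<and>
     dominant_dimension > 0 \<and> dominant_dimension = finitistic_dimension"

definition right_minimal ::
  "('a, nat \<Rightarrow> 'k) rmodule \<Rightarrow> ((nat \<Rightarrow> 'k) \<Rightarrow> nat \<Rightarrow> 'k) \<Rightarrow> bool" where
  "right_minimal N f \<longleftrightarrow>
     (\<forall>g. module_hom N N g \<and> (\<forall>x\<in>carrier N. f (g x) = f x) \<longrightarrow> module_iso N N g)"

definition minimal_right_approximation ::
  "('a, nat \<Rightarrow> 'k) rmodule set \<Rightarrow> ('a, nat \<Rightarrow> 'k) rmodule \<Rightarrow> ('a, nat \<Rightarrow> 'k) rmodule \<Rightarrow>
   ((nat \<Rightarrow> 'k) \<Rightarrow> nat \<Rightarrow> 'k) \<Rightarrow> bool" where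
  "minimal_right_approximation C X N f \<longleftrightarrow>
     N \<in> C \<and> module_hom N X f \<and> right_minimal N f \<and>
     (\<forall>L\<in>C. \<forall>h. module_hom L X h \<longrightarrow>
        (\<exists>g. module_hom L N g \<and> (\<forall>x\<in>carrier L. f (g x) = h x)))"

definition contravariantly_finite :: "('a, nat \<Rightarrow> 'k) rmodule set \<Rightarrow> bool" where
  "contravariantly_finite C \<longleftrightarrow> (\<forall>X\<in>mod_cat. \<exists>N f. minimal_right_approximation C X N f)"

definition representation_finite :: bool where
  "representation_finite \<longleftrightarrow>
     (\<exists>S. finite S \<and> S \<subseteq> mod_cat \<and>
        (\<forall>M\<in>mod_cat. indecomposable M \<longrightarrow> (\<exists>N\<in>S. isomorphic M N)))"

text \<open>\<open>D(A) = Hom\<^sub>K(A, K)\<close>, the dual of the left regular module: \<open>(f a)(x) = f (a x)\<close>.\<close>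

definition dual_module :: "('a, 'a \<Rightarrow> 'k) rmodule" where
  "dual_module = \<lparr>carrier = {f. Vector_Spaces.linear scale (*) f}, act = (\<lambda>f a x. f (a * x))\<rparr>"

definition Gorenstein :: bool where
  "Gorenstein \<longleftrightarrow>
     injdim (regular_module :: ('a, 'a) rmodule) = projdim dual_module \<and>
     projdim dual_module < \<infinity>"

end

end

theory Submission
  imports Defs
begin

text \<open>
  Let \<open>I\<close> be the minimal injective coresolution of \<open>A\<close>, let \<open>C n\<close> be the kernel of \<open>I n \<rightarrow> I (n + 1)\<close>, and
  let \<open>m\<close> be least with \<open>I m\<close> not projective, so that \<open>m\<close> is the dominant dimension. Read from the right,
  the coresolution shows that \<open>C m\<close> has projective dimension exactly \<open>m\<close>, since \<open>A = C 0\<close> is not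
  injective.

  Suppose that some module has finite projective dimension greater than \<open>m\<close>. It has a syzygy \<open>W\<close> of
  projective dimension one, with projective cover \<open>R\<close> and projective, small, non-injective kernel
  \<open>K \<subseteq> R\<close>, and \<open>W\<close> is an \<open>i\<close>-th syzygy for all \<open>i \<le> m\<close>. In the minimal projective resolution
  \<open>P\<close> of \<open>I m\<close>, as long as \<open>P 0, \<dots>, P (i - 1)\<close> are injective, \<open>Ext\<^sup>1 (W, \<Omega>\<^sup>i (I m)) = 0\<close> by dimension
  shifting. If \<open>P i\<close> were not injective, then \<open>K\<close> and \<open>P i\<close> would share the unique projective
  non-injective indecomposable as a summand; the resulting map \<open>K \<rightarrow> P i\<close> agrees, modulo the small
  kernel of \<open>P i \<rightarrow> \<Omega>\<^sup>i (I m)\<close>, with the restriction of a map \<open>R \<rightarrow> P i\<close>, so its image would be small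
  as well as contain a summand of \<open>P i\<close>. Hence \<open>P 0, \<dots>, P m\<close> are injective. As \<open>C m\<close> has
  projective dimension at most \<open>m\<close>, its inclusion into \<open>I m\<close> then lifts to \<open>P 0\<close>, which makes the
  injective hull \<open>I m\<close> of \<open>C m\<close> a summand of \<open>P 0\<close>, a contradiction.
\<close>

section \<open>Modules and homomorphisms\<close>

lemma
  assumes "right_module M"
  shows rm_zero: "0 \<in> carrier M"
    and rm_diff: "x \<in> carrier M \<Longrightarrow> y \<in> carrier M \<Longrightarrow> x - y \<in> carrier M"
    and rm_act: "x \<in> carrier M \<Longrightarrow> act M x a \<in> carrier M"
    and act_add_left: "x \<in> carrier M \<Longrightarrow> y \<in> carrier M \<Longrightarrow> act M (x + y) a = act M x a + act M y a"
    and act_add_right: "x \<in> carrier M \<Longrightarrow> act M x (a + b) = act M x a + act M x b"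
    and act_mult: "x \<in> carrier M \<Longrightarrow> act M x (a * b) = act M (act M x a) b"
    and act_one: "x \<in> carrier M \<Longrightarrow> act M x 1 = x"
  using assms unfolding right_module_def by auto

lemma
  assumes M: "right_module M"
  shows rm_add: "x \<in> carrier M \<Longrightarrow> y \<in> carrier M \<Longrightarrow> x + y \<in> carrier M"
    and act_zero_left: "act M 0 a = 0"
    and act_zero_right: "x \<in> carrier M \<Longrightarrow> act M x 0 = 0"
    and act_diff_left: "x \<in> carrier M \<Longrightarrow> y \<in> carrier M \<Longrightarrow> act M (x - y) a = act M x a - act M y a"
proof -
  have um: "- x \<in> carrier M" if "x \<in> carrier M" for x
    using rm_diff[OF M rm_zero[OF M] that] by simp
  show "x + y \<in> carrier M" if "x \<in> carrier M" "y \<in> carrier M"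
    using rm_diff[OF M that(1) um[OF that(2)]] by simp
  show "act M 0 a = 0"
    using act_add_left[OF M rm_zero[OF M] rm_zero[OF M], of a] by simp
  show "act M x 0 = 0" if "x \<in> carrier M"
    using act_add_right[OF M that, of 0 0] by simp
  show "act M (x - y) a = act M x a - act M y a" if "x \<in> carrier M" "y \<in> carrier M"
    using act_add_left[OF M rm_diff[OF M that] that(2), of a] by simp
qed

lemma rm_sum: "right_module M \<Longrightarrow> (\<And>s. s \<in> S \<Longrightarrow> f s \<in> carrier M) \<Longrightarrow> sum f S \<in> carrier M"
  by (induction S rule: infinite_finite_induct) (auto intro: rm_zero rm_add)

section \<open>Submodules\<close>

lemma submodule_iff:
  assumes "right_module M"
  shows "submodule U M \<longleftrightarrow> U \<subseteq> carrier M \<and> 0 \<in> U \<and> (\<forall>x\<in>U. \<forall>y\<in>U. x - y \<in> U) \<and>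
    (\<forall>x\<in>U. \<forall>a. act M x a \<in> U)"
  using assms unfolding submodule_def right_module_def by (auto simp: subset_iff)

lemma submodule_module: "submodule U M \<Longrightarrow> right_module (M\<lparr>carrier := U\<rparr>)"
  by (simp add: submodule_def)

lemma submodule_subset: "submodule U M \<Longrightarrow> U \<subseteq> carrier M"
  by (simp add: submodule_def)

lemma submodule_carrier: "right_module M \<Longrightarrow> submodule (carrier M) M"
  by (simp add: submodule_def)

lemma submodule_zero: "right_module M \<Longrightarrow> submodule {0} M"
  by (simp add: submodule_iff rm_zero act_zero_left)

lemma submodule_trans: "submodule U M \<Longrightarrow> submodule V (M\<lparr>carrier := U\<rparr>) \<Longrightarrow> submodule V M"
  by (auto simp: submodule_def)

lemma submodule_restrict: "submodule V M \<Longrightarrow> V \<subseteq> U \<Longrightarrow> submodule V (M\<lparr>carrier := U\<rparr>)"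
  by (auto simp: submodule_def)

lemma
  assumes "submodule U M"
  shows sub_zero: "0 \<in> U"
    and sub_diff: "x \<in> U \<Longrightarrow> y \<in> U \<Longrightarrow> x - y \<in> U"
    and sub_add: "x \<in> U \<Longrightarrow> y \<in> U \<Longrightarrow> x + y \<in> U"
    and sub_act: "x \<in> U \<Longrightarrow> act M x a \<in> U"
  using rm_zero[OF submodule_module[OF assms]] rm_diff[OF submodule_module[OF assms]]
    rm_add[OF submodule_module[OF assms]] rm_act[OF submodule_module[OF assms]] by auto

section \<open>Homomorphisms, kernels and images\<close>

lemma
  assumes "module_hom M N f"
  shows hom_in: "x \<in> carrier M \<Longrightarrow> f x \<in> carrier N"
    and hom_add: "x \<in> carrier M \<Longrightarrow> y \<in> carrier M \<Longrightarrow> f (x + y) = f x + f y"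
    and hom_act: "x \<in> carrier M \<Longrightarrow> f (act M x a) = act N (f x) a"
  using assms unfolding module_hom_def by auto

lemma
  assumes M: "right_module M" and f: "module_hom M N f"
  shows hom_zero: "f 0 = 0"
    and hom_diff: "x \<in> carrier M \<Longrightarrow> y \<in> carrier M \<Longrightarrow> f (x - y) = f x - f y"
proof -
  show "f 0 = 0"
    using hom_add[OF f rm_zero[OF M] rm_zero[OF M]] by simp
  show "f (x - y) = f x - f y" if "x \<in> carrier M" "y \<in> carrier M"
    using hom_add[OF f rm_diff[OF M that] that(2)] by simp
qed

lemma hom_inj_iff:
  assumes M: "right_module M" and f: "module_hom M N f"
  shows "inj_on f (carrier M) \<longleftrightarrow> (\<forall>x\<in>carrier M. f x = 0 \<longrightarrow> x = 0)"
proof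
  assume "inj_on f (carrier M)"
  then show "\<forall>x\<in>carrier M. f x = 0 \<longrightarrow> x = 0"
    using hom_zero[OF M f] rm_zero[OF M] by (metis inj_onD)
next
  assume *: "\<forall>x\<in>carrier M. f x = 0 \<longrightarrow> x = 0"
  show "inj_on f (carrier M)"
  proof (rule inj_onI)
    fix x y assume "x \<in> carrier M" "y \<in> carrier M" "f x = f y"
    then show "x = y" using * hom_diff[OF M f, of x y] rm_diff[OF M, of x y] by auto
  qed
qed

lemma hom_compose: "module_hom M N f \<Longrightarrow> module_hom N L g \<Longrightarrow> module_hom M L (\<lambda>x. g (f x))"
  by (simp add: module_hom_def)

lemma hom_id: "module_hom M M (\<lambda>x. x)"
  by (simp add: module_hom_def)

lemma hom_const_zero: "right_module N \<Longrightarrow> module_hom M N (\<lambda>x. 0)"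
  by (simp add: module_hom_def rm_zero act_zero_left)

lemma hom_plus:
  "right_module N \<Longrightarrow> module_hom M N f \<Longrightarrow> module_hom M N g \<Longrightarrow> module_hom M N (\<lambda>x. f x + g x)"
  by (auto simp: module_hom_def rm_add act_add_left algebra_simps)

lemma hom_minus:
  "right_module N \<Longrightarrow> module_hom M N f \<Longrightarrow> module_hom M N g \<Longrightarrow> module_hom M N (\<lambda>x. f x - g x)"
  by (auto simp: module_hom_def rm_diff act_diff_left algebra_simps)

lemma hom_restrict: "module_hom M N f \<Longrightarrow> U \<subseteq> carrier M \<Longrightarrow> module_hom (M\<lparr>carrier := U\<rparr>) N f"
  by (simp add: module_hom_def subset_iff)

lemma hom_into: "module_hom M N f \<Longrightarrow> f ` carrier M \<subseteq> U \<Longrightarrow> module_hom M (N\<lparr>carrier := U\<rparr>) f"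
  by (auto simp: module_hom_def)

lemma hom_from_into: "module_hom M (N\<lparr>carrier := U\<rparr>) f \<Longrightarrow> U \<subseteq> carrier N \<Longrightarrow> module_hom M N f"
  by (auto simp: module_hom_def)

lemma hom_incl: "U \<subseteq> carrier M \<Longrightarrow> module_hom (M\<lparr>carrier := U\<rparr>) M (\<lambda>x. x)"
  by (auto simp: module_hom_def)

lemma ker_iff: "x \<in> module_ker M f \<longleftrightarrow> x \<in> carrier M \<and> f x = 0"
  by (simp add: module_ker_def)

lemma ker_subset: "module_ker M f \<subseteq> carrier M"
  by (auto simp: ker_iff)

lemma submodule_vimage:
  assumes M: "right_module M" and N: "right_module N" and f: "module_hom M N f" and U: "submodule U N"
  shows "submodule {x \<in> carrier M. f x \<in> U} M"
  using assms by (auto simp: submodule_iff[OF M] rm_zero rm_diff rm_act hom_zero hom_diff hom_act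
      intro: sub_zero sub_diff sub_act)

lemma submodule_ker:
  assumes M: "right_module M" and N: "right_module N" and f: "module_hom M N f"
  shows "submodule (module_ker M f) M"
  using submodule_vimage[OF assms submodule_zero[OF N]] by (simp add: module_ker_def)

lemma submodule_image:
  assumes M: "right_module M" and N: "right_module N" and f: "module_hom M N f" and U: "submodule U M"
  shows "submodule (f ` U) N"
proof -
  have U': "U \<subseteq> carrier M" by (rule submodule_subset[OF U])
  show ?thesis
    unfolding submodule_iff[OF N]
  proof (intro conjI ballI allI)
    show "f ` U \<subseteq> carrier N" using U' hom_in[OF f] by auto
    show "0 \<in> f ` U" using hom_zero[OF M f] sub_zero[OF U] by (metis imageI)
  next
    fix x y assume "x \<in> f ` U" "y \<in> f ` U"
    then obtain u v where *: "u \<in> U" "v \<in> U" "x = f u" "y = f v" by auto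
    then have "x - y = f (u - v)" using hom_diff[OF M f] U' by (metis subsetD)
    then show "x - y \<in> f ` U" using sub_diff[OF U] * by auto
  next
    fix x a assume "x \<in> f ` U"
    then obtain u where *: "u \<in> U" "x = f u" by auto
    then have "act N x a = f (act M u a)" using hom_act[OF f] U' by (metis subsetD)
    then show "act N x a \<in> f ` U" using sub_act[OF U] * by auto
  qed
qed

lemma submodule_range:
  "right_module M \<Longrightarrow> right_module N \<Longrightarrow> module_hom M N f \<Longrightarrow> submodule (f ` carrier M) N"
  by (rule submodule_image) (auto intro: submodule_carrier)

section \<open>Sums of submodules, projections and induced maps\<close>

definition sum_of :: "'m::ab_group_add set \<Rightarrow> 'm set \<Rightarrow> 'm set" where
  "sum_of U V = {u + v |u v. u \<in> U \<and> v \<in> V}"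

lemma sum_ofI: "u \<in> U \<Longrightarrow> v \<in> V \<Longrightarrow> u + v \<in> sum_of U V"
  by (auto simp: sum_of_def)

lemma sum_ofE: "x \<in> sum_of U V \<Longrightarrow> (\<And>u v. u \<in> U \<Longrightarrow> v \<in> V \<Longrightarrow> x = u + v \<Longrightarrow> P) \<Longrightarrow> P"
  by (auto simp: sum_of_def)

lemma submodule_sum_of:
  assumes M: "right_module M" and U: "submodule U M" and V: "submodule V M"
  shows "submodule (sum_of U V) M"
proof -
  have sub: "U \<subseteq> carrier M" "V \<subseteq> carrier M" using U V by (auto dest: submodule_subset)
  show ?thesis
    unfolding submodule_iff[OF M]
  proof (intro conjI ballI allI)
    show "sum_of U V \<subseteq> carrier M" using sub by (auto simp: sum_of_def intro!: rm_add[OF M])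
    show "0 \<in> sum_of U V" using sum_ofI[OF sub_zero[OF U] sub_zero[OF V]] by simp
  next
    fix x y assume "x \<in> sum_of U V" "y \<in> sum_of U V"
    then obtain u v u' v' where *: "u \<in> U" "v \<in> V" "x = u + v" "u' \<in> U" "v' \<in> V" "y = u' + v'"
      by (auto elim!: sum_ofE)
    then have "x - y = (u - u') + (v - v')" by simp
    then show "x - y \<in> sum_of U V" using sum_ofI sub_diff[OF U] sub_diff[OF V] * by metis
  next
    fix x a assume "x \<in> sum_of U V"
    then obtain u v where *: "u \<in> U" "v \<in> V" "x = u + v" by (auto elim!: sum_ofE)
    then have "act M x a = act M u a + act M v a" using act_add_left[OF M] sub by blast
    then show "act M x a \<in> sum_of U V" using sum_ofI sub_act[OF U] sub_act[OF V] * by metis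
  qed
qed

lemma sum_of_supersets:
  assumes "submodule U M" "submodule V M"
  shows "U \<subseteq> sum_of U V" and "V \<subseteq> sum_of U V"
proof -
  show "U \<subseteq> sum_of U V" using sum_ofI[OF _ sub_zero[OF assms(2)]] by fastforce
  show "V \<subseteq> sum_of U V" using sum_ofI[OF sub_zero[OF assms(1)]] by fastforce
qed

text \<open>Independence makes the \<open>U\<close>-component of an element of the sum unique, so
  choosing one yields an additive map. Its domain is the sum and not all of \<open>M\<close>; the
  hull construction extends it from there by injectivity.\<close>

lemma independent_projection:
  assumes M: "right_module M" and U: "submodule U M" and V: "submodule V M" and UV: "U \<inter> V \<subseteq> {0}"
  obtains g where "module_hom (M\<lparr>carrier := sum_of U V\<rparr>) (M\<lparr>carrier := U\<rparr>) g"
    "\<forall>u\<in>U. g u = u" "\<forall>v\<in>V. g v = 0"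
proof -
  have sub: "U \<subseteq> carrier M" "V \<subseteq> carrier M" using U V by (auto dest: submodule_subset)
  define g where "g x = (SOME u. u \<in> U \<and> x - u \<in> V)" for x
  have g: "g x = u" if "u \<in> U" "x - u \<in> V" for x u
  proof -
    have *: "g x \<in> U \<and> x - g x \<in> V" unfolding g_def by (rule someI[of _ u]) (use that in blast)
    \<comment> \<open>Two candidates for the component differ by an element of \<open>V\<close> and
      of \<open>U\<close>, hence by zero.\<close>
    have "(x - u) - (x - g x) \<in> V" by (rule sub_diff[OF V]) (use that * in blast)+
    then have "g x - u \<in> V" by (simp add: algebra_simps)
    moreover have "g x - u \<in> U" by (rule sub_diff[OF U]) (use that * in blast)+
    ultimately show ?thesis using UV by auto
  qed
  have gsum: "g (u + v) = u" if "u \<in> U" "v \<in> V" for u v by (rule g) (use that in auto)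
  have "module_hom (M\<lparr>carrier := sum_of U V\<rparr>) (M\<lparr>carrier := U\<rparr>) g"
    unfolding module_hom_def
  proof (intro conjI ballI allI; simp)
    fix x assume "x \<in> sum_of U V"
    then obtain u v where uv: "u \<in> U" "v \<in> V" "x = u + v" by (rule sum_ofE)
    then show "g x \<in> U" by (simp add: gsum)
    have "act M x a = act M u a + act M v a" for a
      unfolding uv(3) by (rule act_add_left[OF M]) (use uv sub in auto)
    then show "g (act M x a) = act M (g x) a" for a
      using uv by (simp add: gsum sub_act[OF U] sub_act[OF V])
    fix y assume "y \<in> sum_of U V"
    then obtain u' v' where uv': "u' \<in> U" "v' \<in> V" "y = u' + v'" by (rule sum_ofE)
    have "g (x + y) = g ((u + u') + (v + v'))" by (simp add: uv uv' algebra_simps)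
    also have "\<dots> = u + u'" by (rule gsum) (use uv uv' sub_add[OF U] sub_add[OF V] in auto)
    finally show "g (x + y) = g x + g y" using uv uv' by (simp add: gsum)
  qed
  moreover have "g u = u" if "u \<in> U" for u using gsum[OF that sub_zero[OF V]] by simp
  moreover have "g v = 0" if "v \<in> V" for v using gsum[OF sub_zero[OF U] that] by simp
  ultimately show ?thesis using that by blast
qed

lemma iso_inverse:
  assumes M: "right_module M" and f: "module_iso M N f"
  obtains g where "module_iso N M g" "\<forall>x\<in>carrier M. g (f x) = x" "\<forall>y\<in>carrier N. f (g y) = y"
proof -
  define g where "g = inv_into (carrier M) f"
  have h: "module_hom M N f" and b: "bij_betw f (carrier M) (carrier N)"
    using f by (auto simp: module_iso_def)
  have gf: "g (f x) = x" if "x \<in> carrier M" for x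
    using b that by (simp add: g_def bij_betw_def)
  have fg: "f (g y) = y" if "y \<in> carrier N" for y
    using b that by (metis bij_betw_imp_surj_on f_inv_into_f g_def)
  have gin: "g y \<in> carrier M" if "y \<in> carrier N" for y
    using b that by (metis bij_betw_imp_surj_on inv_into_into g_def)
  have add: "g (x + y) = g x + g y" if "x \<in> carrier N" "y \<in> carrier N" for x y
  proof -
    have "f (g x + g y) = x + y" using hom_add[OF h] gin fg that by metis
    then show ?thesis using gf rm_add[OF M] gin that by metis
  qed
  have "g (act N x a) = act M (g x) a" if "x \<in> carrier N" for x a
  proof -
    have "f (act M (g x) a) = act N x a" using hom_act[OF h] gin fg that by metis
    then show ?thesis using gf rm_act[OF M] gin that by metis
  qed
  then have "module_hom N M g" using gin add by (simp add: module_hom_def)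
  moreover have "bij_betw g (carrier N) (carrier M)"
    unfolding g_def by (rule bij_betw_inv_into[OF b])
  ultimately show ?thesis using that gf fg by (auto simp: module_iso_def)
qed

lemma iso_sym: "right_module M \<Longrightarrow> isomorphic M N \<Longrightarrow> isomorphic N M"
  by (metis isomorphic_def iso_inverse)

text \<open>Two preimages under \<open>p\<close> differ by an element of its kernel, where
  \<open>f\<close> vanishes; hence any choice of preimage gives the same value.\<close>

lemma hom_factor:
  assumes R: "right_module R" and p: "module_hom R X p" "p ` carrier R = carrier X"
    and f: "module_hom R Y f" and ker: "\<And>x. x \<in> carrier R \<Longrightarrow> p x = 0 \<Longrightarrow> f x = 0"
  obtains g where "module_hom X Y g" "\<forall>x\<in>carrier R. g (p x) = f x"
proof -
  define g where "g = (\<lambda>y. f (inv_into (carrier R) p y))"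
  have gp: "g (p x) = f x" if x: "x \<in> carrier R" for x
  proof -
    define z where "z = inv_into (carrier R) p (p x)"
    have z: "z \<in> carrier R" "p z = p x"
      using x by (auto simp: z_def inv_into_into f_inv_into_f)
    have "f (z - x) = 0"
      using ker[OF rm_diff[OF R z(1) x]] hom_diff[OF R p(1) z(1) x] z(2) by simp
    then have "f z = f x" using hom_diff[OF R f z(1) x] by simp
    then show ?thesis by (simp add: g_def z_def)
  qed
  have "module_hom X Y g"
    unfolding module_hom_def p(2)[symmetric]
    using gp by (auto simp: hom_add[OF p(1), symmetric] hom_act[OF p(1), symmetric] rm_add[OF R]
        rm_act[OF R] hom_in[OF f] hom_add[OF f] hom_act[OF f])
  then show ?thesis using that gp by auto
qed

text \<open>A direct summand up to isomorphism, expressed by maps so that the two modules may have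
  different ambient types.\<close>

definition retract ::
  "('a::ring_1, 'm::ab_group_add) rmodule \<Rightarrow> ('a, 'n::ab_group_add) rmodule \<Rightarrow> bool" where
  "retract M X \<longleftrightarrow> (\<exists>i r. module_hom M X i \<and> module_hom X M r \<and> (\<forall>x\<in>carrier M. r (i x) = x))"

lemma isomorphic_retract: "right_module M \<Longrightarrow> isomorphic M N \<Longrightarrow> retract M N"
  by (metis retract_def isomorphic_def iso_inverse module_iso_def)

section \<open>Small submodules\<close>

definition small :: "'m::ab_group_add set \<Rightarrow> ('a::ring_1, 'm) rmodule \<Rightarrow> bool" where
  "small U M \<longleftrightarrow> (\<forall>L. submodule L M \<and> carrier M \<subseteq> sum_of U L \<longrightarrow> L = carrier M)"

lemma small_image:
  assumes M: "right_module M" and N: "right_module N" and f: "module_hom M N f"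
    and U: "small U M" "U \<subseteq> carrier M"
  shows "small (f ` U) N"
  unfolding small_def
proof (intro allI impI)
  fix L assume *: "submodule L N \<and> carrier N \<subseteq> sum_of (f ` U) L"
  define L' where "L' = {x \<in> carrier M. f x \<in> L}"
  have L': "submodule L' M"
    unfolding L'_def using submodule_vimage[OF M N f] * by blast
  have "carrier M \<subseteq> sum_of U L'"
  proof
    fix x assume x: "x \<in> carrier M"
    then obtain u l where u: "u \<in> U" "l \<in> L" "f x = f u + l"
      using * hom_in[OF f x] by (fastforce elim: sum_ofE)
    then have "f (x - u) = l" using hom_diff[OF M f x, of u] U(2) by auto
    then have "x - u \<in> L'" using u U(2) x rm_diff[OF M] by (auto simp: L'_def)
    then show "x \<in> sum_of U L'" using sum_ofI[OF u(1)] by fastforce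
  qed
  then have "L' = carrier M" using U(1) L' by (auto simp: small_def)
  then have "f ` U \<subseteq> L" using U(2) by (auto simp: L'_def)
  then have "sum_of (f ` U) L \<subseteq> L" using sub_add[of L N] * by (auto simp: sum_of_def)
  then show "L = carrier N" using * submodule_subset by blast
qed

text \<open>If \<open>W\<close> and \<open>L\<close> generate \<open>M\<close>, then so do
  \<open>U\<close> and \<open>V + L\<close>. Drop \<open>U\<close> first, which leaves
  \<open>V + L\<close>, and then \<open>V\<close>.\<close>

lemma small_subset_sum:
  assumes M: "right_module M" and U: "small U M" and V: "small V M" "submodule V M"
    and W: "W \<subseteq> sum_of U V"
  shows "small W M"
  unfolding small_def
proof (intro allI impI)
  fix L assume *: "submodule L M \<and> carrier M \<subseteq> sum_of W L"
  have "carrier M \<subseteq> sum_of U (sum_of V L)"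
  proof
    fix x assume "x \<in> carrier M"
    then obtain w l where "w \<in> W" "l \<in> L" "x = w + l" using * by (blast elim: sum_ofE)
    moreover then obtain u v where "u \<in> U" "v \<in> V" "w = u + v" using W by (blast elim: sum_ofE)
    ultimately show "x \<in> sum_of U (sum_of V L)"
      by (metis sum_ofI add.assoc)
  qed
  then have "sum_of V L = carrier M"
    using U submodule_sum_of[OF M V(2)] * by (auto simp: small_def)
  then show "L = carrier M" using V * by (auto simp: small_def)
qed

text \<open>\<open>V\<close> and the kernel of the retraction \<open>r\<close> generate
  \<open>M\<close>. Smallness makes the kernel all of \<open>M\<close>, so on \<open>V\<close> the
  map \<open>r\<close> is both zero and the identity.\<close>

lemma small_retract_zero:
  assumes M: "right_module M" and V: "submodule V M" and s: "small V M"
    and r: "module_hom M (M\<lparr>carrier := V\<rparr>) r" and rV: "\<And>x. x \<in> V \<Longrightarrow> r x = x"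
  shows "V = {0}"
proof -
  note N = submodule_module[OF V]
  have sub: "V \<subseteq> carrier M" by (rule submodule_subset[OF V])
  have "carrier M \<subseteq> sum_of V (module_ker M r)"
  proof
    fix x assume x: "x \<in> carrier M"
    have rx: "r x \<in> V" using hom_in[OF r x] by simp
    have "r (x - r x) = 0" using hom_diff[OF M r x, of "r x"] rx rV sub by auto
    then have "x - r x \<in> module_ker M r" using rm_diff[OF M x] rx sub by (auto simp: ker_iff)
    then show "x \<in> sum_of V (module_ker M r)" using sum_ofI[OF rx] by fastforce
  qed
  then have "module_ker M r = carrier M"
    using s submodule_ker[OF M N r] by (auto simp: small_def)
  then have "x = 0" if "x \<in> V" for x
    using that rV[of x] sub ker_iff by (metis subsetD)
  then show ?thesis using sub_zero[OF V] by auto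
qed

section \<open>Coordinates of finite dimensional modules\<close>

interpretation coord: vector_space "\<lambda>(c::'k::field) (f::nat \<Rightarrow> 'k) i. c * f i"
  by unfold_locales (auto simp: fun_eq_iff algebra_simps)

text \<open>Copies of \<open>K^n\<close>. Containment in one of them is the form in which finite
  dimension is used in the ambient space \<open>nat \<Rightarrow> 'k\<close>.\<close>

definition supported :: "nat \<Rightarrow> (nat \<Rightarrow> 'k::zero) set" where
  "supported n = {f. \<forall>i\<ge>n. f i = 0}"

lemma sum_fun_apply: "(\<Sum>x\<in>A. f x) i = (\<Sum>x\<in>A. f x i)"
  by (induction A rule: infinite_finite_induct) auto

lemma supported_span:
  "supported n \<subseteq> coord.span ((\<lambda>j i. if i = j then 1 else 0) ` {..<n} :: (nat \<Rightarrow> 'k::field) set)"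
proof
  fix f :: "nat \<Rightarrow> 'k" assume f: "f \<in> supported n"
  let ?e = "\<lambda>j i::nat. if i = j then 1 else (0::'k)"
  have "f = (\<Sum>j<n. (\<lambda>i. f j * ?e j i))"
  proof
    fix i show "f i = (\<Sum>j<n. (\<lambda>i. f j * ?e j i)) i"
      using f by (cases "i < n") (auto simp: sum_fun_apply supported_def if_distrib sum.delta cong: if_cong)
  qed
  also have "\<dots> \<in> coord.span (?e ` {..<n})"
    by (intro coord.span_sum coord.span_scale coord.span_base) auto
  finally show "f \<in> coord.span (?e ` {..<n})" .
qed

lemma supported_independent_finite:
  assumes "coord.independent B" "B \<subseteq> supported n"
  shows "finite (B :: (nat \<Rightarrow> 'k::field) set)"
  using coord.independent_span_bound[OF _ assms(1) order_trans[OF assms(2) supported_span]] by simp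

text \<open>A basis of \<open>U\<close> extends to a basis of \<open>V\<close>, which is finite
  because \<open>V\<close> lies in a copy of \<open>K^n\<close>; equal bases would put
  \<open>V\<close> inside \<open>U\<close>.\<close>

lemma coord_dim_less:
  assumes U: "coord.subspace U" and V: "coord.subspace V" "V \<subseteq> supported n" and "U \<subset> V"
  shows "coord.dim U < coord.dim (V :: (nat \<Rightarrow> 'k::field) set)"
proof -
  obtain B where B: "B \<subseteq> U" "coord.independent B" "U \<subseteq> coord.span B"
    using coord.maximal_independent_subset .
  obtain B' where B': "B \<subseteq> B'" "B' \<subseteq> V" "coord.independent B'" "V \<subseteq> coord.span B'"
    using coord.maximal_independent_subset_extend[of B V] B \<open>U \<subset> V\<close> by blast
  have dims: "coord.dim U = card B" "coord.dim V = card B'"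
    using B B' coord.basis_card_eq_dim by metis+
  have "finite B'" using supported_independent_finite B' V(2) by blast
  moreover have "B \<noteq> B'"
  proof
    assume "B = B'"
    then have "V \<subseteq> U" using B' B(1) coord.span_minimal[OF B(1) U] by blast
    then show False using \<open>U \<subset> V\<close> by blast
  qed
  ultimately show ?thesis using dims B'(1) psubset_card_mono by (metis psubsetI)
qed

lemma coord_projection:
  assumes "coord.subspace (U :: (nat \<Rightarrow> 'k::field) set)"
  obtains g where "\<forall>x. g x \<in> U" "\<forall>x y. g (x + y) = g x + g y"
    "\<forall>c x. g (\<lambda>i. c * x i) = (\<lambda>i. c * g x i)" "\<forall>x\<in>U. g x = x"
proof -
  let ?s = "\<lambda>(c::'k) (f::nat \<Rightarrow> 'k) i. c * f i"
  have p: "vector_space_pair ?s ?s" by unfold_locales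
  have "Vector_Spaces.linear ?s ?s (\<lambda>x. x)" by unfold_locales auto
  \<comment> \<open>A left inverse of the identity on \<open>U\<close> with values in
    \<open>U\<close> is a projection onto \<open>U\<close>.\<close>
  then obtain g where g: "range g \<subseteq> U" "Vector_Spaces.linear ?s ?s g" "\<forall>v\<in>U. g v = v"
    using vector_space_pair.linear_exists_left_inverse_on[OF p _ assms] by (metis inj_on_id2)
  interpret g: Vector_Spaces.linear ?s ?s g by (rule g(2))
  show ?thesis
    by (rule that[of g]) (use g in \<open>auto simp: g.add g.scale\<close>)
qed

context fd_algebra
begin

lemma scale_one_mult: "a * scale c 1 = scale c a" "scale c 1 * a = scale c a"
  by (simp_all add: scale_mult_right scale_mult_left)

section \<open>Coordinates and finite dimensionality\<close>

text \<open>A \<open>K\<close>-linear embedding of the carrier into \<open>K^n\<close>, the scalars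
  acting through \<open>scale c 1\<close>. Dimension counts and linear complements for
  \<open>M\<close> are taken on its image.\<close>

definition coordinates :: "('a, 'm::ab_group_add) rmodule \<Rightarrow> ('m \<Rightarrow> nat \<Rightarrow> 'k) \<Rightarrow> nat \<Rightarrow> bool" where
  "coordinates M \<kappa> n \<longleftrightarrow> inj_on \<kappa> (carrier M) \<and> \<kappa> ` carrier M \<subseteq> supported n \<and>
    (\<forall>x\<in>carrier M. \<forall>y\<in>carrier M. \<kappa> (x + y) = \<kappa> x + \<kappa> y) \<and>
    (\<forall>x\<in>carrier M. \<forall>c. \<kappa> (act M x (scale c 1)) = (\<lambda>i. c * \<kappa> x i))"

lemma
  assumes "coordinates M \<kappa> n"
  shows coordinates_inj: "inj_on \<kappa> (carrier M)"
    and coordinates_supported: "\<kappa> ` carrier M \<subseteq> supported n"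
    and coordinates_add: "x \<in> carrier M \<Longrightarrow> y \<in> carrier M \<Longrightarrow> \<kappa> (x + y) = \<kappa> x + \<kappa> y"
    and coordinates_scale: "x \<in> carrier M \<Longrightarrow> \<kappa> (act M x (scale c 1)) = (\<lambda>i. c * \<kappa> x i)"
  using assms by (auto simp: coordinates_def)

lemma coordinates_zero:
  assumes "right_module M" "coordinates M \<kappa> n" shows "\<kappa> 0 = 0"
  using coordinates_add[OF assms(2), of 0 0] rm_zero[OF assms(1)] by simp

lemma coordinates_subspace:
  assumes M: "right_module M" and \<kappa>: "coordinates M \<kappa> n" and U: "submodule U M"
  shows "coord.subspace (\<kappa> ` U)"
  unfolding coord.subspace_def
proof (intro conjI ballI allI)
  have sub: "U \<subseteq> carrier M" by (rule submodule_subset[OF U])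
  show "0 \<in> \<kappa> ` U" using coordinates_zero[OF M \<kappa>] sub_zero[OF U] by (metis imageI)
  show "x + y \<in> \<kappa> ` U" if "x \<in> \<kappa> ` U" "y \<in> \<kappa> ` U" for x y
    using that sub by (auto simp: coordinates_add[OF \<kappa>, symmetric] subset_iff intro: sub_add[OF U])
  show "(\<lambda>i. c * x i) \<in> \<kappa> ` U" if "x \<in> \<kappa> ` U" for c x
    using that sub by (auto simp: coordinates_scale[OF \<kappa>, symmetric] subset_iff intro: sub_act[OF U])
qed

text \<open>The spanning set gives a linear surjection \<open>\<phi>\<close> from \<open>K^n\<close>
  onto \<open>M\<close>, and the coordinates are a linear section of it: take any preimage and
  remove its component in the kernel of \<open>\<phi>\<close>.\<close>

lemma fd_module_coordinates:
  fixes M :: "('a, 'm::ab_group_add) rmodule"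
  assumes "fd_module M"
  obtains \<kappa> n where "coordinates M \<kappa> n"
proof -
  have M: "right_module M" using assms by (simp add: fd_module_def)
  obtain S where S: "finite S" "S \<subseteq> carrier M"
    "\<And>x. x \<in> carrier M \<Longrightarrow> \<exists>c. x = (\<Sum>s\<in>S. act M s (scale (c s) 1))"
    using assms by (auto simp: fd_module_def)
  obtain e n where e: "bij_betw e {..<n::nat} S"
    using ex_bij_betw_nat_finite[OF S(1)] by (metis atLeast0LessThan)
  have e_in: "e i \<in> carrier M" if "i < n" for i
    using e S(2) that bij_betwE by blast
  define \<phi> where "\<phi> c = (\<Sum>i<n. act M (e i) (scale (c i) 1))" for c :: "nat \<Rightarrow> 'k"
  have \<phi>_add: "\<phi> (c + d) = \<phi> c + \<phi> d" for c d
    by (simp add: \<phi>_def scale_left_distrib act_add_right[OF M e_in] sum.distrib)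
  have act_sum: "act M (sum f A) a = (\<Sum>x\<in>A. act M (f x) a)"
    if "\<And>x. x \<in> A \<Longrightarrow> f x \<in> carrier M" for f and A :: "nat set" and a
    using that
    by (induction A rule: infinite_finite_induct)
       (auto simp: act_zero_left[OF M] act_add_left[OF M] rm_sum[OF M])
  have \<phi>_scale: "\<phi> (\<lambda>i. k * c i) = act M (\<phi> c) (scale k 1)" for k c
    unfolding \<phi>_def
    by (subst act_sum) (auto simp: rm_act[OF M] e_in act_mult[OF M, symmetric] scale_one_mult mult.commute)
  have \<phi>_surj: "\<exists>c. c \<in> supported n \<and> \<phi> c = x" if x: "x \<in> carrier M" for x
  proof -
    obtain c where c: "x = (\<Sum>s\<in>S. act M s (scale (c s) 1))" using S(3)[OF x] by blast
    have "x = \<phi> (\<lambda>i. if i < n then c (e i) else 0)"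
      unfolding c \<phi>_def by (subst sum.reindex_bij_betw[OF e, symmetric]) (auto intro: sum.cong)
    then show ?thesis by (intro exI[of _ "\<lambda>i. if i < n then c (e i) else 0"]) (auto simp: supported_def)
  qed
  have \<phi>_zero: "\<phi> 0 = 0" using \<phi>_add[of 0 0] by simp
  define Z where "Z = {c \<in> supported n. \<phi> c = 0}"
  have "coord.subspace Z"
    unfolding coord.subspace_def Z_def
    using \<phi>_zero \<phi>_add \<phi>_scale act_zero_left[OF M] by (auto simp: supported_def)
  then obtain g where g: "\<forall>x. g x \<in> Z" "\<forall>x y. g (x + y) = g x + g y"
    "\<forall>c x. g (\<lambda>i. c * x i) = (\<lambda>i. c * g x i)" "\<forall>x\<in>Z. g x = x"
    by (rule coord_projection)
  note g = g[rule_format]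
  define C where "C x = (SOME c. c \<in> supported n \<and> \<phi> c = x)" for x
  have C: "C x \<in> supported n" "\<phi> (C x) = x" if "x \<in> carrier M" for x
    using someI_ex[OF \<phi>_surj[OF that]] by (auto simp: C_def)
  define \<kappa> where "\<kappa> x = C x - g (C x)" for x
  \<comment> \<open>Two preimages of the same element differ by an element of \<open>Z\<close>,
    which \<open>g\<close> fixes. The corrected preimage is therefore independent of the choice, and
    this makes \<open>\<kappa>\<close> linear.\<close>
  have eq: "c - g c = d - g d" if "c \<in> supported n" "d \<in> supported n" "\<phi> c = \<phi> d" for c d
  proof -
    have "\<phi> (c - d) = 0" using \<phi>_add[of "c - d" d] that(3) by simp
    then have "c - d \<in> Z" using that by (auto simp: Z_def supported_def)
    then have "g (c - d) = c - d" by (rule g(4))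
    moreover have "g (c - d) = g c - g d" using g(2)[of "c - d" d] by simp
    ultimately show ?thesis by (simp add: algebra_simps)
  qed
  have sadd: "c + d \<in> supported n" if "c \<in> supported n" "d \<in> supported n" for c d :: "nat \<Rightarrow> 'k"
    using that by (auto simp: supported_def)
  have gs: "g x \<in> supported n" "\<phi> (g x) = 0" for x using g(1)[of x] by (auto simp: Z_def)
  have "coordinates M \<kappa> n"
    unfolding coordinates_def
  proof (intro conjI ballI allI)
    show "inj_on \<kappa> (carrier M)"
    proof (rule inj_onI)
      fix x y assume *: "x \<in> carrier M" "y \<in> carrier M" "\<kappa> x = \<kappa> y"
      have "\<phi> (\<kappa> z) = z" if "z \<in> carrier M" for z
        using \<phi>_add[of "\<kappa> z" "g (C z)"] C(2)[OF that] gs by (simp add: \<kappa>_def)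
      then show "x = y" using * by metis
    qed
    show "\<kappa> ` carrier M \<subseteq> supported n"
      using C gs by (auto simp: \<kappa>_def supported_def)
  next
    fix x y assume *: "x \<in> carrier M" "y \<in> carrier M"
    have "\<kappa> (x + y) = (C x + C y) - g (C x + C y)"
      unfolding \<kappa>_def by (rule eq) (use * C rm_add[OF M *] in \<open>auto simp: \<phi>_add sadd\<close>)
    then show "\<kappa> (x + y) = \<kappa> x + \<kappa> y" by (simp add: \<kappa>_def g(2))
  next
    fix x k assume *: "x \<in> carrier M"
    have "\<kappa> (act M x (scale k 1)) = (\<lambda>i. k * C x i) - g (\<lambda>i. k * C x i)"
      unfolding \<kappa>_def
      by (rule eq) (use * C rm_act[OF M *] in \<open>auto simp: \<phi>_scale supported_def\<close>)
    also have "\<dots> = (\<lambda>i. k * \<kappa> x i)"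
      by (simp add: \<kappa>_def g(3) fun_eq_iff right_diff_distrib)
    finally show "\<kappa> (act M x (scale k 1)) = (\<lambda>i. k * \<kappa> x i)" .
  qed
  then show ?thesis by (rule that)
qed

text \<open>Preimages under \<open>\<kappa>\<close> of a basis of the coordinate image span the
  module.\<close>

lemma fd_moduleI:
  assumes M: "right_module M" and \<kappa>: "coordinates M \<kappa> n"
  shows "fd_module M"
proof -
  obtain B where B: "B \<subseteq> \<kappa> ` carrier M" "coord.independent B" "\<kappa> ` carrier M \<subseteq> coord.span B"
    using coord.maximal_independent_subset .
  have fin: "finite B"
    using supported_independent_finite B coordinates_supported[OF \<kappa>] by (metis order_trans)
  define g where "g = inv_into (carrier M) \<kappa>"
  have g: "g b \<in> carrier M" "\<kappa> (g b) = b" if "b \<in> B" for b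
    using that B(1) by (auto simp: g_def inv_into_into f_inv_into_f)
  have inj: "inj_on g B" by (rule inj_on_inverseI) (rule g(2))
  have sum: "\<kappa> (sum f A) = (\<Sum>x\<in>A. \<kappa> (f x))" if "\<And>x. x \<in> A \<Longrightarrow> f x \<in> carrier M"
    for f and A :: "(nat \<Rightarrow> 'k) set"
    using that
    by (induction A rule: infinite_finite_induct)
       (auto simp: coordinates_zero[OF M \<kappa>] coordinates_add[OF \<kappa>] rm_sum[OF M])
  have "\<exists>c. x = (\<Sum>s\<in>g ` B. act M s (scale (c s) 1))" if x: "x \<in> carrier M" for x
  proof -
    have "\<kappa> x \<in> coord.span B" using B(3) x by blast
    then obtain u where u: "\<kappa> x = (\<Sum>b\<in>B. (\<lambda>i. u b * b i))"
      using coord.span_finite[OF fin] by (auto simp: image_iff)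
    have in': "act M (g b) (scale (u b) 1) \<in> carrier M" if "b \<in> B" for b
      using that g rm_act[OF M] by auto
    have "\<kappa> (\<Sum>b\<in>B. act M (g b) (scale (u b) 1)) = \<kappa> x"
      unfolding u by (subst sum) (auto simp: in' g coordinates_scale[OF \<kappa>] intro!: sum.cong)
    from inj_onD[OF coordinates_inj[OF \<kappa>] this rm_sum[OF M in'] x]
    have "x = (\<Sum>b\<in>B. act M (g b) (scale (u b) 1))" by simp
    also have "\<dots> = (\<Sum>s\<in>g ` B. act M s (scale (u (\<kappa> s)) 1))"
      by (subst sum.reindex[OF inj]) (auto simp: g intro!: sum.cong)
    finally show ?thesis by (rule exI[of _ "\<lambda>s. u (\<kappa> s)"])
  qed
  moreover have "g ` B \<subseteq> carrier M" using g by auto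
  ultimately show ?thesis using M fin unfolding fd_module_def by blast
qed

lemma fd_right_module: "fd_module M \<Longrightarrow> right_module M"
  by (simp add: fd_module_def)

lemma fd_submodule:
  assumes "fd_module M" "submodule U M"
  shows "fd_module (M\<lparr>carrier := U\<rparr>)"
proof -
  obtain \<kappa> n where \<kappa>: "coordinates M \<kappa> n" using fd_module_coordinates[OF assms(1)] .
  have "coordinates (M\<lparr>carrier := U\<rparr>) \<kappa> n"
    using \<kappa> submodule_subset[OF assms(2)] unfolding coordinates_def
    by (auto simp: inj_on_subset subset_iff)
  then show ?thesis using fd_moduleI[OF submodule_module[OF assms(2)]] by blast
qed

section \<open>Chain conditions\<close>

text \<open>The measure is the dimension of the coordinate image. It takes the place of the length
  of a module and yields both chain conditions below.\<close>

lemma submodule_measure: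
  fixes M :: "('a, 'm::ab_group_add) rmodule"
  assumes "fd_module M"
  obtains \<mu> :: "'m set \<Rightarrow> nat" where
    "\<And>U V. submodule U M \<Longrightarrow> submodule V M \<Longrightarrow> U \<subset> V \<Longrightarrow> \<mu> U < \<mu> V"
proof -
  note M = fd_right_module[OF assms]
  obtain \<kappa> n where \<kappa>: "coordinates M \<kappa> n" using fd_module_coordinates[OF assms] .
  have "coord.dim (\<kappa> ` U) < coord.dim (\<kappa> ` V)"
    if U: "submodule U M" and V: "submodule V M" and "U \<subset> V" for U V
  proof (rule coord_dim_less)
    show "coord.subspace (\<kappa> ` U)" "coord.subspace (\<kappa> ` V)"
      using coordinates_subspace[OF M \<kappa>] U V by auto
    show "\<kappa> ` V \<subseteq> supported n"
      using coordinates_supported[OF \<kappa>] submodule_subset[OF V] by blast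
    show "\<kappa> ` U \<subset> \<kappa> ` V"
      using \<open>U \<subset> V\<close> coordinates_inj[OF \<kappa>] submodule_subset[OF V]
      by (metis inj_on_subset image_strict_mono)
  qed
  then show ?thesis using that[of "\<lambda>U. coord.dim (\<kappa> ` U)"] by blast
qed

lemma minimal_submodule:
  assumes fd: "fd_module M" and U: "submodule U M" "P U"
  obtains V where "submodule V M" "P V"
    "\<And>W. submodule W M \<Longrightarrow> P W \<Longrightarrow> W \<subseteq> V \<Longrightarrow> W = V"
proof -
  obtain \<mu> :: "_ \<Rightarrow> nat" where \<mu>: "\<And>U V. submodule U M \<Longrightarrow> submodule V M \<Longrightarrow> U \<subset> V \<Longrightarrow> \<mu> U < \<mu> V"
    using submodule_measure[OF fd] by blast
  obtain V where "submodule V M \<and> P V" "\<And>W. submodule W M \<and> P W \<Longrightarrow> \<mu> V \<le> \<mu> W"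
    using ex_has_least_nat[of "\<lambda>U. submodule U M \<and> P U" U \<mu>] U by blast
  then show ?thesis using that[of V] \<mu> by (metis leD psubsetI)
qed

text \<open>A member of greatest measure is maximal for inclusion; all measures are bounded by that
  of the carrier.\<close>

lemma maximal_submodule:
  assumes fd: "fd_module M" and U: "submodule U M" "P U"
  obtains V where "submodule V M" "P V"
    "\<And>W. submodule W M \<Longrightarrow> P W \<Longrightarrow> V \<subseteq> W \<Longrightarrow> W = V"
proof -
  obtain \<mu> :: "_ \<Rightarrow> nat" where \<mu>: "\<And>U V. submodule U M \<Longrightarrow> submodule V M \<Longrightarrow> U \<subset> V \<Longrightarrow> \<mu> U < \<mu> V"
    using submodule_measure[OF fd] by blast
  have "\<mu> W < Suc (\<mu> (carrier M))" if "submodule W M" for W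
    using \<mu>[OF that submodule_carrier[OF fd_right_module[OF fd]]] submodule_subset[OF that]
    by (cases "W = carrier M") (auto simp: less_Suc_eq)
  then obtain V where "submodule V M \<and> P V" "\<And>W. submodule W M \<and> P W \<Longrightarrow> \<mu> W \<le> \<mu> V"
    using ex_has_greatest_nat[of "\<lambda>U. submodule U M \<and> P U" U \<mu> "Suc (\<mu> (carrier M))"] U by auto
  then show ?thesis using that[of V] \<mu> by (metis leD psubsetI)
qed

text \<open>The kernels of the powers of \<open>h\<close> stabilise at some \<open>k\<close>. If
  \<open>h x = 0\<close>, write \<open>x\<close> as the \<open>k\<close>-th power of
  \<open>h\<close> applied to \<open>y\<close>; then \<open>y\<close> is killed by the next power,
  hence already by the \<open>k\<close>-th, and \<open>x = 0\<close>.\<close>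

lemma surjective_endomorphism_injective:
  assumes fd: "fd_module M" and h: "module_hom M M h" and surj: "h ` carrier M = carrier M"
  shows "inj_on h (carrier M)"
proof -
  note M = fd_right_module[OF fd]
  have hk: "module_hom M M (h ^^ k)" for k
    by (induction k) (use hom_id hom_compose[OF _ h] in \<open>auto simp: id_def o_def\<close>)
  have sk: "(h ^^ k) ` carrier M = carrier M" for k
  proof (induction k)
    case (Suc k)
    have "(h ^^ Suc k) ` carrier M = h ` (h ^^ k) ` carrier M" by (simp add: image_image)
    then show ?case using Suc surj by simp
  qed simp
  define P where "P U = (\<exists>k. U = module_ker M (h ^^ k))" for U
  have "P (module_ker M (h ^^ 0))" unfolding P_def by blast
  then obtain V where V: "submodule V M" "P V"
    "\<And>W. submodule W M \<Longrightarrow> P W \<Longrightarrow> V \<subseteq> W \<Longrightarrow> W = V"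
    using maximal_submodule[where P = P, OF fd submodule_ker[OF M M hk[of 0]]] by blast
  then obtain k where k: "V = module_ker M (h ^^ k)" by (auto simp: P_def)
  have "V \<subseteq> module_ker M (h ^^ Suc k)"
    using hom_zero[OF M h] by (auto simp: k ker_iff)
  then have stable: "module_ker M (h ^^ Suc k) = V"
    using V(3)[OF submodule_ker[OF M M hk]] unfolding P_def by blast
  have "x = 0" if "x \<in> carrier M" "h x = 0" for x
  proof -
    obtain y where y: "y \<in> carrier M" "x = (h ^^ k) y" using sk[of k] \<open>x \<in> carrier M\<close> by blast
    then have "y \<in> module_ker M (h ^^ Suc k)" using that by (simp add: ker_iff)
    then show "x = 0" unfolding stable using y by (simp add: k ker_iff)
  qed
  then show ?thesis using hom_inj_iff[OF M h] by blast
qed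

section \<open>Quotients and copies in \<open>mod_cat\<close>\<close>

text \<open>A projection of the coordinate space, transported back. It commutes with scalars and not
  necessarily with the algebra, which suffices to build quotients and to extend functionals.\<close>

lemma linear_projection:
  fixes M :: "('a, 'm::ab_group_add) rmodule"
  assumes fd: "fd_module M" and U: "submodule U M"
  obtains \<rho> where "\<forall>x\<in>carrier M. \<rho> x \<in> U"
    "\<forall>x\<in>carrier M. \<forall>y\<in>carrier M. \<rho> (x + y) = \<rho> x + \<rho> y"
    "\<forall>x\<in>carrier M. \<forall>c. \<rho> (act M x (scale c 1)) = act M (\<rho> x) (scale c 1)"
    "\<forall>x\<in>U. \<rho> x = x"
proof -
  note M = fd_right_module[OF fd]
  have sub: "U \<subseteq> carrier M" by (rule submodule_subset[OF U])
  obtain \<kappa> n where \<kappa>: "coordinates M \<kappa> n" using fd_module_coordinates[OF fd] .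
  obtain g where g: "\<forall>x. g x \<in> \<kappa> ` U" "\<forall>x y. g (x + y) = g x + g y"
    "\<forall>c x. g (\<lambda>i. c * x i) = (\<lambda>i. c * g x i)" "\<forall>x\<in>\<kappa> ` U. g x = x"
    by (rule coord_projection[OF coordinates_subspace[OF M \<kappa> U]])
  note g = g[rule_format]
  define \<rho> where "\<rho> x = inv_into U \<kappa> (g (\<kappa> x))" for x
  have \<rho>: "\<rho> x \<in> U" "\<kappa> (\<rho> x) = g (\<kappa> x)" for x
    using g(1)[of "\<kappa> x"] by (auto simp: \<rho>_def inv_into_into f_inv_into_f)
  have eqI: "x = y" if "x \<in> U" "y \<in> U" "\<kappa> x = \<kappa> y" for x y
    using coordinates_inj[OF \<kappa>] sub that by (meson inj_onD subsetD)
  show ?thesis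
  proof (rule that[of \<rho>]; intro ballI allI)
    show "\<rho> x \<in> U" for x by (rule \<rho>)
    show "\<rho> (x + y) = \<rho> x + \<rho> y" if "x \<in> carrier M" "y \<in> carrier M" for x y
    proof (rule eqI)
      show "\<rho> x + \<rho> y \<in> U" by (intro sub_add[OF U] \<rho>)
      show "\<kappa> (\<rho> (x + y)) = \<kappa> (\<rho> x + \<rho> y)"
        using \<rho> sub coordinates_add[OF \<kappa>] that g(2) by (metis subsetD)
    qed (rule \<rho>)
    show "\<rho> (act M x (scale c 1)) = act M (\<rho> x) (scale c 1)" if "x \<in> carrier M" for x c
    proof (rule eqI)
      show "act M (\<rho> x) (scale c 1) \<in> U" by (intro sub_act[OF U] \<rho>)
      show "\<kappa> (\<rho> (act M x (scale c 1))) = \<kappa> (act M (\<rho> x) (scale c 1))"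
        using \<rho> sub coordinates_scale[OF \<kappa>] that g(3) by (metis subsetD)
    qed (rule \<rho>)
    show "\<rho> x = x" if "x \<in> U" for x
      by (rule eqI) (use \<rho> g(4) that in auto)
  qed
qed

text \<open>The quotient by \<open>U\<close> is realised on a \<open>K\<close>-linear complement of \<open>U\<close>.\<close>

lemma quotient_module:
  fixes M :: "('a, 'm::ab_group_add) rmodule"
  assumes fd: "fd_module M" and U: "submodule U M"
  obtains N :: "('a, 'm) rmodule" and \<pi> where "fd_module N" "module_hom M N \<pi>"
    "\<pi> ` carrier M = carrier N" "module_ker M \<pi> = U"
proof -
  note M = fd_right_module[OF fd]
  have sub: "U \<subseteq> carrier M" by (rule submodule_subset[OF U])
  obtain \<rho> where \<rho>: "\<forall>x\<in>carrier M. \<rho> x \<in> U"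
    "\<forall>x\<in>carrier M. \<forall>y\<in>carrier M. \<rho> (x + y) = \<rho> x + \<rho> y"
    "\<forall>x\<in>carrier M. \<forall>c. \<rho> (act M x (scale c 1)) = act M (\<rho> x) (scale c 1)"
    "\<forall>x\<in>U. \<rho> x = x"
    by (rule linear_projection[OF fd U])
  note \<rho> = \<rho>[rule_format]
  obtain \<kappa> n where \<kappa>: "coordinates M \<kappa> n" using fd_module_coordinates[OF fd] .
  define \<pi> where "\<pi> x = x - \<rho> x" for x
  \<comment> \<open>The action of \<open>M\<close> may leave the complement, so it is followed by
    \<open>\<pi>\<close>.\<close>
  define N where "N = \<lparr>carrier = \<pi> ` carrier M, act = (\<lambda>x a. \<pi> (act M x a))\<rparr>"
  have in': "\<pi> x \<in> carrier M" if "x \<in> carrier M" for x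
    using rm_diff[OF M that] \<rho>(1)[OF that] sub by (auto simp: \<pi>_def)
  have add: "\<pi> (x + y) = \<pi> x + \<pi> y" if "x \<in> carrier M" "y \<in> carrier M" for x y
    using that \<rho>(2) by (simp add: \<pi>_def)
  have diff: "\<pi> (x - y) = \<pi> x - \<pi> y" if "x \<in> carrier M" "y \<in> carrier M" for x y
    using add[OF rm_diff[OF M that] that(2)] by simp
  have scl: "\<pi> (act M x (scale c 1)) = act M (\<pi> x) (scale c 1)" if "x \<in> carrier M" for x c
    using that \<rho>(3) \<rho>(1)[OF that] sub act_diff_left[OF M that, of "\<rho> x"] by (auto simp: \<pi>_def)
  have kills: "\<pi> x = 0" if "x \<in> U" for x using \<rho>(4)[OF that] by (simp add: \<pi>_def)
  have idem: "\<pi> (\<pi> x) = \<pi> x" if "x \<in> carrier M" for x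
    using diff[OF that, of "\<rho> x"] kills[OF \<rho>(1)[OF that]] \<rho>(1)[OF that] sub by (auto simp: \<pi>_def)
  \<comment> \<open>\<open>x\<close> and \<open>\<pi> x\<close> differ by an element of
    \<open>U\<close>, which stays in \<open>U\<close> under the action and is then killed by
    \<open>\<pi>\<close>. This gives associativity of the new action and makes \<open>\<pi>\<close>
    a homomorphism.\<close>
  have act\<pi>: "\<pi> (act M (\<pi> x) a) = \<pi> (act M x a)" if "x \<in> carrier M" for x a
  proof -
    have r: "\<rho> x \<in> U" "\<rho> x \<in> carrier M" using \<rho>(1)[OF that] sub by auto
    have "act M (\<pi> x) a = act M x a - act M (\<rho> x) a"
      unfolding \<pi>_def by (rule act_diff_left[OF M that r(2)])
    then show ?thesis
      using diff[OF rm_act[OF M that] rm_act[OF M r(2)]] kills[OF sub_act[OF U r(1)]] by simp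
  qed
  have N: "right_module N"
    unfolding right_module_def N_def rmodule.select_convs
  proof (intro conjI ballI allI; (elim imageE)?)
    show "0 \<in> \<pi> ` carrier M" using kills[OF sub_zero[OF U]] rm_zero[OF M] by (metis imageI)
    show "x - y \<in> \<pi> ` carrier M" if "x = \<pi> u" "u \<in> carrier M" "y = \<pi> v" "v \<in> carrier M" for x y u v
      using that diff rm_diff[OF M] by (metis imageI)
    show "\<pi> (act M x a) \<in> \<pi> ` carrier M" if "x = \<pi> u" "u \<in> carrier M" for x u a
      using that rm_act[OF M] in' by blast
    show "\<pi> (act M (x + y) a) = \<pi> (act M x a) + \<pi> (act M y a)"
      if "x = \<pi> u" "u \<in> carrier M" "y = \<pi> v" "v \<in> carrier M" for x y u v a
      using that in' by (simp add: act_add_left[OF M] add rm_act[OF M])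
    show "\<pi> (act M x (a + b)) = \<pi> (act M x a) + \<pi> (act M x b)" if "x = \<pi> u" "u \<in> carrier M" for x u a b
      using that in' by (simp add: act_add_right[OF M] add rm_act[OF M])
    show "\<pi> (act M x (a * b)) = \<pi> (act M (\<pi> (act M x a)) b)" if "x = \<pi> u" "u \<in> carrier M" for x u a b
    proof -
      have x: "x \<in> carrier M" using that in' by simp
      then show ?thesis by (simp add: act_mult[OF M x] act\<pi>[OF rm_act[OF M x]])
    qed
    show "\<pi> (act M x 1) = x" if "x = \<pi> u" "u \<in> carrier M" for x u
      using that in' by (simp add: act_one[OF M] idem)
  qed
  have "coordinates N \<kappa> n"
    unfolding coordinates_def
  proof (intro conjI ballI allI)
    have c: "carrier N \<subseteq> carrier M" using in' by (auto simp: N_def)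
    show "inj_on \<kappa> (carrier N)" using coordinates_inj[OF \<kappa>] c by (rule inj_on_subset)
    show "\<kappa> ` carrier N \<subseteq> supported n" using coordinates_supported[OF \<kappa>] c by blast
    show "\<kappa> (x + y) = \<kappa> x + \<kappa> y" if "x \<in> carrier N" "y \<in> carrier N" for x y
      using coordinates_add[OF \<kappa>] c that by blast
    show "\<kappa> (act N x (scale k 1)) = (\<lambda>i. k * \<kappa> x i)" if x: "x \<in> carrier N" for x k
    proof -
      have "\<pi> x = x" using x idem by (auto simp: N_def)
      then have "act N x (scale k 1) = act M x (scale k 1)" using scl[of x k] c x by (auto simp: N_def)
      then show ?thesis using coordinates_scale[OF \<kappa>] c x by auto
    qed
  qed
  then have "fd_module N" by (rule fd_moduleI[OF N])
  moreover have "module_hom M N \<pi>"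
    by (auto simp: module_hom_def N_def add act\<pi>)
  moreover have "module_ker M \<pi> = U"
  proof
    show "module_ker M \<pi> \<subseteq> U" using \<rho>(1) by (force simp: ker_iff \<pi>_def)
    show "U \<subseteq> module_ker M \<pi>" using kills sub by (auto simp: ker_iff)
  qed
  ultimately show ?thesis using that by (simp add: N_def)
qed

lemma fd_isomorphic:
  fixes M :: "('a, 'm::ab_group_add) rmodule" and N :: "('a, 'n::ab_group_add) rmodule"
  assumes fd: "fd_module M" and N: "right_module N" and f: "module_iso M N f"
  shows "fd_module N"
proof -
  note M = fd_right_module[OF fd]
  obtain \<kappa> n where \<kappa>: "coordinates M \<kappa> n" using fd_module_coordinates[OF fd] .
  obtain g where g: "module_iso N M g" using iso_inverse[OF M f] by metis
  then have h: "module_hom N M g" and b: "bij_betw g (carrier N) (carrier M)" by (auto simp: module_iso_def)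
  have "coordinates N (\<kappa> \<circ> g) n"
    unfolding coordinates_def
  proof (intro conjI ballI allI)
    show "inj_on (\<kappa> \<circ> g) (carrier N)"
      using b coordinates_inj[OF \<kappa>] by (metis bij_betw_def comp_inj_on)
    show "(\<kappa> \<circ> g) ` carrier N \<subseteq> supported n"
      using b coordinates_supported[OF \<kappa>] by (auto simp: bij_betw_def)
  qed (auto simp: hom_in[OF h] hom_add[OF h] hom_act[OF h] coordinates_add[OF \<kappa>] coordinates_scale[OF \<kappa>])
  then show ?thesis by (rule fd_moduleI[OF N])
qed

text \<open>Transport of structure along the coordinates. It brings modules over other ambient
  types, such as \<open>A\<close> and \<open>D(A)\<close>, into \<open>mod_cat\<close>.\<close>

lemma mod_cat_copy:
  fixes M :: "('a, 'm::ab_group_add) rmodule"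
  assumes fd: "fd_module M"
  obtains N f where "N \<in> mod_cat" "module_iso M N f"
proof -
  note M = fd_right_module[OF fd]
  obtain \<kappa> n where \<kappa>: "coordinates M \<kappa> n" using fd_module_coordinates[OF fd] .
  define g where "g = inv_into (carrier M) \<kappa>"
  define N where "N = \<lparr>carrier = \<kappa> ` carrier M, act = (\<lambda>y a. \<kappa> (act M (g y) a))\<rparr>"
  have gk: "g (\<kappa> x) = x" if "x \<in> carrier M" for x
    using that coordinates_inj[OF \<kappa>] by (simp add: g_def)
  have diff: "\<kappa> x - \<kappa> y = \<kappa> (x - y)" if "x \<in> carrier M" "y \<in> carrier M" for x y
    using coordinates_add[OF \<kappa> rm_diff[OF M that] that(2)] by simp
  have add: "\<kappa> x + \<kappa> y = \<kappa> (x + y)" if "x \<in> carrier M" "y \<in> carrier M" for x y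
    using coordinates_add[OF \<kappa> that] by simp
  have "right_module N"
    unfolding right_module_def N_def rmodule.select_convs
  proof (intro conjI ballI allI; (elim imageE)?)
    show "0 \<in> \<kappa> ` carrier M" using coordinates_zero[OF M \<kappa>] rm_zero[OF M] by (metis imageI)
  qed (simp_all add: gk rm_act[OF M] act_one[OF M] act_mult[OF M] act_add_left[OF M]
      act_add_right[OF M] add diff rm_diff[OF M] rm_add[OF M])
  moreover have iso: "module_iso M N \<kappa>"
    using coordinates_inj[OF \<kappa>] by (auto simp: module_iso_def module_hom_def N_def gk add bij_betw_def)
  ultimately have "N \<in> mod_cat" using fd_isomorphic[OF fd] by (simp add: mod_cat_def)
  then show ?thesis using iso that by blast
qed

end

section \<open>Projective and injective modules\<close>

text \<open>Two sequences are coded as one, so that the direct sum of two modules in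
  \<open>nat \<Rightarrow> 'k\<close> lives in the same type.\<close>

definition interleave :: "(nat \<Rightarrow> 'k) \<Rightarrow> (nat \<Rightarrow> 'k) \<Rightarrow> nat \<Rightarrow> 'k" where
  "interleave x y = (\<lambda>n. if even n then x (n div 2) else y (n div 2))"

definition evens :: "(nat \<Rightarrow> 'k) \<Rightarrow> nat \<Rightarrow> 'k" where
  "evens z = (\<lambda>n. z (2 * n))"

definition odds :: "(nat \<Rightarrow> 'k) \<Rightarrow> nat \<Rightarrow> 'k" where
  "odds z = (\<lambda>n. z (2 * n + 1))"

lemma interleave_simps [simp]:
  "evens (interleave x y) = x" "odds (interleave x y) = y" "interleave (evens z) (odds z) = z"
  by (auto simp: interleave_def evens_def odds_def fun_eq_iff)

lemma interleave_add: "interleave (x + x') (y + y') = interleave x y + interleave x' y'"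
  by (auto simp: interleave_def fun_eq_iff)

lemma evens_odds_linear [simp]:
  "evens (z + w) = evens z + evens w" "odds (z + w) = odds z + odds w"
  "evens (z - u) = evens z - evens u" "odds (z - u) = odds z - odds u"
  "evens 0 = 0" "odds 0 = 0"
  by (auto simp: evens_def odds_def fun_eq_iff)

type_synonym ('a, 'k) kmodule = "('a, nat \<Rightarrow> 'k) rmodule"

definition biprod ::
  "('a::ring_1, 'k::field) kmodule \<Rightarrow> ('a, 'k) kmodule \<Rightarrow> ('a, 'k) kmodule" where
  "biprod M N = \<lparr>carrier = {z. evens z \<in> carrier M \<and> odds z \<in> carrier N},
     act = (\<lambda>z a. interleave (act M (evens z) a) (act N (odds z) a))\<rparr>"

lemma biprod_module:
  assumes "right_module M" "right_module N"
  shows "right_module (biprod M N)"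
  using assms
  by (auto simp: right_module_def biprod_def interleave_add)

lemma hom_evens: "module_hom (biprod M N) M evens"
  by (simp add: module_hom_def biprod_def)

lemma hom_odds: "module_hom (biprod M N) N odds"
  by (simp add: module_hom_def biprod_def)

lemma hom_pair: "module_hom L M f \<Longrightarrow> module_hom L N g \<Longrightarrow> module_hom L (biprod M N) (\<lambda>x. interleave (f x) (g x))"
  by (simp add: module_hom_def biprod_def interleave_add)

lemma hom_copair:
  "right_module L \<Longrightarrow> module_hom M L f \<Longrightarrow> module_hom N L g \<Longrightarrow>
    module_hom (biprod M N) L (\<lambda>z. f (evens z) + g (odds z))"
  by (rule hom_plus[OF _ hom_compose[OF hom_evens] hom_compose[OF hom_odds]])

lemma hom_left: "right_module N \<Longrightarrow> module_hom M (biprod M N) (\<lambda>x. interleave x 0)"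
  by (rule hom_pair[OF hom_id hom_const_zero])

lemma hom_right: "right_module M \<Longrightarrow> module_hom N (biprod M N) (\<lambda>y. interleave 0 y)"
  by (rule hom_pair[OF hom_const_zero hom_id])

context fd_algebra
begin

lemma mod_cat_iff: "M \<in> mod_cat \<longleftrightarrow> fd_module M"
  by (simp add: mod_cat_def)

lemma mod_cat_module: "M \<in> mod_cat \<Longrightarrow> right_module M"
  by (simp add: mod_cat_def fd_module_def)

lemma mod_cat_submodule: "M \<in> mod_cat \<Longrightarrow> submodule U M \<Longrightarrow> M\<lparr>carrier := U\<rparr> \<in> mod_cat"
  by (simp add: mod_cat_iff fd_submodule)

lemma mod_cat_ker:
  "M \<in> mod_cat \<Longrightarrow> right_module N \<Longrightarrow> module_hom M N f \<Longrightarrow> M\<lparr>carrier := module_ker M f\<rparr> \<in> mod_cat"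
  by (rule mod_cat_submodule[OF _ submodule_ker[OF mod_cat_module]])

lemma mod_cat_biprod:
  assumes "M \<in> mod_cat" "N \<in> mod_cat"
  shows "biprod M N \<in> mod_cat"
proof -
  note rm = mod_cat_module[OF assms(1)] mod_cat_module[OF assms(2)]
  obtain \<kappa> m where \<kappa>: "coordinates M \<kappa> m" using fd_module_coordinates assms(1) mod_cat_iff by blast
  obtain \<nu> n where \<nu>: "coordinates N \<nu> n" using fd_module_coordinates assms(2) mod_cat_iff by blast
  \<comment> \<open>From the index \<open>2 * (m + n)\<close> on, half the index is at least
    \<open>m\<close> and at least \<open>n\<close>, so both components vanish there.\<close>
  have "coordinates (biprod M N) (\<lambda>z. interleave (\<kappa> (evens z)) (\<nu> (odds z))) (2 * (m + n))"
    unfolding coordinates_def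
  proof (intro conjI ballI allI)
    show "inj_on (\<lambda>z. interleave (\<kappa> (evens z)) (\<nu> (odds z))) (carrier (biprod M N))"
    proof (rule inj_onI)
      fix z w assume *: "z \<in> carrier (biprod M N)" "w \<in> carrier (biprod M N)"
        "interleave (\<kappa> (evens z)) (\<nu> (odds z)) = interleave (\<kappa> (evens w)) (\<nu> (odds w))"
      from *(3) have "\<kappa> (evens z) = \<kappa> (evens w)" "\<nu> (odds z) = \<nu> (odds w)"
        by (metis interleave_simps(1), metis interleave_simps(2))
      then have "evens z = evens w" "odds z = odds w"
        using * coordinates_inj[OF \<kappa>] coordinates_inj[OF \<nu>] by (auto simp: biprod_def inj_on_def)
      then show "z = w" by (metis interleave_simps(3))
    qed
    have "i div 2 \<ge> m" "i div 2 \<ge> n" if "i \<ge> 2 * (m + n)" for i :: nat using that by auto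
    then show "(\<lambda>z. interleave (\<kappa> (evens z)) (\<nu> (odds z))) ` carrier (biprod M N) \<subseteq> supported (2 * (m + n))"
      using coordinates_supported[OF \<kappa>] coordinates_supported[OF \<nu>]
      by (fastforce simp: biprod_def supported_def interleave_def)
  next
    fix z w assume "z \<in> carrier (biprod M N)" "w \<in> carrier (biprod M N)"
    then show "interleave (\<kappa> (evens (z + w))) (\<nu> (odds (z + w))) =
        interleave (\<kappa> (evens z)) (\<nu> (odds z)) + interleave (\<kappa> (evens w)) (\<nu> (odds w))"
      by (simp add: biprod_def coordinates_add[OF \<kappa>] coordinates_add[OF \<nu>] interleave_add)
  next
    fix z c assume "z \<in> carrier (biprod M N)"
    then show "interleave (\<kappa> (evens (act (biprod M N) z (scale c 1)))) (\<nu> (odds (act (biprod M N) z (scale c 1)))) =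
        (\<lambda>i. c * interleave (\<kappa> (evens z)) (\<nu> (odds z)) i)"
      by (simp add: biprod_def coordinates_scale[OF \<kappa>] coordinates_scale[OF \<nu>]) (simp add: interleave_def fun_eq_iff)
  qed
  then show ?thesis using fd_moduleI[OF biprod_module[OF rm]] by (simp add: mod_cat_iff)
qed

section \<open>Lifting, extension, retracts and sums\<close>

lemma projective_fd: "projective P \<Longrightarrow> fd_module P"
  by (simp add: projective_def)

lemma injective_fd: "injective I \<Longrightarrow> fd_module I"
  by (simp add: injective_def)

lemma projective_lift:
  assumes "projective P" "M \<in> mod_cat" "N \<in> mod_cat" "module_hom M N p" "p ` carrier M = carrier N"
    "module_hom P N g"
  obtains h where "module_hom P M h" "\<forall>x\<in>carrier P. p (h x) = g x"
proof -
  have "\<exists>h. module_hom P M h \<and> (\<forall>x\<in>carrier P. p (h x) = g x)"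
    using assms(1)[unfolded projective_def, THEN conjunct2, rule_format, OF assms(2,3), of p g] assms(4-6)
    by simp
  then show ?thesis using that by blast
qed

lemma injective_extend_mono:
  assumes "injective I" "M \<in> mod_cat" "N \<in> mod_cat" "module_hom M N j" "inj_on j (carrier M)"
    "module_hom M I g"
  obtains h where "module_hom N I h" "\<forall>x\<in>carrier M. h (j x) = g x"
proof -
  have "\<exists>h. module_hom N I h \<and> (\<forall>x\<in>carrier M. h (j x) = g x)"
    using assms(1)[unfolded injective_def, THEN conjunct2, rule_format, OF assms(2,3), of j g] assms(4-6)
    by simp
  then show ?thesis using that by blast
qed

lemma injective_extend:
  assumes "injective I" "N \<in> mod_cat" "submodule U N" "module_hom (N\<lparr>carrier := U\<rparr>) I g"
  obtains h where "module_hom N I h" "\<forall>x\<in>U. h x = g x"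
proof -
  obtain h where "module_hom N I h" "\<forall>x\<in>carrier (N\<lparr>carrier := U\<rparr>). h x = g x"
    by (rule injective_extend_mono[OF assms(1) mod_cat_submodule[OF assms(2,3)] assms(2)
        hom_incl[OF submodule_subset[OF assms(3)]] inj_on_id2 assms(4)])
  then show ?thesis using that by simp
qed

text \<open>Lift \<open>g\<close> composed with the retraction over \<open>X\<close>, then restrict
  along \<open>i\<close>.\<close>

lemma projective_retract:
  assumes X: "projective X" and M: "fd_module M" and "retract M X"
  shows "projective M"
proof -
  obtain i r where ir: "module_hom M X i" "module_hom X M r" "\<And>x. x \<in> carrier M \<Longrightarrow> r (i x) = x"
    using \<open>retract M X\<close> by (auto simp: retract_def)
  show ?thesis
    unfolding projective_def
  proof (intro conjI M ballI allI impI; elim conjE)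
    fix A B p g assume *: "A \<in> mod_cat" "B \<in> mod_cat" "module_hom A B p" "p ` carrier A = carrier B"
      "module_hom M B g"
    obtain h where h: "module_hom X A h" "\<forall>x\<in>carrier X. p (h x) = g (r x)"
      by (rule projective_lift[OF X *(1-4) hom_compose[OF ir(2) *(5)]])
    show "\<exists>h. module_hom M A h \<and> (\<forall>x\<in>carrier M. p (h x) = g x)"
      using hom_compose[OF ir(1) h(1)] h(2) ir(3) hom_in[OF ir(1)] by (intro exI[of _ "\<lambda>x. h (i x)"]) auto
  qed
qed

text \<open>Extend \<open>g\<close> followed by the inclusion into \<open>X\<close>, then apply the
  retraction.\<close>

lemma injective_retract:
  assumes X: "injective X" and M: "fd_module M" and "retract M X"
  shows "injective M"
proof -
  obtain i r where ir: "module_hom M X i" "module_hom X M r" "\<And>x. x \<in> carrier M \<Longrightarrow> r (i x) = x"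
    using \<open>retract M X\<close> by (auto simp: retract_def)
  show ?thesis
    unfolding injective_def
  proof (intro conjI M ballI allI impI; elim conjE)
    fix A B j g assume *: "A \<in> mod_cat" "B \<in> mod_cat" "module_hom A B j" "inj_on j (carrier A)"
      "module_hom A M g"
    obtain h where h: "module_hom B X h" "\<forall>x\<in>carrier A. h (j x) = i (g x)"
      by (rule injective_extend_mono[OF X *(1-4) hom_compose[OF *(5) ir(1)]])
    show "\<exists>h. module_hom B M h \<and> (\<forall>x\<in>carrier A. h (j x) = g x)"
      using hom_compose[OF h(1) ir(2)] h(2) ir(3) hom_in[OF *(5)] by (intro exI[of _ "\<lambda>x. r (h x)"]) auto
  qed
qed

lemma projective_biprod:
  fixes P Q :: "('a, 'k) kmodule"
  assumes P: "projective P" and Q: "projective Q"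
  shows "projective (biprod P Q)"
  unfolding projective_def
proof (intro conjI ballI allI impI; (elim conjE)?)
  show "fd_module (biprod P Q)" by (rule mod_cat_biprod[unfolded mod_cat_iff, OF projective_fd[OF P] projective_fd[OF Q]])
  fix A B p g assume *: "A \<in> mod_cat" "B \<in> mod_cat" "module_hom A B p" "p ` carrier A = carrier B"
    "module_hom (biprod P Q) B g"
  note rm = fd_right_module[OF projective_fd[OF P]] fd_right_module[OF projective_fd[OF Q]]
  obtain h where h: "module_hom P A h" "\<forall>x\<in>carrier P. p (h x) = g (interleave x 0)"
    by (rule projective_lift[OF P *(1-4) hom_compose[OF hom_left[OF rm(2)] *(5)]])
  obtain k where k: "module_hom Q A k" "\<forall>x\<in>carrier Q. p (k x) = g (interleave 0 x)"
    by (rule projective_lift[OF Q *(1-4) hom_compose[OF hom_right[OF rm(1)] *(5)]])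
  have "p (h (evens z) + k (odds z)) = g z" if z: "z \<in> carrier (biprod P Q)" for z
  proof -
    have e: "evens z \<in> carrier P" "odds z \<in> carrier Q" using z by (auto simp: biprod_def)
    have "z = interleave (evens z) 0 + interleave 0 (odds z)"
      by (simp add: interleave_add[symmetric])
    then have "g z = g (interleave (evens z) 0) + g (interleave 0 (odds z))"
      using hom_add[OF *(5)] hom_in[OF hom_left[OF rm(2)] e(1)] hom_in[OF hom_right[OF rm(1)] e(2)] by metis
    then show ?thesis using hom_add[OF *(3)] hom_in[OF h(1) e(1)] hom_in[OF k(1) e(2)] h(2) k(2) e by simp
  qed
  then show "\<exists>h. module_hom (biprod P Q) A h \<and> (\<forall>x\<in>carrier (biprod P Q). p (h x) = g x)"
    using hom_copair[OF mod_cat_module[OF *(1)] h(1) k(1)] by blast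
qed

lemma injective_biprod:
  fixes I J :: "('a, 'k) kmodule"
  assumes I: "injective I" and J: "injective J"
  shows "injective (biprod I J)"
  unfolding injective_def
proof (intro conjI ballI allI impI; (elim conjE)?)
  show "fd_module (biprod I J)" by (rule mod_cat_biprod[unfolded mod_cat_iff, OF injective_fd[OF I] injective_fd[OF J]])
  fix A B j g assume *: "A \<in> mod_cat" "B \<in> mod_cat" "module_hom A B j" "inj_on j (carrier A)"
    "module_hom A (biprod I J) g"
  obtain h where h: "module_hom B I h" "\<forall>x\<in>carrier A. h (j x) = evens (g x)"
    by (rule injective_extend_mono[OF I *(1-4) hom_compose[OF *(5) hom_evens]])
  obtain k where k: "module_hom B J k" "\<forall>x\<in>carrier A. k (j x) = odds (g x)"
    by (rule injective_extend_mono[OF J *(1-4) hom_compose[OF *(5) hom_odds]])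
  show "\<exists>h. module_hom B (biprod I J) h \<and> (\<forall>x\<in>carrier A. h (j x) = g x)"
    using hom_pair[OF h(1) k(1)] h(2) k(2) by (intro exI[of _ "\<lambda>x. interleave (h x) (k x)"]) simp
qed

section \<open>The regular module and enough projectives\<close>

lemma fd_regular: "fd_module (regular_module :: ('a, 'a) rmodule)"
proof -
  obtain B where B: "finite B" "span B = UNIV" using finite_dimensional by blast
  have "\<exists>c. x = (\<Sum>s\<in>B. s * scale (c s) 1)" for x
  proof -
    have "x \<in> span B" using B by simp
    then obtain u where "x = (\<Sum>s\<in>B. scale (u s) s)" using span_finite[OF B(1)] by auto
    then show ?thesis by (auto simp: scale_one_mult)
  qed
  then show ?thesis using B(1)
    unfolding fd_module_def right_module_def regular_module_def
    by (auto simp: algebra_simps)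
qed

lemma projective_regular: "projective (regular_module :: ('a, 'a) rmodule)"
  unfolding projective_def
proof (intro conjI fd_regular ballI allI impI; elim conjE)
  fix M N and p g assume *: "M \<in> mod_cat" "N \<in> mod_cat" "module_hom M N p" "p ` carrier M = carrier N"
    "module_hom (regular_module :: ('a, 'a) rmodule) N g"
  note M = mod_cat_module[OF *(1)]
  \<comment> \<open>A homomorphism out of \<open>A\<close> is determined by its value at 1, so a
    preimage of \<open>g 1\<close> gives the lift.\<close>
  have "g 1 \<in> p ` carrier M" using hom_in[OF *(5)] *(4) by (simp add: regular_module_def)
  then obtain y where y: "y \<in> carrier M" "p y = g 1" by force
  have "module_hom regular_module M (\<lambda>a. act M y a)"
    by (simp add: module_hom_def regular_module_def rm_act[OF M y(1)] act_add_right[OF M y(1)] act_mult[OF M y(1)])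
  moreover have "p (act M y a) = g a" for a
    using hom_act[OF *(3) y(1), of a] hom_act[OF *(5), of 1 a] y(2) by (simp add: regular_module_def)
  ultimately show "\<exists>h. module_hom regular_module M h \<and> (\<forall>x\<in>carrier regular_module. p (h x) = g x)"
    by blast
qed

lemma regular_copy:
  obtains B f where "B \<in> mod_cat" "module_iso (regular_module :: ('a, 'a) rmodule) B f" "projective B"
proof -
  obtain B f where B: "B \<in> mod_cat" "module_iso (regular_module :: ('a, 'a) rmodule) B f"
    using mod_cat_copy[OF fd_regular] .
  have "isomorphic (regular_module :: ('a, 'a) rmodule) B" using B(2) by (auto simp: isomorphic_def)
  then have "retract B (regular_module :: ('a, 'a) rmodule)"
    by (intro isomorphic_retract mod_cat_module[OF B(1)] iso_sym[OF fd_right_module[OF fd_regular]])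
  then have "projective B" using projective_retract[OF projective_regular] B(1) by (simp add: mod_cat_iff)
  then show ?thesis using that B by blast
qed

text \<open>A maximal one among the images of projectives in \<open>M\<close> is everything: adding
  a copy of the regular module to the source, mapped by acting on a given \<open>x\<close>, enlarges
  the image so that it contains \<open>x\<close>.\<close>

lemma enough_projectives:
  assumes "M \<in> mod_cat"
  obtains R :: "('a, 'k) kmodule" and p where "projective R" "module_hom R M p" "p ` carrier R = carrier M"
proof -
  note M = mod_cat_module[OF assms]
  have fd: "fd_module M" using assms by (simp add: mod_cat_iff)
  obtain B f where B: "B \<in> mod_cat" "module_iso (regular_module :: ('a, 'a) rmodule) B f" "projective B"
    using regular_copy .
  note rB = mod_cat_module[OF B(1)]
  obtain e where "module_iso B (regular_module :: ('a, 'a) rmodule) e"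
    and e_inv: "\<forall>a\<in>carrier regular_module. e (f a) = a"
    using iso_inverse[OF fd_right_module[OF fd_regular] B(2)] by blast
  then have e: "module_hom B (regular_module :: ('a, 'a) rmodule) e" "\<And>a. e (f a) = a"
    by (simp_all add: module_iso_def) (simp add: regular_module_def)
  define P where "P U = (\<exists>(R :: ('a, 'k) kmodule) p. projective R \<and> module_hom R M p \<and> U = p ` carrier R)" for U
  have "P {0}"
    unfolding P_def using B(3) hom_const_zero[OF M, of B] rm_zero[OF rB] 
    by (intro exI[of _ B] exI[of _ "\<lambda>x. 0"]) auto
  then obtain V where V: "submodule V M" "P V"
    "\<And>W. submodule W M \<Longrightarrow> P W \<Longrightarrow> V \<subseteq> W \<Longrightarrow> W = V"
    using maximal_submodule[where P = P, OF fd submodule_zero[OF M]] by blast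
  then obtain R :: "('a, 'k) kmodule" and p where R: "projective R" "module_hom R M p" "V = p ` carrier R" by (auto simp: P_def)
  note rR = fd_right_module[OF projective_fd[OF R(1)]]
  have "x \<in> V" if x: "x \<in> carrier M" for x
  proof -
    define q where "q z = p (evens z) + act M x (e (odds z))" for z
    have "module_hom (regular_module :: ('a, 'a) rmodule) M (act M x)"
      by (simp add: module_hom_def regular_module_def rm_act[OF M x] act_add_right[OF M x] act_mult[OF M x])
    from hom_copair[OF M R(2) hom_compose[OF e(1) this]]
    have q: "module_hom (biprod R B) M q" by (simp add: q_def[abs_def])
    define W where "W = q ` carrier (biprod R B)"
    have W: "submodule W M" unfolding W_def by (rule submodule_range[OF biprod_module[OF rR rB] M q])
    have "P W" using projective_biprod[OF R(1) B(3)] q by (auto simp: P_def W_def)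
    moreover have "V \<subseteq> W"
    proof
      fix y assume "y \<in> V"
      then obtain u where u: "u \<in> carrier R" "y = p u" using R(3) by auto
      have "q (interleave u 0) = y"
        using hom_zero[OF rB e(1)] by (simp add: q_def u act_zero_right[OF M x])
      then show "y \<in> W" using hom_in[OF hom_left[OF rB] u(1)] by (auto simp: W_def)
    qed
    ultimately have "W = V" using V(3)[OF W] by blast
    \<comment> \<open>The unit of the added copy of \<open>A\<close> goes to
      \<open>x\<close>.\<close>
    moreover have "q (interleave 0 (f 1)) = x"
      using hom_zero[OF rR R(2)] by (simp add: q_def e act_one[OF M x])
    moreover have "f 1 \<in> carrier B" using B(2) by (auto simp: module_iso_def module_hom_def regular_module_def)
    then have "interleave 0 (f 1) \<in> carrier (biprod R B)" by (rule hom_in[OF hom_right[OF rR]])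
    ultimately show "x \<in> V" by (metis W_def imageI)
  qed
  then have "V = carrier M" using submodule_subset[OF V(1)] by blast
  then show ?thesis using R that by blast
qed

section \<open>The dual of the algebra and enough injectives\<close>

lemma dual_carrier:
  "f \<in> carrier dual_module \<longleftrightarrow> (\<forall>a b. f (a + b) = f a + f b) \<and> (\<forall>c a. f (scale c a) = c * f a)"
proof -
  have "vector_space ((*) :: 'k \<Rightarrow> 'k \<Rightarrow> 'k)" by unfold_locales (auto simp: algebra_simps)
  then show ?thesis
    using vector_space_axioms by (simp add: dual_module_def Vector_Spaces.linear_iff)
qed

lemma dual_act [simp]: "act dual_module f a = (\<lambda>x. f (a * x))"
  by (simp add: dual_module_def)

lemma dual_right_module: "right_module dual_module"
  unfolding right_module_def
  by (auto simp: dual_carrier algebra_simps fun_eq_iff scale_mult_right scale_mult_left mult.assoc)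

text \<open>A functional is determined by its values on a finite spanning set; these values are the
  coordinates.\<close>

lemma fd_dual: "fd_module dual_module"
proof -
  obtain B where B: "finite B" "span B = UNIV" using finite_dimensional by blast
  obtain e n where e: "bij_betw e {..<n::nat} B"
    using ex_bij_betw_nat_finite[OF B(1)] by (metis atLeast0LessThan)
  define \<kappa> :: "('a \<Rightarrow> 'k) \<Rightarrow> nat \<Rightarrow> 'k" where "\<kappa> f = (\<lambda>i. if i < n then f (e i) else 0)" for f
  have "coordinates dual_module \<kappa> n"
    unfolding coordinates_def
  proof (intro conjI ballI allI)
    show "inj_on \<kappa> (carrier dual_module)"
    proof (rule inj_onI)
      fix f g assume *: "f \<in> carrier dual_module" "g \<in> carrier dual_module" "\<kappa> f = \<kappa> g"
      have zero: "f 0 = 0" "g 0 = 0" using * dual_carrier by (metis add_cancel_right_right)+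
      have "f b = g b" if "b \<in> B" for b
      proof -
        have "b \<in> e ` {..<n}" using e that by (simp add: bij_betw_def)
        then obtain i where "i < n" "b = e i" by auto
        then show ?thesis using fun_cong[OF *(3), of i] by (simp add: \<kappa>_def)
      qed
      note agree = this
      have "f a = g a" if "a \<in> span B" for a
        using that by (induction a rule: span_induct_alt) (use * dual_carrier zero agree in auto)
      then show "f = g" using B(2) by auto
    qed
  qed (auto simp: \<kappa>_def supported_def fun_eq_iff dual_carrier scale_one_mult)
  then show ?thesis by (rule fd_moduleI[OF dual_right_module])
qed

text \<open>Homomorphisms from \<open>M\<close> to \<open>D(A)\<close> correspond to functionals on
  \<open>M\<close> by evaluation at 1. Injectivity thus becomes extension of functionals, for which
  the \<open>K\<close>-linear projection \<open>\<rho>\<close> onto the image of \<open>j\<close> is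
  enough.\<close>

lemma injective_dual: "injective dual_module"
  unfolding injective_def
proof (intro conjI fd_dual ballI allI impI; elim conjE)
  fix M N j g assume *: "M \<in> mod_cat" "N \<in> mod_cat" "module_hom M N j" "inj_on j (carrier M)"
    "module_hom M dual_module g"
  note M = mod_cat_module[OF *(1)] and N = mod_cat_module[OF *(2)]
  define U where "U = j ` carrier M"
  have U: "submodule U N" unfolding U_def by (rule submodule_range[OF M N *(3)])
  obtain \<rho> where \<rho>: "\<forall>x\<in>carrier N. \<rho> x \<in> U"
    "\<forall>x\<in>carrier N. \<forall>y\<in>carrier N. \<rho> (x + y) = \<rho> x + \<rho> y"
    "\<forall>x\<in>carrier N. \<forall>c. \<rho> (act N x (scale c 1)) = act N (\<rho> x) (scale c 1)"
    "\<forall>x\<in>U. \<rho> x = x"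
    using linear_projection[OF _ U] *(2) mod_cat_iff by blast
  note \<rho> = \<rho>[rule_format]
  have "module_iso M (N\<lparr>carrier := U\<rparr>) j"
    using hom_into[OF *(3)] *(4) by (auto simp: module_iso_def bij_betw_def U_def)
  from iso_inverse[OF M this] obtain i where
    i: "module_iso (N\<lparr>carrier := U\<rparr>) M i" "\<forall>x\<in>carrier M. i (j x) = x" by blast
  have ih: "module_hom (N\<lparr>carrier := U\<rparr>) M i" using i(1) by (simp add: module_iso_def)
  \<comment> \<open>The functional attached to \<open>g\<close>, moved to the image of
    \<open>j\<close>.\<close>
  define \<psi> where "\<psi> y = g (i y) 1" for y
  have \<psi>_add: "\<psi> (x + y) = \<psi> x + \<psi> y" if "x \<in> U" "y \<in> U" for x y
    using that hom_add[OF ih] hom_add[OF *(5)] hom_in[OF ih] by (simp add: \<psi>_def)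
  have \<psi>_scale: "\<psi> (act N x (scale c 1)) = c * \<psi> x" if "x \<in> U" for x c
  proof -
    have "i (act N x (scale c 1)) = act M (i x) (scale c 1)" "i x \<in> carrier M"
      using that hom_act[OF ih] hom_in[OF ih] by simp_all
    then show ?thesis
      using hom_act[OF *(5), of "i x"] hom_in[OF *(5), of "i x"] by (simp add: \<psi>_def dual_carrier scale_one_mult)
  qed
  have \<psi>j: "\<psi> (act N (j x) a) = g x a" if "x \<in> carrier M" for x a
    using that hom_act[OF *(3) that, of a] i(2) rm_act[OF M that] hom_act[OF *(5) that, of a]
    by (metis \<psi>_def dual_act mult_1_right)
  \<comment> \<open>The homomorphism attached to the extended functional
    \<open>\<psi> \<circ> \<rho>\<close>.\<close>
  define h where "h y = (\<lambda>a. \<psi> (\<rho> (act N y a)))" for y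
  have h_in: "h y \<in> carrier dual_module" if y: "y \<in> carrier N" for y
  proof -
    have "act N y (scale c a) = act N (act N y a) (scale c 1)" for c a
      using act_mult[OF N y, of a "scale c 1"] by (simp add: scale_one_mult)
    then show ?thesis
      by (simp add: dual_carrier h_def act_add_right[OF N y] \<rho> rm_act[OF N y] \<psi>_add \<psi>_scale)
  qed
  have "module_hom N dual_module h"
    unfolding module_hom_def
    by (auto simp: h_in) (simp_all add: h_def fun_eq_iff act_add_left[OF N] \<rho> rm_act[OF N] \<psi>_add act_mult[OF N])
  moreover have "h (j x) = g x" if x: "x \<in> carrier M" for x
  proof -
    have "act N (j x) a \<in> U" for a using hom_act[OF *(3) x, of a, symmetric] rm_act[OF M x] by (simp add: U_def)
    then show ?thesis using \<psi>j[OF x] by (simp add: h_def \<rho>(4))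
  qed
  ultimately show "\<exists>h. module_hom N dual_module h \<and> (\<forall>x\<in>carrier M. h (j x) = g x)" by blast
qed

text \<open>A coordinate that is nonzero at \<open>x\<close> is a functional on \<open>M\<close>;
  the homomorphism attached to it sends \<open>x\<close> to a functional whose value at 1 is that
  coordinate.\<close>

lemma dual_separates:
  assumes "M \<in> mod_cat" "x \<in> carrier M" "x \<noteq> 0"
  obtains g where "module_hom M dual_module g" "g x \<noteq> 0"
proof -
  note M = mod_cat_module[OF assms(1)]
  obtain \<kappa> n where \<kappa>: "coordinates M \<kappa> n" using fd_module_coordinates assms(1) mod_cat_iff by blast
  have "\<kappa> x \<noteq> 0"
    using coordinates_inj[OF \<kappa>] coordinates_zero[OF M \<kappa>] assms rm_zero[OF M] by (metis inj_onD)
  then obtain i where i: "\<kappa> x i \<noteq> 0" by (auto simp: fun_eq_iff)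
  define g where "g y = (\<lambda>a. \<kappa> (act M y a) i)" for y
  have g_in: "g y \<in> carrier dual_module" if y: "y \<in> carrier M" for y
  proof -
    have "act M y (scale c a) = act M (act M y a) (scale c 1)" for c a
      using act_mult[OF M y, of a "scale c 1"] by (simp add: scale_one_mult)
    then show ?thesis
      by (simp add: dual_carrier g_def act_add_right[OF M y] rm_act[OF M y] coordinates_add[OF \<kappa>]
          coordinates_scale[OF \<kappa>])
  qed
  have "module_hom M dual_module g"
    unfolding module_hom_def
    by (auto simp: g_in) (simp_all add: g_def fun_eq_iff act_add_left[OF M] rm_act[OF M] coordinates_add[OF \<kappa>]
        act_mult[OF M])
  moreover have "g x 1 \<noteq> 0" using i assms(2) by (simp add: g_def act_one[OF M])
  then have "g x \<noteq> 0" by auto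
  ultimately show ?thesis using that by blast
qed

text \<open>Dual to the projective case. A homomorphism to an injective module with minimal kernel
  is injective, since a nonzero element of the kernel could be detected by adding a factor
  \<open>D(A)\<close> to the target.\<close>

lemma enough_injectives:
  assumes "M \<in> mod_cat"
  obtains J :: "('a, 'k) kmodule" and j where "injective J" "module_hom M J j" "inj_on j (carrier M)"
proof -
  note M = mod_cat_module[OF assms]
  have fd: "fd_module M" using assms by (simp add: mod_cat_iff)
  obtain D f where D: "D \<in> mod_cat" "module_iso dual_module D f" using mod_cat_copy[OF fd_dual] .
  note rD = mod_cat_module[OF D(1)]
  have fh: "module_hom dual_module D f" "inj_on f (carrier dual_module)"
    using D(2) by (auto simp: module_iso_def bij_betw_def)
  have "isomorphic dual_module D" using D(2) by (auto simp: isomorphic_def)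
  then have "retract D dual_module" by (intro isomorphic_retract rD iso_sym[OF dual_right_module])
  then have Di: "injective D" using injective_retract[OF injective_dual] D(1) by (simp add: mod_cat_iff)
  define P where "P U = (\<exists>(J :: ('a, 'k) kmodule) j. injective J \<and> module_hom M J j \<and> U = module_ker M j)" for U
  have "P (carrier M)"
    unfolding P_def using Di hom_const_zero[OF rD, of M]
    by (intro exI[of _ D] exI[of _ "\<lambda>x. 0"]) (auto simp: module_ker_def)
  then obtain V where V: "submodule V M" "P V"
    "\<And>W. submodule W M \<Longrightarrow> P W \<Longrightarrow> W \<subseteq> V \<Longrightarrow> W = V"
    using minimal_submodule[where P = P, OF fd submodule_carrier[OF M]] by blast
  then obtain J :: "('a, 'k) kmodule" and j where J: "injective J" "module_hom M J j" "V = module_ker M j" by (auto simp: P_def)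
  note rJ = fd_right_module[OF injective_fd[OF J(1)]]
  have "x = 0" if x: "x \<in> carrier M" "j x = 0" for x
  proof (rule ccontr)
    assume "x \<noteq> 0"
    then obtain g where g: "module_hom M dual_module g" "g x \<noteq> 0" using dual_separates[OF assms x(1)] by blast
    define k where "k y = interleave (j y) (f (g y))" for y
    have k: "module_hom M (biprod J D) k"
      unfolding k_def by (rule hom_pair[OF J(2) hom_compose[OF g(1) fh(1)]])
    have eo: "j y = evens (k y)" "f (g y) = odds (k y)" for y by (simp_all add: k_def)
    have "P (module_ker M k)" using injective_biprod[OF J(1) Di] k by (auto simp: P_def)
    moreover have "module_ker M k \<subseteq> V" by (auto simp: J(3) ker_iff eo)
    ultimately have "module_ker M k = V"
      using V(3)[OF submodule_ker[OF M biprod_module[OF rJ rD] k]] by blast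
    then have "k x = 0" using x by (auto simp: J(3) ker_iff)
    then have "f (g x) = 0" by (simp add: eo)
    then show False
      using hom_inj_iff[OF dual_right_module fh(1)] fh(2) hom_in[OF g(1) x(1)] g(2) by blast
  qed
  then show ?thesis using that J hom_inj_iff[OF M J(2)] by blast
qed

section \<open>Projective covers and injective hulls\<close>

text \<open>Take a minimal submodule \<open>S\<close> of a projective \<open>R\<close> that still
  maps onto \<open>M\<close>. Lifting \<open>p\<close> through \<open>S\<close> gives
  \<open>h\<close> from \<open>R\<close> to \<open>S\<close>, which restricts to an automorphism of
  \<open>S\<close>; so \<open>S\<close> is a summand of \<open>R\<close>. Minimality also makes the
  kernel small.\<close>

lemma projective_cover:
  assumes "M \<in> mod_cat"
  obtains S :: "('a, 'k) kmodule" and p where "projective S" "module_hom S M p" "p ` carrier S = carrier M" "small (module_ker S p) S"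
proof -
  note M = mod_cat_module[OF assms]
  obtain R :: "('a, 'k) kmodule" and p
    where R: "projective R" "module_hom R M p" "p ` carrier R = carrier M"
    by (rule enough_projectives[OF assms])
  note fdR = projective_fd[OF R(1)]
  note rR = fd_right_module[OF fdR]
  obtain S where S: "submodule S R" "p ` S = carrier M"
    "\<And>W. submodule W R \<Longrightarrow> p ` W = carrier M \<Longrightarrow> W \<subseteq> S \<Longrightarrow> W = S"
    using minimal_submodule[where P = "\<lambda>U. p ` U = carrier M", OF fdR submodule_carrier[OF rR] R(3)] by blast
  let ?S = "R\<lparr>carrier := S\<rparr>"
  have S_sub: "S \<subseteq> carrier R" by (rule submodule_subset[OF S(1)])
  have S_cat: "?S \<in> mod_cat" using fd_submodule[OF fdR S(1)] by (simp add: mod_cat_iff)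
  note rS = mod_cat_module[OF S_cat]
  have pS: "module_hom ?S M p" by (rule hom_restrict[OF R(2) S_sub])
  have "p ` carrier ?S = carrier M" using S(2) by simp
  then obtain h where h: "module_hom R ?S h" "\<forall>x\<in>carrier R. p (h x) = p x"
    by (rule projective_lift[OF R(1) S_cat assms pS _ R(2)])
  have hS: "module_hom ?S ?S h" by (rule hom_restrict[OF h(1) S_sub])
  \<comment> \<open>\<open>h\<close> commutes with \<open>p\<close>, so the image of
    \<open>S\<close> under \<open>h\<close> still maps onto \<open>M\<close> and minimality
    applies.\<close>
  have "h ` S = S"
  proof (rule S(3))
    show "submodule (h ` S) R"
      using submodule_trans[OF S(1)] submodule_range[OF rS rS hS] by simp
    have "p ` h ` S = p ` S" using h(2) S_sub by (force simp: image_iff)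
    then show "p ` h ` S = carrier M" using S(2) by simp
    show "h ` S \<subseteq> S" using hom_in[OF hS] by auto
  qed
  then have "module_iso ?S ?S h"
    using hS surjective_endomorphism_injective[OF fd_submodule[OF fdR S(1)] hS]
    by (auto simp: module_iso_def bij_betw_def)
  from iso_inverse[OF rS this] obtain k where
    k: "module_iso ?S ?S k" "\<forall>x\<in>carrier ?S. k (h x) = x" by blast
  \<comment> \<open>Correcting \<open>h\<close> by the inverse \<open>k\<close> of its restriction
    gives a retraction of \<open>R\<close> onto \<open>S\<close>.\<close>
  have "retract ?S R"
    unfolding retract_def
    by (intro exI[of _ "\<lambda>x. x"] exI[of _ "\<lambda>x. k (h x)"])
       (use k hom_compose[OF h(1)] hom_incl[OF S_sub] in \<open>auto simp: module_iso_def\<close>)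
  then have proj: "projective ?S" using projective_retract[OF R(1)] S_cat by (simp add: mod_cat_iff)
  have "small (module_ker ?S p) ?S"
    unfolding small_def
  proof (intro allI impI; elim conjE)
    fix L assume L: "submodule L ?S" "carrier ?S \<subseteq> sum_of (module_ker ?S p) L"
    \<comment> \<open>If \<open>L\<close> and the kernel generate \<open>S\<close>, then
      \<open>L\<close> already maps onto \<open>M\<close>.\<close>
    have "L = S"
    proof (rule S(3))
      show "submodule L R" by (rule submodule_trans[OF S(1) L(1)])
      show "L \<subseteq> S" using submodule_subset[OF L(1)] by simp
      have *: "p s \<in> p ` L" if s: "s \<in> S" for s
      proof -
        have "s \<in> sum_of (module_ker ?S p) L" using L(2) s by auto
        then obtain u l where ul: "u \<in> module_ker ?S p" "l \<in> L" "s = u + l" by (rule sum_ofE)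
        then have "p s = p l" using hom_add[OF pS, of u l] \<open>L \<subseteq> S\<close> by (auto simp: ker_iff)
        then show ?thesis using ul by blast
      qed
      have "p ` S \<subseteq> p ` L" using * by auto
      moreover have "p ` L \<subseteq> p ` S" using \<open>L \<subseteq> S\<close> by (rule image_mono)
      ultimately show "p ` L = carrier M" using S(2) by simp
    qed
    then show "L = carrier ?S" by simp
  qed
  then show ?thesis using that[OF proj pS] S(2) by simp
qed

text \<open>
  The injective hull is a maximal essential extension \<open>E\<close> of \<open>U\<close> inside an injective module \<open>J\<close>;
  the projection onto \<open>E\<close> along a maximal \<open>V\<close> with \<open>V \<inter> E = {0}\<close> extends to a retraction of \<open>J\<close>.
\<close>

lemma injective_hull:
  assumes "M \<in> mod_cat"
  obtains I :: "('a, 'k) kmodule" and i where "injective I" "module_hom M I i" "inj_on i (carrier M)" "essential (i ` carrier M) I"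
proof -
  note M = mod_cat_module[OF assms]
  obtain J :: "('a, 'k) kmodule" and j
    where J: "injective J" "module_hom M J j" "inj_on j (carrier M)"
    by (rule enough_injectives[OF assms])
  note fdJ = injective_fd[OF J(1)]
  note rJ = fd_right_module[OF fdJ]
  have J_cat: "J \<in> mod_cat" using fdJ by (simp add: mod_cat_iff)
  define U where "U = j ` carrier M"
  have U: "submodule U J" unfolding U_def by (rule submodule_range[OF M rJ J(2)])
  have "essential U (J\<lparr>carrier := U\<rparr>)"
    using submodule_restrict[OF U] by (auto simp: essential_def dest: submodule_subset simp: Int_absorb1)
  then obtain E where E: "submodule E J" "essential U (J\<lparr>carrier := E\<rparr>)"
    "\<And>W. submodule W J \<Longrightarrow> essential U (J\<lparr>carrier := W\<rparr>) \<Longrightarrow> E \<subseteq> W \<Longrightarrow> W = E"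
    using maximal_submodule[where P = "\<lambda>E. essential U (J\<lparr>carrier := E\<rparr>)", OF fdJ U] by blast
  have UE: "U \<subseteq> E" using E(2) submodule_subset by (fastforce simp: essential_def)
  have E_sub: "E \<subseteq> carrier J" by (rule submodule_subset[OF E(1)])
  have "{0} \<inter> E = {0}" using sub_zero[OF E(1)] by auto
  then obtain V where V: "submodule V J" "V \<inter> E = {0}"
    "\<And>W. submodule W J \<Longrightarrow> W \<inter> E = {0} \<Longrightarrow> V \<subseteq> W \<Longrightarrow> W = V"
    using maximal_submodule[where P = "\<lambda>V. V \<inter> E = {0}", OF fdJ submodule_zero[OF rJ]] by blast
  have V_sub: "V \<subseteq> carrier J" by (rule submodule_subset[OF V(1)])
  define W where "W = sum_of E V"
  have W: "submodule W J" unfolding W_def by (rule submodule_sum_of[OF rJ E(1) V(1)])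
  obtain g where g: "module_hom (J\<lparr>carrier := W\<rparr>) (J\<lparr>carrier := E\<rparr>) g" "\<forall>e\<in>E. g e = e" "\<forall>v\<in>V. g v = 0"
    unfolding W_def using V(2) by (auto intro: independent_projection[OF rJ E(1) V(1)])
  obtain k where k: "module_hom J J k" "\<forall>x\<in>W. k x = g x"
    by (rule injective_extend[OF J(1) J_cat W hom_from_into[OF g(1) E_sub]])
  have kE: "k e = e" if "e \<in> E" for e
    using k(2) g(2) that sum_of_supersets[OF E(1) V(1)] by (auto simp: W_def)
  have kV: "k v = 0" if "v \<in> V" for v
    using k(2) g(3) that sum_of_supersets[OF E(1) V(1)] by (auto simp: W_def)
  \<comment> \<open>The kernel of \<open>k\<close> meets \<open>E\<close> trivially, as
    \<open>k\<close> fixes \<open>E\<close>, and it contains \<open>V\<close>; maximality of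
    \<open>V\<close> gives equality.\<close>
  have ker: "module_ker J k = V"
  proof (rule V(3)[OF submodule_ker[OF rJ rJ k(1)]])
    show "module_ker J k \<inter> E = {0}"
      using kE sub_zero[OF E(1)] rm_zero[OF rJ] by (auto simp: ker_iff)
    show "V \<subseteq> module_ker J k" using kV V_sub by (auto simp: ker_iff)
  qed
  define F where "F = k ` carrier J"
  have F: "submodule F J" unfolding F_def by (rule submodule_range[OF rJ rJ k(1)])
  have EF: "E \<subseteq> F" using kE E_sub unfolding F_def by (metis image_eqI subsetD subsetI)
  \<comment> \<open>A nonzero submodule \<open>X\<close> of the image pulls back to a module
    properly containing \<open>V\<close>, which therefore meets \<open>E\<close>. As
    \<open>k\<close> fixes \<open>E\<close>, \<open>X\<close> itself meets \<open>E\<close>, and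
    then \<open>U\<close> by essentiality.\<close>
  have "essential U (J\<lparr>carrier := F\<rparr>)"
    unfolding essential_def
  proof (intro conjI allI impI; (elim conjE)?)
    show "submodule U (J\<lparr>carrier := F\<rparr>)" by (rule submodule_restrict[OF U]) (use UE EF in blast)
    fix X assume X: "submodule X (J\<lparr>carrier := F\<rparr>)" "X \<noteq> {0}"
    have XJ: "submodule X J" by (rule submodule_trans[OF F X(1)])
    define Y where "Y = {x \<in> carrier J. k x \<in> X}"
    have Y: "submodule Y J" unfolding Y_def by (rule submodule_vimage[OF rJ rJ k(1) XJ])
    obtain x where x: "x \<in> X" "x \<noteq> 0" using X(2) sub_zero[OF XJ] by blast
    then obtain y where y: "y \<in> carrier J" "x = k y" using submodule_subset[OF X(1)] by (auto simp: F_def)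
    have "y \<in> Y" "y \<notin> V" using x y ker by (auto simp: Y_def ker_iff)
    moreover have "V \<subseteq> Y" using kV V_sub sub_zero[OF XJ] by (auto simp: Y_def)
    ultimately have "Y \<inter> E \<noteq> {0}" using V(3)[OF Y] by blast
    then obtain e where e: "e \<in> Y" "e \<in> E" "e \<noteq> 0" using sub_zero[OF Y] sub_zero[OF E(1)] by blast
    then have "e \<in> X \<inter> E" using kE by (auto simp: Y_def)
    then have "X \<inter> E \<noteq> {0}" using e by blast
    moreover have "submodule (X \<inter> E) (J\<lparr>carrier := E\<rparr>)"
      using XJ E(1) by (intro submodule_restrict) (auto simp: submodule_iff[OF rJ])
    ultimately have "U \<inter> (X \<inter> E) \<noteq> {0}" using E(2) by (auto simp: essential_def)
    then show "U \<inter> X \<noteq> {0}" using UE sub_zero[OF U] sub_zero[OF XJ] by blast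
  qed
  \<comment> \<open>By maximality of \<open>E\<close> as an essential extension the image of
    \<open>k\<close> is exactly \<open>E\<close>, and \<open>k\<close> is a retraction onto
    it.\<close>
  then have "F = E" using E(3)[OF F _ EF] by blast
  then have "module_hom J (J\<lparr>carrier := E\<rparr>) k" by (intro hom_into[OF k(1)]) (simp add: F_def)
  then have "retract (J\<lparr>carrier := E\<rparr>) J"
    unfolding retract_def using hom_incl[OF E_sub] kE
    by (intro exI[of _ "\<lambda>x. x"] exI[of _ k]) auto
  then have "injective (J\<lparr>carrier := E\<rparr>)" by (rule injective_retract[OF J(1) fd_submodule[OF fdJ E(1)]])
  moreover have "module_hom M (J\<lparr>carrier := E\<rparr>) j" using UE by (intro hom_into[OF J(2)]) (simp add: U_def)
  ultimately show ?thesis using that J(3) E(2) by (simp add: U_def)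
qed

end

section \<open>Projective dimension and extensions\<close>

abbreviation syz :: "('a::ring_1, 'm::ab_group_add) rmodule \<Rightarrow> ('m \<Rightarrow> 'n::ab_group_add) \<Rightarrow> ('a, 'm) rmodule" where
  "syz R p \<equiv> R\<lparr>carrier := module_ker R p\<rparr>"

context fd_algebra
begin

section \<open>Covers and syzygies\<close>

text \<open>Any surjection from a projective module. Minimality is expressed separately, by
  smallness of the kernel.\<close>

definition covers :: "('a, 'k) kmodule \<Rightarrow> ((nat \<Rightarrow> 'k) \<Rightarrow> nat \<Rightarrow> 'k) \<Rightarrow> ('a, 'k) kmodule \<Rightarrow> bool" where
  "covers R p M \<longleftrightarrow> projective R \<and> module_hom R M p \<and> p ` carrier R = carrier M"

lemma
  assumes "covers R p M"
  shows covers_projective: "projective R"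
    and covers_hom: "module_hom R M p"
    and covers_surj: "p ` carrier R = carrier M"
  using assms by (auto simp: covers_def)

lemma covers_cat: "covers R p M \<Longrightarrow> R \<in> mod_cat"
  using projective_fd[OF covers_projective] by (simp add: mod_cat_iff)

lemma covers_module: "covers R p M \<Longrightarrow> right_module R"
  by (rule mod_cat_module[OF covers_cat])

lemma covers_exists:
  assumes "M \<in> mod_cat"
  obtains R p where "covers R p M"
proof -
  obtain R :: "('a, 'k) kmodule" and p
    where "projective R" "module_hom R M p" "p ` carrier R = carrier M"
    by (rule enough_projectives[OF assms])
  then show ?thesis using that by (simp add: covers_def)
qed

lemma covers_lift:
  assumes "covers R p M" "M \<in> mod_cat" "projective P" "module_hom P M g"
  obtains h where "module_hom P R h" "\<forall>x\<in>carrier P. p (h x) = g x"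
  by (rule projective_lift[OF assms(3) covers_cat[OF assms(1)] assms(2) covers_hom[OF assms(1)]
        covers_surj[OF assms(1)] assms(4)])

lemma syz_submodule: "covers R p M \<Longrightarrow> M \<in> mod_cat \<Longrightarrow> submodule (module_ker R p) R"
  by (rule submodule_ker[OF covers_module mod_cat_module covers_hom])

lemma syz_cat: "covers R p M \<Longrightarrow> M \<in> mod_cat \<Longrightarrow> syz R p \<in> mod_cat"
  by (rule mod_cat_submodule[OF covers_cat syz_submodule])

lemma hom_syz:
  "module_hom M R f \<Longrightarrow> (\<And>x. x \<in> carrier M \<Longrightarrow> p (f x) = 0) \<Longrightarrow> module_hom M (syz R p) f"
  by (rule hom_into) (auto simp: ker_iff hom_in)

lemma zero_module_projective:
  assumes "M \<in> mod_cat" "carrier M = {0}"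
  shows "projective M"
  unfolding projective_def
proof (intro conjI ballI allI impI; (elim conjE)?)
  show "fd_module M" using assms by (simp add: mod_cat_iff)
  fix A B p g assume *: "A \<in> mod_cat" "module_hom A B p" "module_hom M B g"
  have "p 0 = g 0"
    using hom_zero[OF mod_cat_module[OF *(1)] *(2)] hom_zero[OF mod_cat_module[OF assms(1)] *(3)] by simp
  then show "\<exists>h. module_hom M A h \<and> (\<forall>x\<in>carrier M. p (h x) = g x)"
    using hom_const_zero[OF mod_cat_module[OF *(1)], of M] assms(2) by auto
qed

lemma zero_module_injective:
  assumes "M \<in> mod_cat" "carrier M = {0}"
  shows "injective M"
  unfolding injective_def
proof (intro conjI ballI allI impI; (elim conjE)?)
  show "fd_module M" using assms by (simp add: mod_cat_iff)
  fix A B j g assume "module_hom A M g"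
  then have "g x = 0" if "x \<in> carrier A" for x using hom_in that assms(2) by blast
  then show "\<exists>h. module_hom B M h \<and> (\<forall>x\<in>carrier A. h (j x) = g x)"
    using hom_const_zero[OF mod_cat_module[OF assms(1)], of B] by auto
qed

section \<open>Projective dimension by syzygies\<close>

text \<open>Projective dimension at most \<open>n\<close>, for some choice of covers; independence
  of the choice is \<open>pdle_syz\<close>.\<close>

primrec pdle :: "nat \<Rightarrow> ('a, 'k) kmodule \<Rightarrow> bool" where
  "pdle 0 M \<longleftrightarrow> projective M"
| "pdle (Suc n) M \<longleftrightarrow> M \<in> mod_cat \<and> (\<exists>R p. covers R p M \<and> pdle n (syz R p))"

lemma pdle_cat: "pdle n M \<Longrightarrow> M \<in> mod_cat"
  by (cases n) (auto simp: mod_cat_iff projective_fd)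

text \<open>A form of Schanuel's lemma for retracts. Lift \<open>i\<close> and \<open>r\<close> to
  maps \<open>a\<close> and \<open>b\<close> between the covers. Then
  \<open>x \<mapsto> (a x, x)\<close> is split by
  \<open>(y, z) \<mapsto> b y + (z - b (a z))\<close>.\<close>

lemma syz_retract:
  assumes R: "covers R p X" "X \<in> mod_cat" and R': "covers R' q M" "M \<in> mod_cat" and "retract M X"
  shows "retract (syz R' q) (biprod (syz R p) R')"
proof -
  note rm = covers_module[OF R(1)] covers_module[OF R'(1)]
  obtain i r where ir: "module_hom M X i" "module_hom X M r" "\<forall>x\<in>carrier M. r (i x) = x"
    using \<open>retract M X\<close> by (auto simp: retract_def)
  note i0 = hom_zero[OF mod_cat_module[OF R'(2)] ir(1)] and r0 = hom_zero[OF mod_cat_module[OF R(2)] ir(2)]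
  obtain a where a: "module_hom R' R a" "\<forall>x\<in>carrier R'. p (a x) = i (q x)"
    by (rule covers_lift[OF R covers_projective[OF R'(1)] hom_compose[OF covers_hom[OF R'(1)] ir(1)]])
  obtain b where b: "module_hom R R' b" "\<forall>x\<in>carrier R. q (b x) = r (p x)"
    by (rule covers_lift[OF R' covers_projective[OF R(1)] hom_compose[OF covers_hom[OF R(1)] ir(2)]])
  have a': "module_hom (syz R' q) (syz R p) a"
    by (rule hom_syz[OF hom_restrict[OF a(1) ker_subset]]) (use a(2) i0 in \<open>auto simp: ker_iff\<close>)
  have b': "module_hom (syz R p) (syz R' q) b"
    by (rule hom_syz[OF hom_restrict[OF b(1) ker_subset]]) (use b(2) r0 in \<open>auto simp: ker_iff\<close>)
  have ba: "module_hom R' R' (\<lambda>x. b (a x))" by (rule hom_compose[OF a(1) b(1)])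
  \<comment> \<open>\<open>b \<circ> a\<close> lies over the identity of \<open>M\<close>, because
    \<open>r \<circ> i\<close> is the identity, so the difference lands in the syzygy.\<close>
  have c: "module_hom R' (syz R' q) (\<lambda>x. x - b (a x))"
  proof (rule hom_syz[OF hom_minus[OF rm(2) hom_id ba]])
    fix x assume x: "x \<in> carrier R'"
    have "q (b (a x)) = q x"
      using a(2) b(2) ir(3) x hom_in[OF a(1) x] hom_in[OF covers_hom[OF R'(1)] x] by simp
    then show "q (x - b (a x)) = 0"
      using hom_diff[OF rm(2) covers_hom[OF R'(1)] x hom_in[OF ba x]] by simp
  qed
  show ?thesis
    unfolding retract_def
    using hom_pair[OF a' hom_incl[OF ker_subset]]
      hom_copair[OF mod_cat_module[OF syz_cat[OF R']] b' c]
    by (intro exI[of _ "\<lambda>x. interleave (a x) x"] exI[of _ "\<lambda>z. b (evens z) + (odds z - b (a (odds z)))"]) simp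
qed

text \<open>Adding a projective and passing to a retract are treated in one induction, since each
  claim at \<open>Suc n\<close> uses claims at \<open>n\<close> for syzygies: a syzygy of a retract
  is a retract of a syzygy only after adding a projective.\<close>

lemma pdle_biprod_retract:
  shows "pdle n K \<Longrightarrow> projective Q \<Longrightarrow> pdle n (biprod K Q)"
    and "pdle n K \<Longrightarrow> Q \<in> mod_cat \<Longrightarrow> retract Q K \<Longrightarrow> pdle n Q"
proof (induction n arbitrary: K Q)
  case 0
  {
    case 1
    then show ?case by (simp add: projective_biprod)
  next
    case 2
    then show ?case by (simp add: projective_retract mod_cat_iff)
  }
next
  case (Suc n)
  {
    case 1
    have K: "K \<in> mod_cat" and Q: "Q \<in> mod_cat"
      using 1 by (auto simp: mod_cat_iff projective_fd)
    obtain S p where S: "covers S p K" "pdle n (syz S p)" using 1 by auto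
    \<comment> \<open>The sum of \<open>p\<close> with the identity of \<open>Q\<close>; its kernel
      is a copy of the kernel of \<open>p\<close>.\<close>
    define s where "s z = interleave (p (evens z)) (odds z)" for z
    have "s ` carrier (biprod S Q) = carrier (biprod K Q)"
    proof
      show "s ` carrier (biprod S Q) \<subseteq> carrier (biprod K Q)"
        using hom_in[OF covers_hom[OF S(1)]] by (auto simp: s_def biprod_def)
      show "carrier (biprod K Q) \<subseteq> s ` carrier (biprod S Q)"
      proof
        fix z assume z: "z \<in> carrier (biprod K Q)"
        then have "evens z \<in> p ` carrier S" "odds z \<in> carrier Q"
          using covers_surj[OF S(1)] by (auto simp: biprod_def)
        then obtain x where x: "x \<in> carrier S" "evens z = p x" by blast
        have "s (interleave x (odds z)) = z" using x by (simp add: s_def flip: x(2))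
        moreover have "interleave x (odds z) \<in> carrier (biprod S Q)" using x z by (simp add: biprod_def)
        ultimately show "z \<in> s ` carrier (biprod S Q)" by (metis imageI)
      qed
    qed
    moreover have "module_hom (biprod S Q) (biprod K Q) s"
      unfolding s_def by (rule hom_pair[OF hom_compose[OF hom_evens covers_hom[OF S(1)]] hom_odds])
    ultimately have cov: "covers (biprod S Q) s (biprod K Q)"
      using projective_biprod[OF covers_projective[OF S(1)] 1(2)] by (simp add: covers_def)
    have ker: "z \<in> module_ker (biprod S Q) s \<longleftrightarrow> evens z \<in> module_ker S p \<and> odds z = 0" for z
    proof -
      have "s z = 0 \<longleftrightarrow> p (evens z) = 0 \<and> odds z = 0"
        by (metis evens_odds_linear(5,6) interleave_simps s_def)
      then show ?thesis using rm_zero[OF mod_cat_module[OF Q]] by (auto simp: ker_iff biprod_def)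
    qed
    have "module_hom (syz (biprod S Q) s) (syz S p) evens"
      by (rule hom_into[OF hom_restrict[OF hom_evens ker_subset]]) (auto simp: ker)
    moreover have "module_hom (syz S p) (syz (biprod S Q) s) (\<lambda>x. interleave x 0)"
      by (rule hom_into[OF hom_restrict[OF hom_left[OF mod_cat_module[OF Q]] ker_subset]]) (auto simp: ker)
    moreover have "interleave (evens z) 0 = z" if "odds z = 0" for z :: "nat \<Rightarrow> 'k"
      using interleave_simps(3)[of z] that by simp
    ultimately have "retract (syz (biprod S Q) s) (syz S p)"
      unfolding retract_def
      by (intro exI[of _ evens] exI[of _ "\<lambda>x. interleave x 0"]) (simp add: ker)
    then have "pdle n (syz (biprod S Q) s)"
      by (rule Suc.IH(2)[OF S(2) syz_cat[OF cov mod_cat_biprod[OF K Q]]])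
    then show ?case using cov mod_cat_biprod[OF K Q] by auto
  next
    case 2
    have K: "K \<in> mod_cat" using 2 by simp
    obtain R p where R: "covers R p K" "pdle n (syz R p)" using 2 by auto
    obtain R' q where R': "covers R' q Q" using covers_exists[OF 2(2)] .
    have "pdle n (syz R' q)"
      using Suc.IH(2)[OF Suc.IH(1)[OF R(2) covers_projective[OF R']] syz_cat[OF R' 2(2)]
          syz_retract[OF R(1) K R' 2(2,3)]] .
    then show ?case using R' 2(2) by auto
  }
qed

lemma retract_refl: "retract M M"
  unfolding retract_def using hom_id by blast

text \<open>Independence of the cover: each syzygy of \<open>M\<close> is a retract of any other one
  with a projective added.\<close>

lemma pdle_syz:
  assumes "pdle (Suc n) M" "covers R p M"
  shows "pdle n (syz R p)"
proof -
  have M: "M \<in> mod_cat" using assms(1) by simp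
  obtain R' q where R': "covers R' q M" "pdle n (syz R' q)" using assms(1) by auto
  show ?thesis
    by (rule pdle_biprod_retract(2)[OF pdle_biprod_retract(1)[OF R'(2) covers_projective[OF assms(2)]]
          syz_cat[OF assms(2) M] syz_retract[OF R'(1) M assms(2) M retract_refl]])
qed

lemma pdle_Suc: "pdle n M \<Longrightarrow> pdle (Suc n) M"
proof (induction n arbitrary: M)
  case 0
  then have M: "M \<in> mod_cat" by (rule pdle_cat)
  \<comment> \<open>A projective module covers itself with zero kernel.\<close>
  have cov: "covers M (\<lambda>x. x) M" using 0 hom_id by (auto simp: covers_def)
  have "module_ker M (\<lambda>x. x) = {0}" using rm_zero[OF mod_cat_module[OF M]] by (auto simp: ker_iff)
  then have "projective (syz M (\<lambda>x. x))" using syz_cat[OF cov M] by (intro zero_module_projective) auto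
  then show ?case using cov M by auto
next
  case (Suc n)
  then show ?case by (metis pdle.simps(2))
qed

lemma pdle_mono: "m \<le> n \<Longrightarrow> pdle m M \<Longrightarrow> pdle n M"
  by (induction n rule: dec_induct) (auto simp del: pdle.simps intro: pdle_Suc)

lemma injective_kernel_projective:
  assumes M: "right_module M" and f: "module_hom R M f" "f ` carrier R = carrier M"
    and R: "projective R" "M \<in> mod_cat" and ker: "module_ker R f = {0}"
  shows "projective M"
proof -
  note rR = fd_right_module[OF projective_fd[OF R(1)]]
  have "inj_on f (carrier R)" using hom_inj_iff[OF rR f(1)] ker by (auto simp: module_ker_def)
  then have "isomorphic R M" using f by (auto simp: isomorphic_def module_iso_def bij_betw_def)
  then have "retract M R" by (rule isomorphic_retract[OF M iso_sym[OF rR]])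
  then show ?thesis using projective_retract[OF R(1)] R(2) by (simp add: mod_cat_iff)
qed

text \<open>A cover of \<open>M\<close> is spliced onto a resolution of its syzygy,
  \<open>case_nat\<close> shifting the indices; a projective module is followed by zero
  modules.\<close>

lemma pdle_resolution:
  "pdle n M \<Longrightarrow> \<exists>P \<epsilon> d. projective_resolution M P \<epsilon> d \<and> (\<forall>i>n. carrier (P i) = {0})"
proof (induction n arbitrary: M)
  case 0
  then have M: "M \<in> mod_cat" by (rule pdle_cat)
  note rM = mod_cat_module[OF M]
  let ?Z = "M\<lparr>carrier := {0}\<rparr>"
  have Z: "?Z \<in> mod_cat" by (rule mod_cat_submodule[OF M submodule_zero[OF rM]])
  have "projective_resolution M (case_nat M (\<lambda>_. ?Z)) (\<lambda>x. x) (\<lambda>_ _. 0)"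
    unfolding projective_resolution_def
    using 0 zero_module_projective[OF Z] hom_id hom_const_zero[OF rM] hom_const_zero[OF mod_cat_module[OF Z]]
      rm_zero[OF rM]
    by (auto simp: module_ker_def split: nat.splits)
  then show ?case by (intro exI[of _ "case_nat M (\<lambda>_. ?Z)"] exI conjI) (auto split: nat.splits)
next
  case (Suc n)
  then have M: "M \<in> mod_cat" by simp
  obtain R p where R: "covers R p M" "pdle n (syz R p)" using Suc by auto
  obtain P \<epsilon> d where P: "projective_resolution (syz R p) P \<epsilon> d" "\<forall>i>n. carrier (P i) = {0}"
    using Suc.IH[OF R(2)] by blast
  have "projective_resolution M (case_nat R P) p (case_nat \<epsilon> d)"
    using P(1) R(1) hom_from_into[OF _ ker_subset, of "P 0" R p \<epsilon>]
    unfolding projective_resolution_def covers_def by (auto split: nat.splits)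
  then show ?case using P(2)
    by (intro exI[of _ "case_nat R P"] exI conjI) (auto split: nat.splits)
qed

text \<open>Dropping the first term of a resolution leaves a resolution of the first syzygy. For
  \<open>n = 0\<close> the term \<open>P 1\<close> vanishes, so \<open>\<epsilon>\<close> is
  injective.\<close>

lemma resolution_pdle:
  "M \<in> mod_cat \<Longrightarrow> projective_resolution M P \<epsilon> d \<Longrightarrow> \<forall>i>n. carrier (P i) = {0} \<Longrightarrow> pdle n M"
proof (induction n arbitrary: M P \<epsilon> d)
  case 0
  note P = 0(2)[unfolded projective_resolution_def]
  have "projective (P 1)" using P by simp
  then have P1: "right_module (P 1)" by (rule fd_right_module[OF projective_fd])
  have "module_hom (P 1) (P 0) (d 0)" using P by simp
  then have "d 0 0 = 0" by (rule hom_zero[OF P1])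
  then have "module_ker (P 0) \<epsilon> = {0}" using P 0(3) by (metis image_insert image_empty less_one)
  then show ?case
    using injective_kernel_projective[OF mod_cat_module[OF 0(1)], of "P 0" \<epsilon>] P 0(1) by simp
next
  case (Suc n)
  note P = Suc(3)[unfolded projective_resolution_def]
  have cov: "covers (P 0) \<epsilon> M" using P by (simp add: covers_def)
  have "module_hom (P 1) (syz (P 0) \<epsilon>) (d 0)"
    by (rule hom_into) (use P in auto)
  then have "projective_resolution (syz (P 0) \<epsilon>) (\<lambda>i. P (Suc i)) (d 0) (\<lambda>i. d (Suc i))"
    using P unfolding projective_resolution_def by simp
  then have "pdle n (syz (P 0) \<epsilon>)"
    by (rule Suc.IH[OF syz_cat[OF cov Suc(2)]]) (use Suc(4) in simp)
  then show ?case using cov Suc(2) by auto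
qed

lemma projdim_pdle:
  assumes "M \<in> mod_cat"
  shows "projdim M = Inf {enat n |n. pdle n M}"
proof -
  have "(\<exists>P \<epsilon> d. projective_resolution M P \<epsilon> d \<and> (\<forall>i>n. carrier (P i) = {0})) \<longleftrightarrow> pdle n M" for n
  proof
    assume "\<exists>P \<epsilon> d. projective_resolution M P \<epsilon> d \<and> (\<forall>i>n. carrier (P i) = {0})"
    then show "pdle n M" by (elim exE conjE) (rule resolution_pdle[OF assms])
  qed (rule pdle_resolution)
  then show ?thesis by (simp add: projdim_def)
qed

text \<open>Vanishing of \<open>Ext\<^sup>1 (X, Y)\<close>.\<close>

definition orth :: "('a, 'k) kmodule \<Rightarrow> ('a, 'k) kmodule \<Rightarrow> bool" where
  "orth X Y \<longleftrightarrow> (\<forall>R p \<phi>. covers R p X \<and> module_hom (syz R p) Y \<phi> \<longrightarrow>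
     (\<exists>\<psi>. module_hom R Y \<psi> \<and> (\<forall>x\<in>module_ker R p. \<psi> x = \<phi> x)))"

lemma orth_injective:
  assumes "X \<in> mod_cat" "injective Y"
  shows "orth X Y"
  unfolding orth_def
proof (intro allI impI; elim conjE)
  fix R p \<phi> assume *: "covers R p X" "module_hom (syz R p) Y \<phi>"
  obtain \<psi> where "module_hom R Y \<psi>" "\<forall>x\<in>module_ker R p. \<psi> x = \<phi> x"
    by (rule injective_extend[OF assms(2) covers_cat[OF *(1)] syz_submodule[OF *(1) assms(1)] *(2)])
  then show "\<exists>\<psi>. module_hom R Y \<psi> \<and> (\<forall>x\<in>module_ker R p. \<psi> x = \<phi> x)" by blast
qed

text \<open>Dimension shifting. In \<open>0 \<rightarrow> \<Omega>Y \<rightarrow> Q \<rightarrow> Y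
  \<rightarrow> 0\<close> the module \<open>Q\<close> is injective, so it is enough that every map
  \<open>\<Omega>X \<rightarrow> Y\<close> lifts to \<open>Q\<close>: it extends to \<open>R\<close>
  by assumption, and \<open>R\<close> is projective.\<close>

lemma orth_syz:
  assumes XY: "orth X Y" and X: "X \<in> mod_cat" and Y: "Y \<in> mod_cat"
    and R: "covers R p X" and Q: "covers Q q Y" and inj: "injective Q"
  shows "orth (syz R p) (syz Q q)"
  unfolding orth_def
proof (intro allI impI; elim conjE)
  fix R1 p1 \<phi> assume R1: "covers R1 p1 (syz R p)" and \<phi>: "module_hom (syz R1 p1) (syz Q q) \<phi>"
  note K = syz_cat[OF R X]
  note sub1 = syz_submodule[OF R1 K]
  note rR1 = covers_module[OF R1] and rQ = covers_module[OF Q]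
  have p1: "module_hom R1 R p1" by (rule hom_from_into[OF covers_hom[OF R1] ker_subset])
  have p1_ker: "p1 x \<in> module_ker R p" if "x \<in> carrier R1" for x
    using hom_in[OF covers_hom[OF R1] that] by simp
  obtain f where f: "module_hom R1 Q f" "\<forall>x\<in>module_ker R1 p1. f x = \<phi> x"
    by (rule injective_extend[OF inj covers_cat[OF R1] sub1 hom_from_into[OF \<phi> ker_subset]])
  have qf: "module_hom R1 Y (\<lambda>x. q (f x))" by (rule hom_compose[OF f(1) covers_hom[OF Q]])
  \<comment> \<open>\<open>f\<close> maps the kernel of \<open>p1\<close> into the syzygy of
    \<open>Y\<close>, so \<open>q \<circ> f\<close> induces a map on the syzygy of
    \<open>X\<close>.\<close>
  have "q (f x) = 0" if "x \<in> carrier R1" "p1 x = 0" for x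
    using f(2) hom_in[OF \<phi>, of x] that by (auto simp: ker_iff)
  from hom_factor[OF rR1 covers_hom[OF R1] covers_surj[OF R1] qf this]
  obtain \<phi>' where \<phi>': "module_hom (syz R p) Y \<phi>'" "\<forall>x\<in>carrier R1. \<phi>' (p1 x) = q (f x)" by blast
  obtain \<psi> where \<psi>: "module_hom R Y \<psi>" "\<forall>x\<in>module_ker R p. \<psi> x = \<phi>' x"
    using XY R \<phi>'(1) unfolding orth_def by blast
  obtain h where h: "module_hom R Q h" "\<forall>x\<in>carrier R. q (h x) = \<psi> x"
    by (rule covers_lift[OF Q Y covers_projective[OF R] \<psi>(1)])
  have hp: "module_hom R1 Q (\<lambda>x. h (p1 x))" by (rule hom_compose[OF p1 h(1)])
  \<comment> \<open>Subtracting the lift moves the values of \<open>f\<close> into the syzygy of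
    \<open>Y\<close> and changes nothing on the kernel of \<open>p1\<close>, where the subtracted
    map vanishes.\<close>
  have "module_hom R1 (syz Q q) (\<lambda>x. f x - h (p1 x))"
  proof (rule hom_syz[OF hom_minus[OF rQ f(1) hp]])
    fix x assume x: "x \<in> carrier R1"
    have "q (h (p1 x)) = q (f x)"
      using h(2) \<psi>(2) \<phi>'(2) x p1_ker[OF x] hom_in[OF p1 x] by simp
    then show "q (f x - h (p1 x)) = 0"
      using hom_diff[OF rQ covers_hom[OF Q] hom_in[OF f(1) x] hom_in[OF hp x]] by simp
  qed
  moreover have "f x - h (p1 x) = \<phi> x" if "x \<in> module_ker R1 p1" for x
    using that f(2) hom_zero[OF covers_module[OF R] h(1)] by (simp add: ker_iff)
  ultimately show "\<exists>\<psi>. module_hom R1 (syz Q q) \<psi> \<and> (\<forall>x\<in>module_ker R1 p1. \<psi> x = \<phi> x)" by blast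
qed

section \<open>Lifting along injective covers\<close>

text \<open>The first \<open>j\<close> terms of some projective resolution of \<open>Y\<close> are
  injective.\<close>

primrec injchain :: "nat \<Rightarrow> ('a, 'k) kmodule \<Rightarrow> bool" where
  "injchain 0 Y \<longleftrightarrow> True"
| "injchain (Suc j) Y \<longleftrightarrow> (\<exists>Q q. covers Q q Y \<and> injective Q \<and> injchain j (syz Q q))"

text \<open>The obstruction to lifting lies in Ext^1(X, \<Omega>Y), which the injective terms shift
  to Ext^(j+1) of \<open>X\<close> with values in the \<open>(j + 1)\<close>-st syzygy of
  \<open>Y\<close>, and this is zero. In the induction a lift on a cover of \<open>X\<close> is
  corrected by a lift obtained for the syzygies.\<close>

lemma injchain_lift:
  "pdle j X \<Longrightarrow> Y \<in> mod_cat \<Longrightarrow> injchain (Suc j) Y \<Longrightarrow> module_hom X Y g \<Longrightarrow>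
    \<exists>Q q h. covers Q q Y \<and> injective Q \<and> module_hom X Q h \<and> (\<forall>x\<in>carrier X. q (h x) = g x)"
proof (induction j arbitrary: X Y g)
  case 0
  obtain Q q where Q: "covers Q q Y" "injective Q" using 0(3) by auto
  obtain h where "module_hom X Q h" "\<forall>x\<in>carrier X. q (h x) = g x"
    using covers_lift[OF Q(1) 0(2) _ 0(4)] 0(1) by auto
  then show ?case using Q by blast
next
  case (Suc j)
  have X: "X \<in> mod_cat" using Suc(2) by simp
  obtain R p where R: "covers R p X" "pdle j (syz R p)" using Suc(2) by auto
  obtain Q q where Q: "covers Q q Y" "injective Q" "injchain (Suc j) (syz Q q)"
    using Suc(4) by (metis injchain.simps(2))
  note rR = covers_module[OF R(1)] and rQ = covers_module[OF Q(1)]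
  obtain h where h: "module_hom R Q h" "\<forall>x\<in>carrier R. q (h x) = g (p x)"
    by (rule covers_lift[OF Q(1) Suc(3) covers_projective[OF R(1)] hom_compose[OF covers_hom[OF R(1)] Suc(5)]])
  have "module_hom (syz R p) (syz Q q) h"
    by (rule hom_syz[OF hom_restrict[OF h(1) ker_subset]])
       (use h(2) in \<open>simp add: ker_iff hom_zero[OF mod_cat_module[OF X] Suc(5)]\<close>)
  \<comment> \<open>The map induced between the syzygies lifts by the induction hypothesis, which
    spends one term of the chain and one unit of projective dimension.\<close>
  from Suc.IH[OF R(2) syz_cat[OF Q(1) Suc(3)] Q(3) this]
  obtain Q1 q1 k where Q1: "covers Q1 q1 (syz Q q)" "injective Q1"
    and k: "module_hom (syz R p) Q1 k" "\<forall>x\<in>module_ker R p. q1 (k x) = h x" by auto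
  \<comment> \<open>Injectivity of \<open>Q1\<close> extends the lift \<open>k\<close> from the
    syzygy to \<open>R\<close>.\<close>
  obtain k' where k': "module_hom R Q1 k'" "\<forall>x\<in>module_ker R p. k' x = k x"
    by (rule injective_extend[OF Q1(2) covers_cat[OF R(1)] syz_submodule[OF R(1) X] k(1)])
  have q1: "module_hom Q1 Q q1" by (rule hom_from_into[OF covers_hom[OF Q1(1)] ker_subset])
  have qq1: "q (q1 y) = 0" if "y \<in> carrier Q1" for y
    using hom_in[OF covers_hom[OF Q1(1)] that] by (simp add: ker_iff)
  have q1k': "module_hom R Q (\<lambda>x. q1 (k' x))" by (rule hom_compose[OF k'(1) q1])
  have diff: "module_hom R Q (\<lambda>x. h x - q1 (k' x))" by (rule hom_minus[OF rQ h(1) q1k'])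
  \<comment> \<open>The corrected map vanishes on the syzygy and so descends to \<open>X\<close>.
    The correction does not disturb the values in \<open>Y\<close>, because
    \<open>q \<circ> q1\<close> is zero.\<close>
  have "h x - q1 (k' x) = 0" if "x \<in> carrier R" "p x = 0" for x
    using that k(2) k'(2) by (simp add: ker_iff)
  from hom_factor[OF rR covers_hom[OF R(1)] covers_surj[OF R(1)] diff this]
  obtain h' where h': "module_hom X Q h'" "\<forall>x\<in>carrier R. h' (p x) = h x - q1 (k' x)" by blast
  have "q (h' y) = g y" if "y \<in> carrier X" for y
  proof -
    have "y \<in> p ` carrier R" using that covers_surj[OF R(1)] by simp
    then obtain x where x: "x \<in> carrier R" "y = p x" by blast
    have "q (h' y) = q (h x) - q (q1 (k' x))"
      using h'(2) x hom_diff[OF rQ covers_hom[OF Q(1)] hom_in[OF h(1) x(1)] hom_in[OF q1k' x(1)]] by simp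
    then show ?thesis using h(2) x qq1[OF hom_in[OF k'(1) x(1)]] by simp
  qed
  then show ?case using Q h' by blast
qed

section \<open>Iterated syzygies\<close>

primrec syzygy :: "nat \<Rightarrow> ('a, 'k) kmodule \<Rightarrow> bool" where
  "syzygy 0 X \<longleftrightarrow> X \<in> mod_cat"
| "syzygy (Suc i) X \<longleftrightarrow> (\<exists>M R p. syzygy i M \<and> covers R p M \<and> X = syz R p)"

lemma syzygy_cat: "syzygy i X \<Longrightarrow> X \<in> mod_cat"
  by (induction i arbitrary: X) (auto intro: syz_cat)

text \<open>An \<open>(i + 1)\<close>-st syzygy of a module is an \<open>i\<close>-th syzygy of its
  first syzygy.\<close>

lemma syzygy_Suc: "syzygy (Suc i) X \<Longrightarrow> syzygy i X"
proof (induction i arbitrary: X)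
  case 0
  then show ?case using syzygy_cat by (metis syzygy.simps(1))
next
  case (Suc i)
  then show ?case by (metis syzygy.simps(2))
qed

lemma syzygy_antimono: "i \<le> j \<Longrightarrow> syzygy j X \<Longrightarrow> syzygy i X"
  by (induction i rule: inc_induct) (auto intro: syzygy_Suc simp del: syzygy.simps)

text \<open>Taking a syzygy lowers a positive finite projective dimension by exactly one, so
  \<open>t\<close> syzygies lead from \<open>Suc t\<close> to one.\<close>

lemma syzygy_of_projdim_one:
  assumes "pdle (Suc t) Z" "\<not> pdle t Z"
  obtains W where "syzygy t W" "pdle 1 W" "\<not> projective W"
proof -
  \<comment> \<open>Invariant: some \<open>i\<close>-th syzygy has projective dimension exactly
    \<open>Suc (t - i)\<close>.\<close>
  have "\<exists>X. syzygy i X \<and> pdle (Suc (t - i)) X \<and> \<not> pdle (t - i) X" if "i \<le> t" for i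
    using that
  proof (induction i)
    case 0
    show ?case using assms pdle_cat[OF assms(1)] by (intro exI[of _ Z]) (simp del: pdle.simps)
  next
    case (Suc i)
    then obtain X where X: "syzygy i X" "pdle (Suc (t - i)) X" "\<not> pdle (t - i) X" by auto
    have t: "t - i = Suc (t - Suc i)" using Suc by simp
    obtain R p where R: "covers R p X" "pdle (t - i) (syz R p)" using X(2) by auto
    have "\<not> pdle (t - Suc i) (syz R p)"
      using X(3) R(1) pdle_cat[OF X(2)] by (auto simp: t)
    then show ?case using X R t by (metis syzygy.simps(2))
  qed
  from this[of t] show ?thesis using that by auto
qed

end

section \<open>Algebras with one projective non-injective indecomposable\<close>

lemma internal_projections:
  assumes M: "right_module M" and UV: "internal_direct_sum M U V"
  obtains r s where "module_hom M (M\<lparr>carrier := U\<rparr>) r" "\<forall>x\<in>U. r x = x"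
    "module_hom M (M\<lparr>carrier := V\<rparr>) s" "\<forall>x\<in>V. s x = x" "\<forall>x\<in>carrier M. r x + s x = x"
proof -
  have U: "submodule U M" and V: "submodule V M" and int: "U \<inter> V = {0}" and M_eq: "carrier M = sum_of U V"
    using UV by (auto simp: internal_direct_sum_def sum_of_def)
  have M_eq': "carrier M = sum_of V U"
    unfolding M_eq sum_of_def by (metis add.commute)
  obtain r where r: "module_hom (M\<lparr>carrier := sum_of U V\<rparr>) (M\<lparr>carrier := U\<rparr>) r"
    "\<forall>x\<in>U. r x = x" "\<forall>x\<in>V. r x = 0"
    using independent_projection[OF M U V] int by auto
  obtain s where s: "module_hom (M\<lparr>carrier := sum_of V U\<rparr>) (M\<lparr>carrier := V\<rparr>) s"
    "\<forall>x\<in>V. s x = x" "\<forall>x\<in>U. s x = 0"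
    using independent_projection[OF M V U] int by auto
  have rM: "module_hom M (M\<lparr>carrier := U\<rparr>) r" using r(1) by (simp add: M_eq[symmetric])
  have sM: "module_hom M (M\<lparr>carrier := V\<rparr>) s" using s(1) by (simp add: M_eq'[symmetric])
  have "r x + s x = x" if "x \<in> carrier M" for x
  proof -
    have "x \<in> sum_of U V" using that by (simp add: M_eq)
    then obtain u v where uv: "u \<in> U" "v \<in> V" "x = u + v" by (rule sum_ofE)
    have "u \<in> carrier M" "v \<in> carrier M" using uv submodule_subset[OF U] submodule_subset[OF V] by auto
    then show ?thesis
      using r(2,3) s(2,3) uv by (simp add: hom_add[OF rM] hom_add[OF sM])
  qed
  then show ?thesis using that rM sM r(2) s(2) by blast
qed

context fd_algebra
begin

section \<open>Non-injective summands\<close>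

text \<open>Take a minimal summand that is not injective. If it splits, one part is not injective,
  since a sum of injectives is injective; by minimality that part is everything and the other is
  zero.\<close>

lemma noninjective_summand:
  fixes K :: "('a, 'k) kmodule"
  assumes fd: "fd_module K" and ninj: "\<not> injective K"
  obtains V r where "submodule V K" "module_hom K (K\<lparr>carrier := V\<rparr>) r" "\<forall>x\<in>V. r x = x"
    "indecomposable (K\<lparr>carrier := V\<rparr>)" "\<not> injective (K\<lparr>carrier := V\<rparr>)"
proof -
  note K = fd_right_module[OF fd]
  let ?R = "\<lambda>V. K\<lparr>carrier := V\<rparr>"
  let ?P = "\<lambda>V. \<not> injective (?R V) \<and> (\<exists>r. module_hom K (?R V) r \<and> (\<forall>x\<in>V. r x = x))"
  have "?P (carrier K)" using ninj hom_id by auto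
  then obtain V where V: "submodule V K" "?P V"
    "\<And>W. submodule W K \<Longrightarrow> ?P W \<Longrightarrow> W \<subseteq> V \<Longrightarrow> W = V"
    using minimal_submodule[where P = ?P, OF fd submodule_carrier[OF K]] by blast
  obtain r where r: "module_hom K (?R V) r" "\<forall>x\<in>V. r x = x" using V(2) by blast
  have V_cat: "?R V \<in> mod_cat" using fd_submodule[OF fd V(1)] by (simp add: mod_cat_iff)
  note rV = mod_cat_module[OF V_cat]
  \<comment> \<open>Summands of \<open>V\<close> are summands of \<open>K\<close>, so minimality of
    \<open>V\<close> applies to them.\<close>
  have min: "A = V" if A: "submodule A (?R V)" and s: "module_hom (?R V) (?R A) s" "\<forall>x\<in>A. s x = x"
    and nA: "\<not> injective (?R A)" for A s
  proof (rule V(3))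
    show "submodule A K" by (rule submodule_trans[OF V(1) A])
    show AV: "A \<subseteq> V" using submodule_subset[OF A] by simp
    have "module_hom K (?R A) (\<lambda>x. s (r x))" using hom_compose[OF r(1) s(1)] .
    moreover have "\<forall>x\<in>A. s (r x) = x" using r(2) s(2) AV by auto
    ultimately show "?P A" using nA by blast
  qed
  have "indecomposable (?R V)"
    unfolding indecomposable_def
  proof (intro conjI allI impI)
    show "carrier (?R V) \<noteq> {0}" using zero_module_injective[OF V_cat] V(2) by blast
    fix A B assume AB: "internal_direct_sum (?R V) A B"
    have A: "submodule A (?R V)" and B: "submodule B (?R V)" and int: "A \<inter> B = {0}"
      using AB by (auto simp: internal_direct_sum_def)
    obtain s t where s: "module_hom (?R V) ((?R V)\<lparr>carrier := A\<rparr>) s" "\<forall>x\<in>A. s x = x"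
      and t: "module_hom (?R V) ((?R V)\<lparr>carrier := B\<rparr>) t" "\<forall>x\<in>B. t x = x"
      and st: "\<forall>x\<in>carrier (?R V). s x + t x = x"
      by (rule internal_projections[OF rV AB])
    have s': "module_hom (?R V) (?R A) s" and t': "module_hom (?R V) (?R B) t" using s(1) t(1) by simp_all
    show "A = {0} \<or> B = {0}"
    proof (cases "injective (?R A) \<and> injective (?R B)")
      case True
      have "module_hom (biprod (?R A) (?R B)) (?R V) (\<lambda>z. evens z + odds z)"
        using hom_copair[OF rV, of "?R A" "\<lambda>x. x" "?R B" "\<lambda>x. x"]
          hom_incl[OF submodule_subset[OF A]] hom_incl[OF submodule_subset[OF B]] by simp
      then have "retract (?R V) (biprod (?R A) (?R B))"
        unfolding retract_def using hom_pair[OF s' t'] st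
        by (intro exI[of _ "\<lambda>x. interleave (s x) (t x)"] exI[of _ "\<lambda>z. evens z + odds z"]) simp
      then have "injective (?R V)"
        using injective_retract[OF injective_biprod fd_submodule[OF fd V(1)], of "?R A" "?R B"] True by blast
      then show ?thesis using V(2) by blast
    next
      case False
      then have "A = V \<or> B = V" using min[OF A s' s(2)] min[OF B t' t(2)] by blast
      then show ?thesis using int submodule_subset[OF A] submodule_subset[OF B] by auto
    qed
  qed
  then show ?thesis using that V(1,2) r by blast
qed

definition unique_noninjective :: bool where
  "unique_noninjective \<longleftrightarrow> (\<forall>P\<in>mod_cat. \<forall>Q\<in>mod_cat.
     indecomposable P \<and> projective P \<and> \<not> injective P \<and>
     indecomposable Q \<and> projective Q \<and> \<not> injective Q \<longrightarrow> isomorphic P Q)"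

text \<open>The map projects \<open>K\<close> onto a non-injective indecomposable summand,
  identifies it by uniqueness with one of \<open>P\<close>, and includes it. The image is a nonzero
  summand of \<open>P\<close>, which cannot be small.\<close>

lemma nonsmall_hom:
  fixes K P :: "('a, 'k) kmodule"
  assumes uniq: unique_noninjective
    and K: "projective K" "\<not> injective K" and P: "projective P" "\<not> injective P"
  obtains f where "module_hom K P f" "\<not> small (f ` carrier K) P"
proof -
  note fdK = projective_fd[OF K(1)] and fdP = projective_fd[OF P(1)]
  note rP = fd_right_module[OF fdP]
  have summand: "projective (L\<lparr>carrier := V\<rparr>) \<and> L\<lparr>carrier := V\<rparr> \<in> mod_cat"
    if "projective L" "submodule V L" "module_hom L (L\<lparr>carrier := V\<rparr>) r" "\<forall>x\<in>V. r x = x"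
    for L :: "('a, 'k) kmodule" and V r
  proof -
    have fd: "fd_module (L\<lparr>carrier := V\<rparr>)" by (rule fd_submodule[OF projective_fd[OF that(1)] that(2)])
    have "retract (L\<lparr>carrier := V\<rparr>) L"
      unfolding retract_def using hom_incl[OF submodule_subset[OF that(2)]] that(3,4)
      by (intro exI[of _ "\<lambda>x. x"] exI[of _ r]) simp
    then show ?thesis using projective_retract[OF that(1) fd] fd by (simp add: mod_cat_iff)
  qed
  obtain V r where V: "submodule V K" "module_hom K (K\<lparr>carrier := V\<rparr>) r" "\<forall>x\<in>V. r x = x"
    "indecomposable (K\<lparr>carrier := V\<rparr>)" "\<not> injective (K\<lparr>carrier := V\<rparr>)"
    by (rule noninjective_summand[OF fdK K(2)])
  obtain V' r' where V': "submodule V' P" "module_hom P (P\<lparr>carrier := V'\<rparr>) r'" "\<forall>x\<in>V'. r' x = x"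
    "indecomposable (P\<lparr>carrier := V'\<rparr>)" "\<not> injective (P\<lparr>carrier := V'\<rparr>)"
    by (rule noninjective_summand[OF fdP P(2)])
  have "isomorphic (K\<lparr>carrier := V\<rparr>) (P\<lparr>carrier := V'\<rparr>)"
    using uniq[unfolded unique_noninjective_def] summand[OF K(1) V(1-3)] summand[OF P(1) V'(1-3)] V(4,5) V'(4,5) by blast
  then obtain \<theta> where \<theta>: "module_hom (K\<lparr>carrier := V\<rparr>) (P\<lparr>carrier := V'\<rparr>) \<theta>" "\<theta> ` V = V'"
    by (auto simp: isomorphic_def module_iso_def bij_betw_def)
  have f: "module_hom K P (\<lambda>x. \<theta> (r x))"
    by (rule hom_from_into[OF hom_compose[OF V(2) \<theta>(1)] submodule_subset[OF V'(1)]])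
  have "r ` carrier K = V"
    using hom_in[OF V(2)] V(3) submodule_subset[OF V(1)] by force
  then have image: "(\<lambda>x. \<theta> (r x)) ` carrier K = V'" using \<theta>(2) by (metis image_image)
  have "\<not> small V' P"
    using small_retract_zero[OF rP V'(1) _ V'(2)] V'(3,4) by (auto simp: indecomposable_def)
  then show ?thesis using that f image by metis
qed

section \<open>Injectivity of the terms of a minimal projective resolution\<close>

text \<open>If \<open>P\<close> were not injective, some map from the syzygy of \<open>W\<close> to
  \<open>P\<close> would have a non-small image. Vanishing of Ext^1(W, Y) makes it agree, up to the
  small kernel of \<open>\<pi>\<close>, with the restriction of a map from the projective cover of
  \<open>W\<close>, and images of small submodules are small.\<close>

lemma projective_cover_injective:
  fixes P :: "('a, 'k) kmodule"
  assumes uniq: unique_noninjective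
    and W: "pdle 1 W" "\<not> projective W" and Y: "Y \<in> mod_cat" and WY: "orth W Y"
    and P: "covers P \<pi> Y" "small (module_ker P \<pi>) P"
  shows "injective P"
proof (rule ccontr)
  assume nP: "\<not> injective P"
  have W_cat: "W \<in> mod_cat" by (rule pdle_cat[OF W(1)])
  note rP = covers_module[OF P(1)]
  obtain R :: "('a, 'k) kmodule" and p where "projective R" "module_hom R W p" "p ` carrier R = carrier W"
    and small: "small (module_ker R p) R"
    by (rule projective_cover[OF W_cat])
  then have R: "covers R p W" by (simp add: covers_def)
  note rR = covers_module[OF R]
  note sub = syz_submodule[OF R W_cat]
  have K: "projective (syz R p)" using pdle_syz[OF _ R, of 0] W(1) by simp
  \<comment> \<open>An injective syzygy would be a summand of the cover; being small, it would
    vanish, and \<open>W\<close> would be projective.\<close>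
  have nK: "\<not> injective (syz R p)"
  proof
    assume inj: "injective (syz R p)"
    obtain k where k: "module_hom R (syz R p) k" "\<forall>x\<in>module_ker R p. k x = x"
      by (rule injective_extend[OF inj covers_cat[OF R] sub hom_id])
    have "module_ker R p = {0}" using small_retract_zero[OF rR sub small k(1)] k(2) by blast
    then show False
      using injective_kernel_projective[OF mod_cat_module[OF W_cat] covers_hom[OF R] covers_surj[OF R]
          covers_projective[OF R] W_cat] W(2) by blast
  qed
  obtain f where f: "module_hom (syz R p) P f" "\<not> small (f ` module_ker R p) P"
    using nonsmall_hom[OF uniq K nK covers_projective[OF P(1)] nP] by auto
  \<comment> \<open>Vanishing of Ext^1 extends \<open>\<pi> \<circ> f\<close> from the syzygy to
    \<open>R\<close>; projectivity of \<open>R\<close> then lifts the extension to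
    \<open>P\<close>.\<close>
  obtain \<psi> where \<psi>: "module_hom R Y \<psi>" "\<forall>x\<in>module_ker R p. \<psi> x = \<pi> (f x)"
    using WY R hom_compose[OF f(1) covers_hom[OF P(1)]] unfolding orth_def by blast
  obtain h where h: "module_hom R P h" "\<forall>x\<in>carrier R. \<pi> (h x) = \<psi> x"
    by (rule covers_lift[OF P(1) Y covers_projective[OF R] \<psi>(1)])
  \<comment> \<open>On the syzygy \<open>f\<close> and \<open>h\<close> have the same composite with
    \<open>\<pi>\<close>, so their values differ by elements of its kernel.\<close>
  have "f ` module_ker R p \<subseteq> sum_of (module_ker P \<pi>) (h ` module_ker R p)"
  proof
    fix y assume "y \<in> f ` module_ker R p"
    then obtain x where x: "x \<in> module_ker R p" "y = f x" by blast
    then have "x \<in> carrier R" by (simp add: ker_iff)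
    have fx: "f x \<in> carrier P" using hom_in[OF f(1)] x(1) by simp
    have "\<pi> (f x - h x) = 0"
      using hom_diff[OF rP covers_hom[OF P(1)] fx hom_in[OF h(1) \<open>x \<in> carrier R\<close>]] \<psi>(2) h(2) x(1)
        \<open>x \<in> carrier R\<close> by simp
    then have "f x - h x \<in> module_ker P \<pi>"
      using rm_diff[OF rP fx hom_in[OF h(1) \<open>x \<in> carrier R\<close>]] by (simp add: ker_iff)
    from sum_ofI[OF this imageI[OF x(1), of h]]
    show "y \<in> sum_of (module_ker P \<pi>) (h ` module_ker R p)" using x(2) by simp
  qed
  then have "small (f ` module_ker R p) P"
    by (rule small_subset_sum[OF rP P(2) small_image[OF rR rP h(1) small ker_subset]
          submodule_image[OF rR rP h(1) sub]])
  then show False using f(2) by blast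
qed

text \<open>\<open>i\<close> counts the syzygies already taken and \<open>j\<close> the terms still
  to be shown injective. Once the projective cover of \<open>Y\<close> is known to be injective,
  dimension shifting carries the hypothesis from \<open>i\<close> and \<open>Y\<close> to
  \<open>Suc i\<close> and the syzygy of \<open>Y\<close>.\<close>

lemma orth_injchain:
  assumes uniq: unique_noninjective
    and W: "pdle 1 W" "\<not> projective W" "syzygy t W"
  shows "Y \<in> mod_cat \<Longrightarrow> i + j \<le> Suc t \<Longrightarrow> (\<And>X. syzygy i X \<Longrightarrow> orth X Y) \<Longrightarrow> injchain j Y"
proof (induction j arbitrary: i Y)
  case 0
  show ?case by simp
next
  case (Suc j)
  \<comment> \<open>As a term remains to be treated, \<open>i \<le> t\<close>, so \<open>W\<close>
    is also an \<open>i\<close>-th syzygy.\<close>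
  have "orth W Y" using Suc(4)[OF syzygy_antimono[OF _ W(3)]] Suc(3) by simp
  obtain P :: "('a, 'k) kmodule" and \<pi> where "projective P" "module_hom P Y \<pi>" "\<pi> ` carrier P = carrier Y"
    and small: "small (module_ker P \<pi>) P"
    by (rule projective_cover[OF Suc(2)])
  then have P: "covers P \<pi> Y" by (simp add: covers_def)
  have inj: "injective P"
    by (rule projective_cover_injective[OF uniq W(1,2) Suc(2) \<open>orth W Y\<close> P small])
  have "injchain j (syz P \<pi>)"
  proof (rule Suc.IH[OF syz_cat[OF P Suc(2)]])
    show "Suc i + j \<le> Suc t" using Suc(3) by simp
    fix X assume "syzygy (Suc i) X"
    then obtain M R p where "syzygy i M" "covers R p M" "X = syz R p" by auto
    then show "orth X (syz P \<pi>)"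
      using orth_syz[OF Suc(4) syzygy_cat Suc(2) _ P inj] by simp
  qed
  then show ?case using P inj by auto
qed

section \<open>Minimal injective coresolutions\<close>

text \<open>\<open>J\<close> is the injective hull of the quotient by \<open>U\<close>, and
  \<open>f\<close> the quotient map followed by the embedding into the hull.\<close>

lemma cosyzygy_step:
  fixes I :: "('a, 'k) kmodule"
  assumes "fd_module I" "submodule U I"
  obtains J :: "('a, 'k) kmodule" and f where "injective J" "module_hom I J f" "module_ker I f = U" "essential (f ` carrier I) J"
proof -
  obtain N :: "('a, 'k) kmodule" and \<pi> where N: "fd_module N" "module_hom I N \<pi>" "\<pi> ` carrier I = carrier N"
    "module_ker I \<pi> = U"
    by (rule quotient_module[OF assms])
  have N_cat: "N \<in> mod_cat" using N(1) by (simp add: mod_cat_iff)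
  obtain J :: "('a, 'k) kmodule" and j where J: "injective J" "module_hom N J j" "inj_on j (carrier N)" "essential (j ` carrier N) J"
    by (rule injective_hull[OF N_cat])
  have "module_ker I (\<lambda>x. j (\<pi> x)) = U"
  proof -
    have "j (\<pi> x) = 0 \<longleftrightarrow> \<pi> x = 0" if "x \<in> carrier I" for x
      using hom_inj_iff[OF mod_cat_module[OF N_cat] J(2)] J(3) hom_in[OF N(2) that]
        hom_zero[OF mod_cat_module[OF N_cat] J(2)] by auto
    then show ?thesis using N(4) by (auto simp: module_ker_def)
  qed
  moreover have "(\<lambda>x. j (\<pi> x)) ` carrier I = j ` carrier N" unfolding N(3)[symmetric] by (simp add: image_image)
  ultimately show ?thesis using that[OF J(1) hom_compose[OF N(2) J(2)]] J(4) by simp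
qed

text \<open>Existence ensures that the choice in \<open>domdim\<close> picks an actual coresolution.
  The terms are built recursively as hulls of the successive cokernels.\<close>

lemma minimal_injective_coresolution_exists:
  fixes N :: "('a, 'm::ab_group_add) rmodule"
  assumes fd: "fd_module N"
  shows "\<exists>I \<epsilon> d. minimal_injective_coresolution N I \<epsilon> d"
proof -
  obtain B \<phi> where B: "B \<in> mod_cat" "module_iso N B \<phi>" by (rule mod_cat_copy[OF fd])
  obtain I0 :: "('a, 'k) kmodule" and i where I0: "injective I0" "module_hom B I0 i"
    "inj_on i (carrier B)" "essential (i ` carrier B) I0"
    by (rule injective_hull[OF B(1)])
  \<comment> \<open>A state is a term together with the image of the preceding map, which the next
    map must have as its kernel.\<close>
  define good :: "('a, 'k) kmodule \<times> (nat \<Rightarrow> 'k) set \<Rightarrow> bool"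
    where "good s \<longleftrightarrow> fd_module (fst s) \<and> submodule (snd s) (fst s)" for s
  define step :: "('a, 'k) kmodule \<times> (nat \<Rightarrow> 'k) set \<Rightarrow> ('a, 'k) kmodule \<times> ((nat \<Rightarrow> 'k) \<Rightarrow> nat \<Rightarrow> 'k) \<Rightarrow> bool"
    where "step s t \<longleftrightarrow> injective (fst t) \<and> module_hom (fst s) (fst t) (snd t) \<and>
      module_ker (fst s) (snd t) = snd s \<and> essential (snd t ` carrier (fst s)) (fst t)" for s t
  \<comment> \<open>The guard \<open>good\<close> makes the claim hold for every state, so that a
    choice function \<open>F\<close> on all states exists.\<close>
  have "\<exists>t. good s \<longrightarrow> step s t" for s
  proof (cases "good s")
    case True
    then have s: "fd_module (fst s)" "submodule (snd s) (fst s)" by (auto simp: good_def)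
    obtain J :: "('a, 'k) kmodule" and f where "injective J" "module_hom (fst s) J f"
      "module_ker (fst s) f = snd s" "essential (f ` carrier (fst s)) J"
      by (rule cosyzygy_step[OF s])
    then show ?thesis by (intro exI[of _ "(J, f)"]) (simp add: step_def)
  qed simp
  then obtain F where F: "\<And>s. good s \<Longrightarrow> step s (F s)" by metis
  define S where "S = rec_nat (I0, i ` carrier B) (\<lambda>_ s. (fst (F s), snd (F s) ` carrier (fst s)))"
  have S_0: "S 0 = (I0, i ` carrier B)" and S_Suc: "S (Suc n) = (fst (F (S n)), snd (F (S n)) ` carrier (fst (S n)))" for n
    by (simp_all add: S_def)
  have good: "good (S n)" for n
  proof (induction n)
    case 0
    show ?case using I0(4) injective_fd[OF I0(1)] by (simp add: S_0 good_def essential_def)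
  next
    case (Suc n)
    have "step (S n) (F (S n))" by (rule F[OF Suc])
    then show ?case using injective_fd[of "fst (F (S n))"] by (simp add: S_Suc good_def step_def essential_def)
  qed
  have st: "step (S n) (F (S n))" for n by (rule F[OF good])
  have inj: "injective (fst (S n))" for n
    by (cases n) (use I0(1) st in \<open>auto simp: S_0 S_Suc step_def\<close>)
  have \<phi>: "module_hom N B \<phi>" "inj_on \<phi> (carrier N)" "\<phi> ` carrier N = carrier B"
    using B(2) by (auto simp: module_iso_def bij_betw_def)
  have image: "(\<lambda>x. i (\<phi> x)) ` carrier N = i ` carrier B"
    unfolding \<phi>(3)[symmetric] by (simp add: image_image)
  have inj\<epsilon>: "inj_on (\<lambda>x. i (\<phi> x)) (carrier N)"
    using comp_inj_on[OF \<phi>(2), of i] I0(3) by (simp add: \<phi>(3) o_def)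
  have "minimal_injective_coresolution N (\<lambda>n. fst (S n)) (\<lambda>x. i (\<phi> x)) (\<lambda>n. snd (F (S n)))"
    unfolding minimal_injective_coresolution_def injective_coresolution_def
  proof (intro conjI allI)
    show "injective (fst (S n))" for n by (rule inj)
    show "module_hom N (fst (S 0)) (\<lambda>x. i (\<phi> x))" using hom_compose[OF \<phi>(1) I0(2)] by (simp add: S_0)
    show "module_hom (fst (S n)) (fst (S (Suc n))) (snd (F (S n)))" for n
      using st[of n] by (simp add: S_Suc step_def)
    show "inj_on (\<lambda>x. i (\<phi> x)) (carrier N)" by (rule inj\<epsilon>)
    show "(\<lambda>x. i (\<phi> x)) ` carrier N = module_ker (fst (S 0)) (snd (F (S 0)))"
      using st[of 0] unfolding image by (simp add: S_0 step_def)
    show "snd (F (S n)) ` carrier (fst (S n)) = module_ker (fst (S (Suc n))) (snd (F (S (Suc n))))" for n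
      using st[of "Suc n"] by (simp add: step_def S_Suc)
    show "essential ((\<lambda>x. i (\<phi> x)) ` carrier N) (fst (S 0))" unfolding image using I0(4) by (simp add: S_0)
    show "essential (snd (F (S n)) ` carrier (fst (S n))) (fst (S (Suc n)))" for n
      using st[of n] by (simp add: S_Suc step_def)
  qed
  then show ?thesis by blast
qed

section \<open>Dominant and finitistic dimension\<close>

lemma NGAS_domdim_eq_findim:
  assumes "NGAS"
  shows "dominant_dimension = finitistic_dimension"
proof -
  let ?A = "regular_module :: ('a, 'a) rmodule"
  \<comment> \<open>The very coresolution chosen in \<open>domdim\<close>, so that its terms decide
    the dominant dimension.\<close>
  define I where "I = (SOME I. \<exists>\<epsilon> d. minimal_injective_coresolution ?A I \<epsilon> d)"
  obtain \<epsilon> d where res: "minimal_injective_coresolution ?A I \<epsilon> d"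
    unfolding I_def using someI_ex[OF minimal_injective_coresolution_exists[OF fd_regular]] by blast
  have nsi: "\<not> injective ?A" and uniq: unique_noninjective
    and dd1: "1 \<le> dominant_dimension"
    using assms by (simp_all add: NGAS_def selfinjective_def unique_noninjective_def)
  have dd: "dominant_dimension = (if \<not> projective (I 0) then 0 else Sup {enat n |n. \<forall>i\<le>n. projective (I i)} + 1)"
    by (simp add: dominant_dimension_def domdim_def I_def Let_def)
  have I0_proj: "projective (I 0)" using dd dd1 by (auto split: if_splits)
  have inj: "injective (I n)" and d: "module_hom (I n) (I (Suc n)) (d n)"
    and ex: "d n ` carrier (I n) = module_ker (I (Suc n)) (d (Suc n))" for n
    using res by (simp_all add: minimal_injective_coresolution_def injective_coresolution_def)
  have \<epsilon>: "module_hom ?A (I 0) \<epsilon>" "inj_on \<epsilon> (carrier ?A)" "\<epsilon> ` carrier ?A = module_ker (I 0) (d 0)"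
    using res by (simp_all add: minimal_injective_coresolution_def injective_coresolution_def)
  \<comment> \<open>These kernels are the images of the preceding maps, which are essential by
    minimality.\<close>
  have ess: "essential (module_ker (I n) (d n)) (I n)" for n
    using res unfolding minimal_injective_coresolution_def
    by (cases n) (auto simp: ex[symmetric] \<epsilon>(3)[symmetric])
  have I_cat: "I n \<in> mod_cat" for n using injective_fd[OF inj] by (simp add: mod_cat_iff)
  note rI = mod_cat_module[OF I_cat]
  \<comment> \<open>The cosyzygies of \<open>A\<close>; \<open>C 0\<close> is a copy of
    \<open>A\<close> itself.\<close>
  define C where "C n = syz (I n) (d n)" for n
  have C_cat: "C n \<in> mod_cat" for n
    unfolding C_def by (rule mod_cat_ker[OF I_cat rI d])
  have "module_iso ?A (C 0) \<epsilon>"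
    using \<epsilon> hom_into[OF \<epsilon>(1), of "module_ker (I 0) (d 0)"] by (simp add: module_iso_def C_def bij_betw_def)
  then have isoC: "isomorphic ?A (C 0)" by (auto simp: isomorphic_def)
  \<comment> \<open>As long as the terms are projective, the coresolution read backwards is a
    projective resolution: \<open>I n\<close> covers \<open>C (Suc n)\<close> with syzygy
    \<open>C n\<close>.\<close>
  have cov: "covers (I n) (d n) (C (Suc n))" if "projective (I n)" for n
    using that hom_into[OF d, of n "module_ker (I (Suc n)) (d (Suc n))"]
    by (simp add: covers_def C_def ex)
  have C0_proj: "projective (C 0)"
    using projective_retract[OF projective_regular _
        isomorphic_retract[OF mod_cat_module[OF C_cat] iso_sym[OF fd_right_module[OF fd_regular] isoC]]]
      C_cat by (simp add: mod_cat_iff)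
  have C0_inj: "\<not> injective (C 0)"
    using injective_retract[OF _ fd_regular isomorphic_retract[OF fd_right_module[OF fd_regular] isoC]] nsi by blast
  have upper: "pdle n (C n)" if "\<forall>k<n. projective (I k)" for n
    using that
  proof (induction n)
    case 0
    show ?case using C0_proj by simp
  next
    case (Suc n)
    then have "pdle n (syz (I n) (d n))" by (simp add: C_def)
    then show ?case using cov[of n] Suc(2) C_cat by auto
  qed
  \<comment> \<open>If \<open>C 1\<close> were projective, \<open>0 \<rightarrow> C 0 \<rightarrow>
    I 0 \<rightarrow> C 1 \<rightarrow> 0\<close> would split and make \<open>A\<close> injective.
    The higher cases reduce to this one by taking syzygies.\<close>
  have lower: "\<not> pdle n (C (Suc n))" if "\<forall>k<Suc n. projective (I k)" for n
    using that
  proof (induction n)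
    case 0
    have c: "covers (I 0) (d 0) (C 1)" using cov[of 0] 0 by simp
    show ?case
    proof
      assume "pdle 0 (C (Suc 0))"
      then have C1: "projective (C 1)" by simp
      obtain s where s: "module_hom (C 1) (I 0) s" "\<forall>x\<in>carrier (C 1). d 0 (s x) = x"
        by (rule covers_lift[OF c C_cat C1 hom_id])
      have sd: "module_hom (I 0) (I 0) (\<lambda>x. s (d 0 x))" by (rule hom_compose[OF covers_hom[OF c] s(1)])
      have "module_hom (I 0) (C 0) (\<lambda>x. x - s (d 0 x))"
        unfolding C_def
      proof (rule hom_syz[OF hom_minus[OF rI hom_id sd]])
        fix x assume x: "x \<in> carrier (I 0)"
        show "d 0 (x - s (d 0 x)) = 0"
          using hom_diff[OF rI d x hom_in[OF sd x]] s(2) hom_in[OF covers_hom[OF c] x] by simp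
      qed
      moreover have "x - s (d 0 x) = x" if "x \<in> carrier (C 0)" for x
        using that hom_zero[OF mod_cat_module[OF C_cat] s(1)] by (simp add: C_def ker_iff)
      moreover have "module_hom (C 0) (I 0) (\<lambda>x. x)" unfolding C_def by (rule hom_incl[OF ker_subset])
      ultimately have "retract (C 0) (I 0)" unfolding retract_def by blast
      then show False using injective_retract[OF inj] C_cat C0_inj by (auto simp: mod_cat_iff)
    qed
  next
    case (Suc n)
    have "pdle n (C (Suc n))" if "pdle (Suc n) (C (Suc (Suc n)))"
      using pdle_syz[OF that cov] Suc(2) by (simp add: C_def)
    then show ?case using Suc by auto
  qed
  \<comment> \<open>\<open>C (Suc n)\<close> has projective dimension exactly \<open>Suc n\<close>
    and so bounds the finitistic dimension from below.\<close>
  have findim_ge: "enat (Suc n) \<le> finitistic_dimension" if "\<forall>k<Suc n. projective (I k)" for n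
  proof -
    have "enat (Suc n) \<le> projdim (C (Suc n))"
      unfolding projdim_pdle[OF C_cat]
    proof (rule Inf_greatest)
      fix x assume "x \<in> {enat m |m. pdle m (C (Suc n))}"
      then obtain m where m: "x = enat m" "pdle m (C (Suc n))" by blast
      have "\<not> m \<le> n" using lower[OF that] pdle_mono[OF _ m(2)] by blast
      then show "enat (Suc n) \<le> x" using m(1) by simp
    qed
    moreover have "projdim (C (Suc n)) \<le> enat (Suc n)"
      unfolding projdim_pdle[OF C_cat] using upper[OF that] by (intro Inf_lower) blast
    then have "projdim (C (Suc n)) < \<infinity>" by (rule order.strict_trans1) simp
    then have "C (Suc n) \<in> P_fin" using C_cat by (simp add: P_fin_def)
    then have "projdim (C (Suc n)) \<le> finitistic_dimension"
      unfolding finitistic_dimension_def by (intro Sup_upper imageI)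
    ultimately show ?thesis by (rule order_trans)
  qed
  show ?thesis
  proof (cases "\<forall>n. projective (I n)")
    \<comment> \<open>With all terms projective, both dimensions are at least every natural
      number.\<close>
    case True
    have "enat n \<le> finitistic_dimension" "enat n \<le> dominant_dimension" for n
    proof -
      have "enat n \<le> enat (Suc n)" by simp
      also have "\<dots> \<le> finitistic_dimension" using True by (intro findim_ge) simp
      finally show "enat n \<le> finitistic_dimension" .
      have "enat n \<le> Sup {enat n |n. \<forall>i\<le>n. projective (I i)}" using True by (intro Sup_upper) auto
      also have "\<dots> \<le> dominant_dimension" using dd True by simp
      finally show "enat n \<le> dominant_dimension" .
    qed
    then have "finitistic_dimension = \<infinity>" "dominant_dimension = \<infinity>"
      by (metis Suc_n_not_le_n enat_ord_simps(1) not_infinity_eq)+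
    then show ?thesis by simp
  next
    case False
    define m where "m = (LEAST m. \<not> projective (I m))"
    have m: "\<not> projective (I m)" using False LeastI_ex unfolding m_def by metis
    have less_m: "projective (I k)" if "k < m" for k using not_less_Least that unfolding m_def by metis
    \<comment> \<open>The dominant dimension is at least one, so \<open>I 0\<close> is
      projective.\<close>
    have "m \<noteq> 0" using m I0_proj by metis
    then obtain l where l: "m = Suc l" using not0_implies_Suc by blast
    \<comment> \<open>The largest index up to which all terms are projective is
      \<open>l = m - 1\<close>; the \<open>+ 1\<close> in \<open>domdim\<close> then makes the
      dominant dimension \<open>m\<close>.\<close>
    have "Sup {enat n |n. \<forall>i\<le>n. projective (I i)} = enat l"
    proof (rule antisym)
      show "Sup {enat n |n. \<forall>i\<le>n. projective (I i)} \<le> enat l"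
      proof (rule Sup_least)
        fix x assume "x \<in> {enat n |n. \<forall>i\<le>n. projective (I i)}"
        then obtain n where n: "x = enat n" "\<forall>i\<le>n. projective (I i)" by blast
        then have "\<not> m \<le> n" using m by blast
        then show "x \<le> enat l" using n(1) l by simp
      qed
      show "enat l \<le> Sup {enat n |n. \<forall>i\<le>n. projective (I i)}"
        using less_m l by (intro Sup_upper) auto
    qed
    then have dm: "dominant_dimension = enat m" using dd I0_proj l by (simp add: one_enat_def)
    \<comment> \<open>A module of larger finite projective dimension would force \<open>I m\<close>
      to be projective.\<close>
    have "projdim Z \<le> enat m" if Z: "Z \<in> P_fin" for Z
    proof (rule ccontr)
      assume big: "\<not> projdim Z \<le> enat m"
      have Z_cat: "Z \<in> mod_cat" and fin: "projdim Z < \<infinity>" using Z by (auto simp: P_fin_def)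
      have not_small: "\<not> pdle n Z" if "n \<le> m" for n
      proof
        assume "pdle n Z"
        then have "projdim Z \<le> enat n" unfolding projdim_pdle[OF Z_cat] by (intro Inf_lower) blast
        also have "\<dots> \<le> enat m" using that by simp
        finally show False using big by blast
      qed
      \<comment> \<open>Otherwise the projective dimension would be the infimum of the empty set,
        which is \<open>\<infinity>\<close>.\<close>
      have "\<exists>n. pdle n Z"
      proof (rule ccontr)
        assume "\<nexists>n. pdle n Z"
        then have "projdim Z = Inf {}" unfolding projdim_pdle[OF Z_cat] by simp
        then show False using fin by (simp add: top_enat_def)
      qed
      \<comment> \<open>\<open>n\<close> is the exact projective dimension of \<open>Z\<close>;
        writing it as \<open>Suc t\<close>, the bound \<open>m < n\<close> becomes
        \<open>m \<le> t\<close>.\<close>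
      then obtain n where n: "pdle n Z" "\<And>k. k < n \<Longrightarrow> \<not> pdle k Z"
        using exists_least_iff[of "\<lambda>n. pdle n Z"] by blast
      have "m < n" using not_small n(1) not_less by blast
      then obtain t where t: "n = Suc t" "m \<le> t" by (metis less_Suc_eq_le lessE order_less_imp_le)
      obtain W where W: "syzygy t W" "pdle 1 W" "\<not> projective W"
        using syzygy_of_projdim_one[of t Z] n t(1) by blast
      \<comment> \<open>The induction starts at \<open>i = 0\<close>, where Ext^1 into the injective
        module \<open>I m\<close> vanishes for every module; the length \<open>Suc m\<close> is
        allowed because \<open>m \<le> t\<close>.\<close>
      have chain: "injchain (Suc m) (I m)"
        by (rule orth_injchain[OF uniq W(2,3,1) I_cat, of 0])
           (use t(2) orth_injective inj in auto)
      have incl: "module_hom (C m) (I m) (\<lambda>x. x)" unfolding C_def by (rule hom_incl[OF ker_subset])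
      have "pdle m (C m)" using upper less_m by blast
      \<comment> \<open>\<open>C m\<close> has projective dimension at most \<open>m\<close> and the
        chain has length \<open>m + 1\<close>, so the inclusion of \<open>C m\<close> into
        \<open>I m\<close> lifts to \<open>Q\<close>.\<close>
      from injchain_lift[OF this I_cat chain incl]
      obtain Q q h where Q: "covers Q q (I m)" "injective Q" and h: "module_hom (C m) Q h" "\<forall>x\<in>carrier (C m). q (h x) = x"
        by auto
      have sub: "submodule (module_ker (I m) (d m)) (I m)" using ess[of m] by (simp add: essential_def)
      obtain h' where h': "module_hom (I m) Q h'" "\<forall>x\<in>module_ker (I m) (d m). h' x = h x"
        by (rule injective_extend[OF Q(2) I_cat sub h(1)[unfolded C_def]])
      have rQ: "right_module Q" by (rule covers_module[OF Q(1)])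
      \<comment> \<open>On \<open>C m\<close> the composite \<open>q \<circ> h\<close> is the
        identity, so \<open>h'\<close> has no kernel there; essentiality of \<open>C m\<close>
        extends this to all of \<open>I m\<close>.\<close>
      have "module_ker (I m) (d m) \<inter> module_ker (I m) h' = {0}"
      proof
        show "module_ker (I m) (d m) \<inter> module_ker (I m) h' \<subseteq> {0}"
        proof
          fix x assume x: "x \<in> module_ker (I m) (d m) \<inter> module_ker (I m) h'"
          then have "h x = 0" using h'(2) by (metis IntE ker_iff)
          then have "x = q 0" using h(2) x by (auto simp: C_def)
          then show "x \<in> {0}" using hom_zero[OF rQ covers_hom[OF Q(1)]] by simp
        qed
        show "{0} \<subseteq> module_ker (I m) (d m) \<inter> module_ker (I m) h'"
          using sub_zero[OF sub] sub_zero[OF submodule_ker[OF rI rQ h'(1)]] by simp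
      qed
      then have "module_ker (I m) h' = {0}"
        using ess[of m] submodule_ker[OF rI rQ h'(1)] unfolding essential_def by blast
      then have mono: "inj_on h' (carrier (I m))"
        using hom_inj_iff[OF rI h'(1)] by (auto simp: module_ker_def)
      \<comment> \<open>\<open>I m\<close> is injective, so its embedding into the projective module
        \<open>Q\<close> splits.\<close>
      obtain r where r: "module_hom Q (I m) r" "\<forall>x\<in>carrier (I m). r (h' x) = x"
        by (rule injective_extend_mono[OF inj I_cat covers_cat[OF Q(1)] h'(1) mono hom_id])
      have "retract (I m) Q" unfolding retract_def using h'(1) r by blast
      then have "projective (I m)"
        by (rule projective_retract[OF covers_projective[OF Q(1)] injective_fd[OF inj]])
      then show False using m by blast
    qed
    then have "finitistic_dimension \<le> enat m"
      unfolding finitistic_dimension_def by (intro Sup_least) blast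
    moreover have "enat m \<le> finitistic_dimension" unfolding l by (rule findim_ge) (use less_m l in simp)
    ultimately show ?thesis using dm by simp
  qed
qed

lemma NGAS_weak_finitistic_Auslander: "NGAS \<Longrightarrow> weak_finitistic_Auslander"
  using NGAS_domdim_eq_findim unfolding NGAS_def weak_finitistic_Auslander_def
  by (metis not_one_le_zero not_gr_zero)

end

theorem corollary5p7:
  fixes scale :: "'k::field \<Rightarrow> 'a::ring_1 \<Rightarrow> 'a"
  assumes "fd_algebra scale"
    and "fd_algebra.NGAS scale"
  shows "(fd_algebra.contravariantly_finite scale (fd_algebra.P_fin scale) \<longrightarrow>
            fd_algebra.weak_finitistic_Auslander scale) \<and>
         (fd_algebra.representation_finite scale \<longrightarrow>
            fd_algebra.weak_finitistic_Auslander scale) \<and>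
         (fd_algebra.Gorenstein scale \<longrightarrow>
            fd_algebra.weak_finitistic_Auslander scale)"
  using fd_algebra.NGAS_weak_finitistic_Auslander[OF assms] by blast

end
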